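(* Let $\Omega$ be an $n$-dimensional oriented manifold with a finite oriented cell complex $D$, let $\mathcal{R}:\Lambda^k(\Omega)\to C^k(D)$ be the reduction operators, let $\mathcal{I}:C^k(D)\to\Lambda^k_h(\Omega;C_k)\subset\Lambda^k(\Omega)$ be reconstruction operators (so that $\mathcal{R}\mathcal{I}=\mathrm{Id}$ and $\mathrm{d}\mathcal{I}=\mathcal{I}\delta$ on $C^k(D)$), and let $\pi_h:=\mathcal{I}\circ\mathcal{R}$ be the associated projection operators. Then the projection commutes with the exterior derivative: $$\mathrm{d}\,\pi_h a^{(k)}=\pi_h\,\mathrm{d}a^{(k)}\qquad\text{for all } a^{(k)}\in\Lambda^k(\Omega).$$
   Context: **Differential forms.** $\Omega\subset\mathbb{R}^n$ is a sufficiently smooth, bounded (compact, with boundary), oriented $n$-dimensional manifold. $\Lambda^k(\Omega)$ is the space of differential $k$-forms $a^{(k)}=\sum_I f_I\,\mathrm{d}x^{i_1}\wedge\cdots\wedge \mathrm{d}x^{i_k}$, $I=(i_1,\dots,i_k)$ with $1\le i_1<\dots<i_k\le n$, whose coefficient functions $f_I$ are continuously differentiable on $\Omega$. $\mathrm{d}$ is the exterior derivative, raising the degree of a form by one. **Cell complex.** A $k$-cell $\tau_{(k)}$ in $\Omega$ is (given by) a map $[0,1]^k\to\Omega$, smooth enough for $k$-forms to be integrated over it, with a chosen default orientation. A cell complex $D$ in $\Omega$ is a finite collection of cells such that: (1) the $n$-cells of $D$ cover $\Omega$; (2) every face of a cell of $D$ is in $D$; (3) the intersection of two $k$-cells $\tau_{(k)},\sigma_{(k)}$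 of $D$ is either a common $l$-cell of $D$ with $0\le l\le k-1$, or is empty, or $\tau_{(k)}=\sigma_{(k)}$. **Chains and boundary.** $C_k(D)$ is the space of $k$-chains, i.e. formal linear combinations $\mathbf{c}_{(k)}=\sum_i c^i\tau_{(k),i}$ of the $k$-cells of $D$. The boundary operator $\partial:C_k(D)\to C_{k-1}(D)$ is the linear map with $\partial\tau_{(k),i}=\sum_j e_i^j\,\tau_{(k-1),j}$, where $e_i^j=1$ (resp. $-1$) if $\tau_{(k-1),j}$ is a face of $\tau_{(k),i}$ whose orientation induced from $\tau_{(k),i}$ equals (resp. is opposite to) its default orientation, and $e_i^j=0$ if $\tau_{(k-1),j}$ is not a face of $\tau_{(k),i}$. The boundary of a $0$-cell is empty. Integration of forms over chains is defined by linearity, $\int_{\mathbf{c}_{(k)}}a^{(k)}=\sum_i c^i\int_{\tau_{(k),i}}a^{(k)}$, and the generalized Stokes theorem $\int_{\mathbf{c}_{(k+1)}}\mathrm{d}a^{(k)}=\int_{\partial\mathbf{c}_{(k+1)}}a^{(k)}$ holds for all $a^{(k)}\in\Lambda^k(\Omega)$ and $\mathbf{c}_{(k+1)}\in C_{k+1}(D)$. **Cochains and coboundary.** $C^k(D)$ is the space of $k$-cochains, i.e. linear functionals $\mathbf{c}^{(k)}:C_k(D)\to\mathbb{R}$, with duality pairing $\langle\mathbf{c}^{(k)},\mathbf{c}_{(k)}\rangle:=\mathbf{c}^{(k)}(\mathbf{c}_{(k)})$. The coboundary operator $\delta:C^k(D)\to C^{k+1}(D)$ is defined by $\langle\delta\mathbf{c}^{(k)},\mathbf{c}_{(k+1)}\rangle=\langle\mathbf{c}^{(k)},\partial\mathbf{c}_{(k+1)}\rangle$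 for all $\mathbf{c}^{(k)}\in C^k(D)$, $\mathbf{c}_{(k+1)}\in C_{k+1}(D)$. **Reduction.** $\mathcal{R}:\Lambda^k(\Omega)\to C^k(D)$ is defined by integration: $\langle\mathcal{R}a^{(k)},\tau_{(k)}\rangle:=\int_{\tau_{(k)}}a^{(k)}$ for all $k$-cells $\tau_{(k)}$ of $D$, extended linearly to chains, so $\langle\mathcal{R}a^{(k)},\mathbf{c}_{(k)}\rangle=\int_{\mathbf{c}_{(k)}}a^{(k)}$. The same formula defines $\mathcal{R}$ on $\mathrm{d}a^{(k)}$ for $a^{(k)}\in\Lambda^k(\Omega)$, even when its coefficients are only continuous. **Reconstruction.** A reconstruction operator is a family (one for each degree $k$) of linear maps $\mathcal{I}:C^k(D)\to\Lambda^k_h(\Omega;C_k)$ into finite-dimensional subspaces $\Lambda^k_h(\Omega;C_k)\subset\Lambda^k(\Omega)$ satisfying: (i) consistency, $\mathcal{R}\mathcal{I}=\mathrm{Id}$ on $C^k(D)$; (ii) $\mathrm{d}\mathcal{I}=\mathcal{I}\delta$ on $C^k(D)$. **Projection.** $\pi_h:=\mathcal{I}\circ\mathcal{R}:\Lambda^k(\Omega)\to\Lambda^k_h(\Omega;C_k)$, where on both sides of the identity the operators in the appropriate degree ($k$ or $k+1$) are used. *)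

theory Defs
  imports "HOL-Analysis.Analysis" "Jordan_Normal_Form.Determinant"
begin

no_notation vec_index (infixl "$" 100)

definition C1_on :: "'a::real_normed_vector set \<Rightarrow> ('a \<Rightarrow> 'b::real_normed_vector) \<Rightarrow> bool" where
  "C1_on S f \<longleftrightarrow> f differentiable_on S \<and>
     (\<forall>v. continuous_on S (\<lambda>x. frechet_derivative f (at x within S) v))"

text \<open>Compact \<open>n\<close>-dimensional \<open>C\<^sup>1\<close>-submanifold of \<open>\<real>\<^sup>n\<close> with boundary. \<open>K\<close> is the set of
  coordinates that vanish on the boundary pieces through \<open>p\<close>: \<open>K = {}\<close> at interior points,
  a singleton at smooth boundary points; larger \<open>K\<close> admits corners, so that the boundary may be
  piecewise smooth as for a cube. An \<open>n\<close>-dimensional submanifold of \<open>\<real>\<^sup>n\<close> is oriented by the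
  standard orientation of \<open>\<real>\<^sup>n\<close>, so the orientation carries no extra data.\<close>

definition compact_manifold :: "(real ^ 'n::finite) set \<Rightarrow> bool" where
  "compact_manifold \<Omega> \<longleftrightarrow> compact \<Omega> \<and>
     (\<forall>p\<in>\<Omega>. \<exists>U V \<Phi> \<Psi> K. open U \<and> p \<in> U \<and> open V \<and> homeomorphism U V \<Phi> \<Psi> \<and>
        C1_on U \<Phi> \<and> C1_on V \<Psi> \<and>
        \<Phi> ` (\<Omega> \<inter> U) = {y \<in> V. \<forall>i\<in>K. 0 \<le> (y :: real ^ 'n) $ i})"

text \<open>A form \<open>\<Sum>\<^sub>I f\<^sub>I dx\<^sup>I\<close> is its family of coefficients, indexed by the strictly increasing
  lists \<open>I\<close>. Coefficients are normalised to \<open>0\<close> off \<open>\<Omega>\<close> and at all other lists, so that equality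
  of forms on \<open>\<Omega>\<close> is equality in HOL.\<close>

type_synonym 'n form = "'n list \<Rightarrow> real ^ 'n \<Rightarrow> real"

definition multi_indices :: "nat \<Rightarrow> 'n::{finite,wellorder} list set" where
  "multi_indices k = {I. length I = k \<and> sorted_wrt (<) I}"

definition forms :: "(real ^ 'n::{finite,wellorder}) set \<Rightarrow> nat \<Rightarrow> 'n form set" where
  "forms \<Omega> k = {a. (\<forall>I\<in>multi_indices k. C1_on \<Omega> (a I)) \<and>
     (\<forall>I x. I \<notin> multi_indices k \<or> x \<notin> \<Omega> \<longrightarrow> a I x = 0)}"

text \<open>Coefficient of \<open>dx\<^sup>J\<close>, \<open>J = (j\<^sub>0 < \<dots> < j\<^sub>k)\<close>, in \<open>\<Sum>\<^sub>I \<Sum>\<^sub>j \<partial>\<^sub>j f\<^sub>I dx\<^sup>j \<and> dx\<^sup>I\<close>: the contributing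
  pairs are \<open>j = j\<^sub>r\<close>, \<open>I = J\<close> without \<open>j\<^sub>r\<close>, with sign \<open>(-1)\<^sup>r\<close>.\<close>

definition ext_deriv ::
  "(real ^ 'n::{finite,wellorder}) set \<Rightarrow> nat \<Rightarrow> 'n form \<Rightarrow> 'n form" where
  "ext_deriv \<Omega> k a = (\<lambda>J x. if J \<in> multi_indices (Suc k) \<and> x \<in> \<Omega>
     then \<Sum>r\<le>k. (-1) ^ r *
       frechet_derivative (a (take r J @ drop (Suc r) J)) (at x within \<Omega>) (axis (J ! r) 1)
     else 0)"

definition cube :: "nat \<Rightarrow> (nat \<Rightarrow> real) set" where
  "cube k = {..<k} \<rightarrow>\<^sub>E {0..1}"

definition cube_partial ::
  "((nat \<Rightarrow> real) \<Rightarrow> 'b::real_normed_vector) \<Rightarrow> nat \<Rightarrow> (nat \<Rightarrow> real) \<Rightarrow> 'b" where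
  "cube_partial f j x = vector_derivative (\<lambda>t. f (x(j := t))) (at (x j) within {0..1})"

definition cube_C1 :: "nat \<Rightarrow> ((nat \<Rightarrow> real) \<Rightarrow> 'b::real_normed_vector) \<Rightarrow> bool" where
  "cube_C1 k f \<longleftrightarrow> continuous_on (cube k) f \<and>
     (\<forall>j<k. (\<forall>x\<in>cube k. (\<lambda>t. f (x(j := t))) differentiable (at (x j) within {0..1})) \<and>
            continuous_on (cube k) (cube_partial f j))"

text \<open>The default orientation \<open>corient \<in> {1, -1}\<close> is relative to the standard orientation of
  the cube, transported by the map; values of the map off the cube are irrelevant.\<close>

datatype 'n cell =
  Cell (cdim: nat) (cmap: "(nat \<Rightarrow> real) \<Rightarrow> real ^ 'n::finite") (corient: real)

definition carrier_of :: "'n::finite cell \<Rightarrow> (real ^ 'n) set" where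
  "carrier_of \<tau> = cmap \<tau> ` cube (cdim \<tau>)"

definition cell_in :: "(real ^ 'n::finite) set \<Rightarrow> 'n cell \<Rightarrow> bool" where
  "cell_in \<Omega> \<tau> \<longleftrightarrow> cube_C1 (cdim \<tau>) (cmap \<tau>) \<and> carrier_of \<tau> \<subseteq> \<Omega> \<and> corient \<tau> \<in> {1, -1}"

text \<open>Two parametrizations describe the same cell if they differ by a \<open>C\<^sup>1\<close>-diffeomorphism of the
  cube; the sign \<open>s\<close> of its Jacobian tells whether they induce the same orientation.\<close>

definition cube_diffeo :: "nat \<Rightarrow> real \<Rightarrow> ((nat \<Rightarrow> real) \<Rightarrow> nat \<Rightarrow> real) \<Rightarrow> bool" where
  "cube_diffeo k s \<psi> \<longleftrightarrow> s \<in> {1, -1} \<and> bij_betw \<psi> (cube k) (cube k) \<and>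
     (\<forall>i<k. cube_C1 k (\<lambda>x. \<psi> x i)) \<and>
     (\<forall>x\<in>cube k.
        sgn (Determinant.det (Matrix.mat k k (\<lambda>(i, j). cube_partial (\<lambda>y. \<psi> y i) j x))) = s)"

definition reparam ::
  "nat \<Rightarrow> real \<Rightarrow> ((nat \<Rightarrow> real) \<Rightarrow> 'b) \<Rightarrow> ((nat \<Rightarrow> real) \<Rightarrow> 'b) \<Rightarrow> bool" where
  "reparam k s f g \<longleftrightarrow> (\<exists>\<psi>. cube_diffeo k s \<psi> \<and> (\<forall>x\<in>cube k. g x = f (\<psi> x)))"

text \<open>The face \<open>x\<^sub>i = e\<close> of the \<open>(k+1)\<close>-cube, parametrized by the \<open>k\<close>-cube. Its orientation induced
  by the \<open>(k+1)\<close>-cube (outward normal first) is \<open>face_sign i e\<close> times that of the \<open>k\<close>-cube.\<close>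

definition cube_face :: "nat \<Rightarrow> nat \<Rightarrow> real \<Rightarrow> (nat \<Rightarrow> real) \<Rightarrow> nat \<Rightarrow> real" where
  "cube_face k i e x =
     (\<lambda>j\<in>{..<Suc k}. if j < i then x j else if j = i then e else x (j - 1))"

definition face_sign :: "nat \<Rightarrow> real \<Rightarrow> real" where
  "face_sign i e = (-1) ^ i * (if e = 1 then 1 else -1)"

definition face_map ::
  "'n::finite cell \<Rightarrow> nat \<Rightarrow> real \<Rightarrow> (nat \<Rightarrow> real) \<Rightarrow> real ^ 'n" where
  "face_map \<tau> i e = cmap \<tau> \<circ> cube_face (cdim \<tau> - 1) i e"

text \<open>Since elements of \<open>D\<close> are parametrized cells, the third conjunct says that every geometric
  cell occurs in \<open>D\<close> with only one parametrization and default orientation.\<close>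

definition cell_complex :: "(real ^ 'n::finite) set \<Rightarrow> 'n cell set \<Rightarrow> bool" where
  "cell_complex \<Omega> D \<longleftrightarrow> finite D \<and>
     (\<forall>\<tau>\<in>D. cell_in \<Omega> \<tau>) \<and>
     (\<forall>\<tau>\<in>D. \<forall>\<sigma>\<in>D. cdim \<tau> = cdim \<sigma> \<and> (\<exists>s. reparam (cdim \<sigma>) s (cmap \<sigma>) (cmap \<tau>)) \<longrightarrow> \<tau> = \<sigma>) \<and>
     \<Omega> = (\<Union>\<tau>\<in>{\<tau>\<in>D. cdim \<tau> = CARD('n)}. carrier_of \<tau>) \<and>
     (\<forall>\<tau>\<in>D. \<forall>i<cdim \<tau>. \<forall>e\<in>{0, 1}.
        \<exists>\<sigma>\<in>D. Suc (cdim \<sigma>) = cdim \<tau> \<and> (\<exists>s. reparam (cdim \<sigma>) s (cmap \<sigma>) (face_map \<tau> i e))) \<and>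
     (\<forall>\<tau>\<in>D. \<forall>\<sigma>\<in>D. cdim \<tau> = cdim \<sigma> \<longrightarrow>
        \<tau> = \<sigma> \<or> carrier_of \<tau> \<inter> carrier_of \<sigma> = {} \<or>
        (\<exists>\<rho>\<in>D. cdim \<rho> < cdim \<tau> \<and> carrier_of \<tau> \<inter> carrier_of \<sigma> = carrier_of \<rho>))"

type_synonym 'n chain = "'n cell \<Rightarrow> real"
type_synonym 'n cochain = "'n chain \<Rightarrow> real"

definition chains :: "'n::finite cell set \<Rightarrow> nat \<Rightarrow> 'n chain set" where
  "chains D k = {c. \<forall>\<tau>. \<tau> \<notin> D \<or> cdim \<tau> \<noteq> k \<longrightarrow> c \<tau> = 0}"

text \<open>\<open>1\<close> (\<open>-1\<close>) if \<open>\<sigma>\<close> is the face \<open>x\<^sub>i = e\<close> of \<open>\<tau>\<close> and the orientation induced from the oriented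
  cell \<open>\<tau>\<close> agrees with (is opposite to) the default orientation of \<open>\<sigma>\<close>; \<open>0\<close> if \<open>\<sigma>\<close> is not that
  face.\<close>

definition face_incidence :: "'n::finite cell \<Rightarrow> nat \<Rightarrow> real \<Rightarrow> 'n cell \<Rightarrow> real" where
  "face_incidence \<tau> i e \<sigma> = corient \<tau> * face_sign i e * corient \<sigma> *
     (if reparam (cdim \<sigma>) 1 (cmap \<sigma>) (face_map \<tau> i e) then 1
      else if reparam (cdim \<sigma>) (-1) (cmap \<sigma>) (face_map \<tau> i e) then -1
      else 0)"

text \<open>A cell with injective map has pairwise different faces, so at most one summand is nonzero and
  the incidence number is \<open>1\<close>, \<open>-1\<close> or \<open>0\<close>. The sum also accounts for maps that identify faces.\<close>

definition incidence :: "'n::finite cell \<Rightarrow> 'n cell \<Rightarrow> real" where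
  "incidence \<tau> \<sigma> = (if cdim \<tau> = Suc (cdim \<sigma>)
     then \<Sum>i<cdim \<tau>. \<Sum>e\<in>{0, 1}. face_incidence \<tau> i e \<sigma> else 0)"

definition boundary :: "'n::finite cell set \<Rightarrow> 'n chain \<Rightarrow> 'n chain" where
  "boundary D c = (\<lambda>\<sigma>. if \<sigma> \<in> D then \<Sum>\<tau>\<in>D. c \<tau> * incidence \<tau> \<sigma> else 0)"

text \<open>As for forms, cochains are normalised to \<open>0\<close> outside the space of \<open>k\<close>-chains.\<close>

definition cochains :: "'n::finite cell set \<Rightarrow> nat \<Rightarrow> 'n cochain set" where
  "cochains D k = {\<phi>.
     (\<forall>c\<in>chains D k. \<forall>c'\<in>chains D k. \<forall>r s.
        \<phi> (\<lambda>\<tau>. r * c \<tau> + s * c' \<tau>) = r * \<phi> c + s * \<phi> c') \<and>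
     (\<forall>c. c \<notin> chains D k \<longrightarrow> \<phi> c = 0)}"

definition coboundary :: "'n::finite cell set \<Rightarrow> nat \<Rightarrow> 'n cochain \<Rightarrow> 'n cochain" where
  "coboundary D k \<phi> = (\<lambda>c. if c \<in> chains D (Suc k) then \<phi> (boundary D c) else 0)"

text \<open>The minor of the Jacobian of \<open>f\<close> on the rows \<open>I\<close>, i.e. the coefficient of
  \<open>dx\<^sub>0 \<and> \<dots> \<and> dx\<^sub>k\<^sub>-\<^sub>1\<close> in the pullback of \<open>dx\<^sup>I\<close> along \<open>f\<close>.\<close>

definition jacobian_minor ::
  "nat \<Rightarrow> ((nat \<Rightarrow> real) \<Rightarrow> real ^ 'n::finite) \<Rightarrow> 'n list \<Rightarrow> (nat \<Rightarrow> real) \<Rightarrow> real" where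
  "jacobian_minor k f I x = Determinant.det (Matrix.mat k k (\<lambda>(i, j). cube_partial f j x $ (I ! i)))"

definition cell_integral :: "'n::{finite,wellorder} cell \<Rightarrow> 'n form \<Rightarrow> real" where
  "cell_integral \<tau> a = corient \<tau> *
     set_lebesgue_integral (PiM {..<cdim \<tau>} (\<lambda>_. lborel)) (cube (cdim \<tau>))
       (\<lambda>x. \<Sum>I\<in>multi_indices (cdim \<tau>). a I (cmap \<tau> x) * jacobian_minor (cdim \<tau>) (cmap \<tau>) I x)"

definition chain_integral :: "'n::{finite,wellorder} cell set \<Rightarrow> 'n chain \<Rightarrow> 'n form \<Rightarrow> real" where
  "chain_integral D c a = (\<Sum>\<tau>\<in>D. c \<tau> * cell_integral \<tau> a)"

definition reduction :: "'n::{finite,wellorder} cell set \<Rightarrow> nat \<Rightarrow> 'n form \<Rightarrow> 'n cochain" where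
  "reduction D k a = (\<lambda>c. if c \<in> chains D k then chain_integral D c a else 0)"

definition fin_dim_subspace :: "'n::finite form set \<Rightarrow> bool" where
  "fin_dim_subspace S \<longleftrightarrow>
     (\<exists>B. finite B \<and> S = range (\<lambda>r :: 'n form \<Rightarrow> real. \<lambda>I x. \<Sum>b\<in>B. r b * b I x))"

definition reconstruction ::
  "(real ^ 'n::{finite,wellorder}) set \<Rightarrow> 'n cell set \<Rightarrow> (nat \<Rightarrow> 'n form set) \<Rightarrow>
   (nat \<Rightarrow> 'n cochain \<Rightarrow> 'n form) \<Rightarrow> bool" where
  "reconstruction \<Omega> D \<Lambda>\<^sub>h \<I> \<longleftrightarrow> (\<forall>k.
     fin_dim_subspace (\<Lambda>\<^sub>h k) \<and> \<Lambda>\<^sub>h k \<subseteq> forms \<Omega> k \<and>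
     \<I> k ` cochains D k \<subseteq> \<Lambda>\<^sub>h k \<and>
     (\<forall>\<phi>\<in>cochains D k. \<forall>\<phi>'\<in>cochains D k. \<forall>r s.
        \<I> k (\<lambda>c. r * \<phi> c + s * \<phi>' c) = (\<lambda>I x. r * \<I> k \<phi> I x + s * \<I> k \<phi>' I x)) \<and>
     (\<forall>\<phi>\<in>cochains D k. reduction D k (\<I> k \<phi>) = \<phi>) \<and>
     (\<forall>\<phi>\<in>cochains D k. ext_deriv \<Omega> k (\<I> k \<phi>) = \<I> (Suc k) (coboundary D k \<phi>)))"

definition projection ::
  "'n::{finite,wellorder} cell set \<Rightarrow> (nat \<Rightarrow> 'n cochain \<Rightarrow> 'n form) \<Rightarrow> nat \<Rightarrow> 'n form \<Rightarrow> 'n form" where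
  "projection D \<I> k = \<I> k \<circ> reduction D k"

end

theory Submission
  imports Defs
begin

text \<open>
  Applying \<open>d \<I> = \<I> \<delta>\<close> on the left, both sides become values of the reconstruction operator:
  \<open>\<I> (\<delta> (R a))\<close> on the left, \<open>\<I> (R (d a))\<close> on the right. So it is enough that
  \<open>\<delta> (R a) = R (d a)\<close> (\<open>coboundary_reduction\<close>), which is the generalized Stokes theorem for the chains
  of the complex. By linearity it concerns one cell \<open>\<tau>\<close> of dimension \<open>k + 1\<close>, with three things to
  prove.

  Stokes' theorem on the cube. After pulling back along the parametrization, each coefficient
  \<open>a\<^sub>I\<close> contributes an integral of \<open>dg \<and> df\<^sub>1 \<and> \<dots> \<and> df\<^sub>k\<close> over the unit cube, where \<open>g = a\<^sub>I \<circ> \<tau>\<close>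
  and the \<open>f\<^sub>i\<close> are components of \<open>\<tau>\<close>; regrouping these wedge products is \<open>wedge_row_expansion\<close>.
  All these functions live on the cube and are merely \<open>C\<^sup>1\<close>, since cells and forms need not have
  second derivatives. If the \<open>f\<^sub>i\<close> have continuous mixed second derivatives, the integrand is a
  divergence by the Piola identity, and the fundamental theorem of calculus gives the faces
  (\<open>stokes_smooth\<close>). Averaging the \<open>f\<^sub>i\<close> over short segments, one coordinate after another,
  supplies these derivatives; the averages use values on the closed cube only and converge together
  with their first derivatives, so that dominated convergence yields the \<open>C\<^sup>1\<close> case (\<open>cube_stokes\<close>).
  Smoothing the \<open>f\<^sub>i\<close> while \<open>g\<close> is kept as a function on the cube avoids evaluating the form on a
  smoothed cell, which could leave \<open>\<Omega>\<close>.

  Independence of the parametrization. A face of \<open>\<tau>\<close> is a cell of the complex only up to a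
  diffeomorphism of the cube, so the change of variables formula must turn the integral over the
  face into the integral over that cell, with the sign of the Jacobian (\<open>pullback_reparam\<close>).

  Uniqueness of the face. The incidence numbers are summed over all cells of the complex, so a face
  must be represented by exactly one cell. Reparametrizations can be composed and
  inverted, the inverse being \<open>C\<^sup>1\<close> up to the boundary of the cube (\<open>cube_diffeo_inverse\<close>). Hence two cells
  representing the same face are reparametrizations of each other, and the complex contains only one
  of them (\<open>face_incidence_sum\<close>).
\<close>

section \<open>Determinants of square arrays\<close>

text \<open>The Jacobians of maps between cubes are naturally indexed by numbers below a variable bound, so
  determinants are used in the form of a function of such an array.\<close>

definition sqdet :: "nat \<Rightarrow> (nat \<Rightarrow> nat \<Rightarrow> real) \<Rightarrow> real" where
  "sqdet n A = Determinant.det (Matrix.mat n n (\<lambda>(i, j). A i j))"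

text \<open>The increasing enumeration of the numbers other than \<open>j\<close>; it describes both the rows and columns
  left after deleting one, and the coordinate directions tangent to the face \<open>x\<^sub>j = e\<close>.\<close>

definition skip :: "nat \<Rightarrow> nat \<Rightarrow> nat" where
  "skip j c = (if c < j then c else Suc c)"

lemma sqdet_cong:
  assumes "\<And>i j. i < n \<Longrightarrow> j < n \<Longrightarrow> A i j = B i j"
  shows "sqdet n A = sqdet n B"
  unfolding sqdet_def using assms by (intro arg_cong[of _ _ Determinant.det] eq_matI) auto

lemma sqdet_perm:
  "sqdet n A = (\<Sum>p | p permutes {..<n}. of_int (sign p) * (\<Prod>i<n. A i (p i)))"
  unfolding sqdet_def
  by (subst det_def'[of _ n])
     (auto simp: atLeast0LessThan lessThan_iff[symmetric] permutes_in_image simp del: lessThan_iff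
        intro!: sum.cong prod.cong)

lemma sqdet_expand_row:
  assumes "i < Suc k"
  shows "sqdet (Suc k) A =
    (\<Sum>j<Suc k. A i j * ((-1) ^ (i + j) * sqdet k (\<lambda>r c. A (skip i r) (skip j c))))"
proof -
  have "Determinant.det (mat_delete (Matrix.mat (Suc k) (Suc k) (\<lambda>(i, j). A i j)) i j)
      = sqdet k (\<lambda>r c. A (skip i r) (skip j c))" for j
    unfolding sqdet_def mat_delete_def skip_def
    by (intro arg_cong[of _ _ Determinant.det] eq_matI) auto
  then show ?thesis
    unfolding sqdet_def using assms
    by (subst laplace_expansion_row[of _ "Suc k" i]) (auto simp: cofactor_def intro!: sum.cong)
qed

lemma sqdet_row_to_front:
  assumes "r \<le> k"
  shows "sqdet (Suc k) A = (-1) ^ r * sqdet (Suc k) (\<lambda>i. if i = 0 then A r else A (skip r (i - 1)))"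
proof -
  have "sqdet (Suc k) (\<lambda>i. if i = 0 then A r else A (skip r (i - 1))) =
     (\<Sum>j<Suc k. A r j * ((-1) ^ j * sqdet k (\<lambda>i c. A (skip r i) (skip j c))))"
    by (subst sqdet_expand_row[of 0]) (auto simp: skip_def[of 0] intro!: sum.cong)
  then show ?thesis
    using assms by (subst sqdet_expand_row[of r])
      (auto simp: sum_distrib_left power_add mult_ac simp del: sum.lessThan_Suc intro!: sum.cong)
qed

lemma sqdet_repeated_row:
  assumes "i < n" "j < n" "i \<noteq> j" "\<And>c. c < n \<Longrightarrow> A i c = A j c"
  shows "sqdet n A = 0"
  unfolding sqdet_def
  by (rule det_identical_rows[of _ n i j]) (use assms in auto)

lemma sqdet_first_row_sum:
  "sqdet (Suc k) (\<lambda>i j. if i = 0 then \<Sum>a\<in>S. c a * v a j else B i j) =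
    (\<Sum>a\<in>S. c a * sqdet (Suc k) (\<lambda>i j. if i = 0 then v a j else B i j))"
proof -
  define C where "C j = (-1) ^ j * sqdet k (\<lambda>r c. B (Suc r) (skip j c))" for j
  have expand: "sqdet (Suc k) (\<lambda>i j. if i = 0 then w j else B i j) = (\<Sum>j<Suc k. w j * C j)" for w
    by (subst sqdet_expand_row[of 0])
       (auto simp: skip_def[of 0] C_def simp del: sum.lessThan_Suc intro!: sum.cong)
  show ?thesis
    unfolding expand sum_distrib_right
    by (subst sum.swap) (simp add: sum_distrib_left mult_ac del: sum.lessThan_Suc)
qed

lemma sqdet_mult:
  "sqdet n (\<lambda>i j. \<Sum>l<n. A i l * B l j) = sqdet n A * sqdet n B"
proof -
  have "Matrix.mat n n (\<lambda>(i, j). \<Sum>l<n. A i l * B l j) =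
      Matrix.mat n n (\<lambda>(i, j). A i j) * Matrix.mat n n (\<lambda>(i, j). B i j)"
    by (intro eq_matI) (auto simp: scalar_prod_def atLeast0LessThan)
  then show ?thesis
    unfolding sqdet_def by (simp add: Determinant.det_mult[of _ n])
qed

lemma sqdet_id: "sqdet n (\<lambda>i j. if i = j then 1 else 0) = 1"
proof -
  have "Matrix.mat n n (\<lambda>(i, j). if i = j then 1 else 0 :: real) = 1\<^sub>m n"
    by (intro eq_matI) auto
  then show ?thesis by (simp add: sqdet_def)
qed

text \<open>The cofactor of position \<open>(i, l)\<close>, which is the entry \<open>(l, i)\<close> of the adjugate.\<close>

definition sqcof :: "nat \<Rightarrow> (nat \<Rightarrow> nat \<Rightarrow> real) \<Rightarrow> nat \<Rightarrow> nat \<Rightarrow> real" where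
  "sqcof n A i l = (-1) ^ (i + l) * sqdet (n - 1) (\<lambda>r c. A (skip i r) (skip l c))"

text \<open>Cramer's rule for a right-hand side \<open>b\<close> times the \<open>j\<close>-th unit vector, kept free of division so that
  one can pass to the limit in it.\<close>

lemma cramer_cofactor:
  assumes eq: "\<And>i. i < n \<Longrightarrow> (\<Sum>m<n. A i m * u m) = (if i = j then b else 0)"
    and "j < n" "l < n"
  shows "sqdet n A * u l = b * sqcof n A j l"
proof -
  define M where "M = Matrix.mat n n (\<lambda>(i, j). A i j)"
  have M: "M \<in> carrier_mat n n" by (simp add: M_def)
  have cof: "cofactor M i l = sqcof n A i l" if "i < n" for i
  proof -
    have "mat_delete M i l = Matrix.mat (n - 1) (n - 1) (\<lambda>(r, c). A (skip i r) (skip l c))"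
      using that \<open>l < n\<close> unfolding M_def mat_delete_def skip_def by (intro eq_matI) auto
    then show ?thesis by (simp add: cofactor_def sqcof_def sqdet_def)
  qed
  have adj: "(\<Sum>i<n. sqcof n A i l * A i m) = (if l = m then sqdet n A else 0)" if "m < n" for m
  proof -
    have "(adj_mat M * M) $$ (l, m) = (\<Sum>i<n. sqcof n A i l * A i m)"
      using that \<open>l < n\<close>
      by (auto simp: scalar_prod_def adj_mat_def M_def[symmetric] atLeast0LessThan cof
          carrier_matD[OF M] intro!: sum.cong) (simp add: M_def)
    moreover have "(adj_mat M * M) $$ (l, m) = (if l = m then sqdet n A else 0)"
      using that \<open>l < n\<close> by (subst adj_mat(3)[OF M]) (auto simp: M_def sqdet_def)
    ultimately show ?thesis by simp
  qed
  have "sqdet n A * u l = (\<Sum>m<n. (\<Sum>i<n. sqcof n A i l * A i m) * u m)"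
    using \<open>l < n\<close> by (simp add: adj if_distrib[of "\<lambda>x. x * _"] sum.delta cong: if_cong)
  also have "\<dots> = (\<Sum>i<n. sqcof n A i l * (\<Sum>m<n. A i m * u m))"
    by (subst sum_distrib_right, subst sum.swap)
       (simp add: sum_distrib_left sum_distrib_right mult_ac)
  also have "\<dots> = b * sqcof n A j l"
    using \<open>j < n\<close> by (simp add: eq if_distrib[of "\<lambda>x. _ * x"] sum.delta cong: if_cong)
  finally show ?thesis .
qed

lemma tendsto_sqdet:
  assumes "\<And>i j. i < n \<Longrightarrow> j < n \<Longrightarrow> ((\<lambda>x. A x i j) \<longlongrightarrow> B i j) F"
  shows "((\<lambda>x. sqdet n (A x)) \<longlongrightarrow> sqdet n B) F"
  unfolding sqdet_perm
  by (intro tendsto_sum tendsto_mult tendsto_const tendsto_prod assms)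
     (use permutes_in_image in fastforce)+

lemma tendsto_sqcof:
  assumes "\<And>i j. i < n \<Longrightarrow> j < n \<Longrightarrow> ((\<lambda>x. A x i j) \<longlongrightarrow> B i j) F"
  shows "((\<lambda>x. sqcof n (A x) i l) \<longlongrightarrow> sqcof n B i l) F"
  unfolding sqcof_def
  by (intro tendsto_mult tendsto_const tendsto_sqdet assms) (auto simp: skip_def)

lemma continuous_on_sqdet:
  assumes "\<And>i j. i < n \<Longrightarrow> j < n \<Longrightarrow> continuous_on S (\<lambda>x. A x i j)"
  shows "continuous_on S (\<lambda>x. sqdet n (A x))"
  using assms unfolding continuous_on_def by (auto intro: tendsto_sqdet)

lemma continuous_on_sqcof:
  assumes "\<And>i j. i < n \<Longrightarrow> j < n \<Longrightarrow> continuous_on S (\<lambda>x. A x i j)"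
  shows "continuous_on S (\<lambda>x. sqcof n (A x) i l)"
  using assms unfolding continuous_on_def by (auto intro: tendsto_sqcof)

lemma abs_sqdet_le:
  assumes "\<And>i j. i < n \<Longrightarrow> j < n \<Longrightarrow> \<bar>A i j\<bar> \<le> B"
  shows "\<bar>sqdet n A\<bar> \<le> fact n * B ^ n"
proof -
  have "\<bar>sqdet n A\<bar> \<le> (\<Sum>p | p permutes {..<n}. \<bar>of_int (sign p) * (\<Prod>i<n. A i (p i))\<bar>)"
    unfolding sqdet_perm by (rule sum_abs)
  also have "\<dots> \<le> (\<Sum>p | p permutes {..<n}. B ^ n)"
  proof (rule sum_mono)
    fix p assume "p \<in> {p. p permutes {..<n}}"
    then have "p i < n" if "i < n" for i using that permutes_in_image by fastforce
    then have "(\<Prod>i<n. \<bar>A i (p i)\<bar>) \<le> (\<Prod>i<n. B)"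
      by (intro prod_mono) (auto intro: assms)
    then show "\<bar>of_int (sign p) * (\<Prod>i<n. A i (p i))\<bar> \<le> B ^ n"
      by (simp add: abs_mult abs_prod sign_def)
  qed
  also have "\<dots> = fact n * B ^ n"
    by (simp add: card_permutations[of _ n])
  finally show ?thesis .
qed

section \<open>Integration over the unit cube\<close>

interpretation lborel_family: product_sigma_finite "\<lambda>_ :: 'i. lborel :: real measure"
  by standard

text \<open>Product Lebesgue measure only depends on the number of factors. This identifies the coordinates of a
  face with those of the standard cube, and numbers below \<open>n\<close> with the basis vectors of \<open>\<real>\<^sup>n\<close>.\<close>

lemma distr_PiM_lborel_reindex:
  assumes f: "bij_betw f I J" and "finite I"
  shows "distr (PiM J (\<lambda>_. lborel :: real measure)) (PiM I (\<lambda>_. lborel)) (\<lambda>\<omega>. \<lambda>i\<in>I. \<omega> (f i))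
    = PiM I (\<lambda>_. lborel)"
proof (rule lborel_family.PiM_eqI)
  show "finite I" by fact
  have fin: "finite J" using assms bij_betw_finite by blast
  have meas: "(\<lambda>\<omega>. \<lambda>i\<in>I. \<omega> (f i)) \<in> measurable (PiM J (\<lambda>_. lborel :: real measure)) (PiM I (\<lambda>_. lborel))"
    using f by (intro measurable_restrict measurable_component_singleton) (auto simp: bij_betw_def)
  fix A :: "_ \<Rightarrow> real set" assume A: "\<And>i. i \<in> I \<Longrightarrow> A i \<in> sets lborel"
  have inv: "inv_into I f j \<in> I" "f (inv_into I f j) = j" if "j \<in> J" for j
    using f that by (auto simp: bij_betw_def inv_into_into f_inv_into_f)
  have inv': "f i \<in> J" "inv_into I f (f i) = i" if "i \<in> I" for i
    using f that by (auto simp: bij_betw_def)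
  have pre: "(\<lambda>\<omega>. \<lambda>i\<in>I. \<omega> (f i)) -` Pi\<^sub>E I A \<inter> space (PiM J (\<lambda>_. lborel :: real measure))
      = Pi\<^sub>E J (\<lambda>j. A (inv_into I f j))"
  proof (intro Set.set_eqI iffI)
    fix w assume "w \<in> (\<lambda>\<omega>. \<lambda>i\<in>I. \<omega> (f i)) -` Pi\<^sub>E I A \<inter> space (PiM J (\<lambda>_. lborel :: real measure))"
    then have w: "\<And>i. i \<in> I \<Longrightarrow> w (f i) \<in> A i" "w \<in> extensional J"
      by (auto simp: space_PiM PiE_iff)
    show "w \<in> Pi\<^sub>E J (\<lambda>j. A (inv_into I f j))"
      using w(2) w(1)[OF inv(1)] inv(2) by (auto simp: PiE_iff)
  next
    fix w assume w: "w \<in> Pi\<^sub>E J (\<lambda>j. A (inv_into I f j))"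
    have "w (f i) \<in> A i" if "i \<in> I" for i
      using w inv'[OF that] by (metis PiE_mem)
    with w show "w \<in> (\<lambda>\<omega>. \<lambda>i\<in>I. \<omega> (f i)) -` Pi\<^sub>E I A \<inter> space (PiM J (\<lambda>_. lborel :: real measure))"
      by (auto simp: space_PiM PiE_iff)
  qed
  have "emeasure (distr (PiM J (\<lambda>_. lborel :: real measure)) (PiM I (\<lambda>_. lborel)) (\<lambda>\<omega>. \<lambda>i\<in>I. \<omega> (f i))) (Pi\<^sub>E I A)
      = emeasure (PiM J (\<lambda>_. lborel :: real measure)) (Pi\<^sub>E J (\<lambda>j. A (inv_into I f j)))"
    using A \<open>finite I\<close> by (subst emeasure_distr[OF meas]) (auto simp: pre intro!: sets_PiM_I_finite)
  also have "\<dots> = (\<Prod>j\<in>J. emeasure lborel (A (inv_into I f j)))"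
    using fin A inv by (intro lborel_family.emeasure_PiM) auto
  also have "\<dots> = (\<Prod>i\<in>I. emeasure lborel (A i))"
    by (subst prod.reindex_bij_betw[OF f, symmetric]) (auto simp: inv' intro!: prod.cong)
  finally show "emeasure (distr (PiM J (\<lambda>_. lborel :: real measure)) (PiM I (\<lambda>_. lborel)) (\<lambda>\<omega>. \<lambda>i\<in>I. \<omega> (f i))) (Pi\<^sub>E I A)
      = (\<Prod>i\<in>I. emeasure lborel (A i))" .
qed auto

lemma cube_iff: "x \<in> cube m \<longleftrightarrow> (\<forall>i<m. 0 \<le> x i \<and> x i \<le> 1) \<and> (\<forall>i\<ge>m. x i = undefined)"
  by (simp add: cube_def PiE_iff extensional_def not_less Ball_def)

lemma cube_upd: "x \<in> cube m \<Longrightarrow> j < m \<Longrightarrow> t \<in> {0..1} \<Longrightarrow> x(j := t) \<in> cube m"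
  by (auto simp: cube_iff)

lemma cubeD: "x \<in> cube m \<Longrightarrow> j < m \<Longrightarrow> x j \<in> {0..1}"
  by (auto simp: cube_iff)

lemma compact_cube: "compact (cube m)"
proof -
  have "cube m = Pi\<^sub>E UNIV (\<lambda>i. if i < m then {0..1} else {undefined})"
  proof (rule Set.set_eqI)
    fix x :: "nat \<Rightarrow> real"
    have "x \<in> cube m \<longleftrightarrow> (\<forall>i. x i \<in> (if i < m then {0..1} else {undefined}))"
      unfolding cube_iff by (metis atLeastAtMost_iff linorder_not_le singletonD singletonI)
    then show "x \<in> cube m \<longleftrightarrow> x \<in> Pi\<^sub>E UNIV (\<lambda>i. if i < m then {0..1} else {undefined})"
      by (simp only: PiE_UNIV_domain Pi_iff Ball_def UNIV_I simp_thms)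
  qed
  moreover have "compactin (product_topology (\<lambda>_. euclidean) UNIV)
      (Pi\<^sub>E UNIV (\<lambda>i :: nat. if i < m then {0..1 :: real} else {undefined}))"
    by (subst compactin_PiE) (auto simp: compactin_euclidean_iff)
  ultimately show ?thesis
    by (simp add: euclidean_product_topology compactin_euclidean_iff)
qed

lemma bounded_on_cube:
  assumes "continuous_on (cube m) (F :: _ \<Rightarrow> real)"
  obtains B where "0 \<le> B" "\<And>x. x \<in> cube m \<Longrightarrow> \<bar>F x\<bar> \<le> B"
proof -
  have "bounded (F ` cube m)"
    using compact_continuous_image[OF assms compact_cube] compact_imp_bounded by blast
  then obtain B where "\<And>x. x \<in> cube m \<Longrightarrow> \<bar>F x\<bar> \<le> B"
    by (auto simp: bounded_iff)
  then show ?thesis by (intro that[of "max 0 B"]) (auto simp: le_max_iff_disj)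
qed

lemma cube_sets: "cube m \<in> sets (PiM {..<m} (\<lambda>_. lborel))"
  unfolding cube_def by (intro sets_PiM_I_finite) auto

lemma emeasure_cube: "emeasure (PiM {..<m} (\<lambda>_. lborel)) (cube m) = 1"
  unfolding cube_def by (subst lborel_family.emeasure_PiM) auto

lemma cube_indicator_measurable:
  assumes "continuous_on (cube m) (F :: _ \<Rightarrow> real)"
  shows "(\<lambda>x. indicator (cube m) x *\<^sub>R F x) \<in> borel_measurable (PiM {..<m} (\<lambda>_. lborel))"
proof -
  have "(\<lambda>x. x) \<in> borel_measurable (PiM {..<m} (\<lambda>_. lborel :: real measure))"
  proof (rule measurable_coordinatewise_then_product)
    fix i
    show "(\<lambda>x. x i) \<in> borel_measurable (PiM {..<m} (\<lambda>_. lborel :: real measure))"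
    proof (cases "i < m")
      case False
      then have "(\<lambda>x. x i) \<in> borel_measurable (PiM {..<m} (\<lambda>_. lborel :: real measure)) \<longleftrightarrow>
         (\<lambda>x. undefined :: real) \<in> borel_measurable (PiM {..<m} (\<lambda>_. lborel :: real measure))"
        by (intro measurable_cong) (auto simp: space_PiM PiE_iff extensional_def)
      then show ?thesis by simp
    qed measurable
  qed
  moreover have "(\<lambda>x. indicator (cube m) x *\<^sub>R F x) \<in> borel_measurable borel"
    by (intro borel_measurable_continuous_on_indicator assms borel_closed
        compact_imp_closed compact_cube)
  ultimately show ?thesis
    using measurable_compose by blast
qed

lemma cube_integrable:
  assumes "continuous_on (cube m) (F :: _ \<Rightarrow> real)"
  shows "set_integrable (PiM {..<m} (\<lambda>_. lborel)) (cube m) F"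
proof -
  obtain B where "\<And>x. x \<in> cube m \<Longrightarrow> \<bar>F x\<bar> \<le> B" using bounded_on_cube[OF assms] by blast
  then show ?thesis
    unfolding set_integrable_def
    by (intro integrableI_bounded_set[where A="cube m" and B=B] cube_indicator_measurable assms cube_sets)
       (auto simp: emeasure_cube indicator_def)
qed

definition cint :: "nat \<Rightarrow> ((nat \<Rightarrow> real) \<Rightarrow> real) \<Rightarrow> real" where
  "cint m F = set_lebesgue_integral (PiM {..<m} (\<lambda>_. lborel)) (cube m) F"

lemma cint_cong: "(\<And>x. x \<in> cube m \<Longrightarrow> F x = G x) \<Longrightarrow> cint m F = cint m G"
  unfolding cint_def set_lebesgue_integral_def
  by (intro Bochner_Integration.integral_cong) (auto simp: indicator_def)

lemma cint_mult: "cint m (\<lambda>x. c * F x) = c * cint m F"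
  unfolding cint_def by (rule set_integral_mult_right)

lemma cint_diff:
  "continuous_on (cube m) F \<Longrightarrow> continuous_on (cube m) G \<Longrightarrow>
    cint m (\<lambda>x. F x - G x) = cint m F - cint m G"
  unfolding cint_def by (intro set_integral_diff cube_integrable)

lemma cint_sum:
  assumes "\<And>i. i \<in> S \<Longrightarrow> continuous_on (cube m) (F i)"
  shows "cint m (\<lambda>x. \<Sum>i\<in>S. F i x) = (\<Sum>i\<in>S. cint m (F i))"
  using cube_integrable[OF assms]
  unfolding cint_def set_lebesgue_integral_def set_integrable_def scaleR_sum_right
  by (intro Bochner_Integration.integral_sum)

text \<open>Dominated convergence; the cube has measure \<open>1\<close>, so a uniform bound suffices.\<close>

lemma cint_tendsto:
  assumes "\<And>n. continuous_on (cube m) (F n)" "continuous_on (cube m) G"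
    and "\<And>x. x \<in> cube m \<Longrightarrow> (\<lambda>n. F n x) \<longlonglongrightarrow> G x"
    and "\<And>n x. x \<in> cube m \<Longrightarrow> \<bar>F n x\<bar> \<le> B"
  shows "(\<lambda>n. cint m (F n)) \<longlonglongrightarrow> cint m G"
  unfolding cint_def set_lebesgue_integral_def
proof (rule integral_dominated_convergence[where w="\<lambda>x. indicator (cube m) x * B"])
  have "set_integrable (PiM {..<m} (\<lambda>_. lborel)) (cube m) (\<lambda>_. B)"
    by (intro cube_integrable continuous_on_const)
  then show "integrable (PiM {..<m} (\<lambda>_. lborel)) (\<lambda>x. indicat_real (cube m) x * B)"
    by (simp add: set_integrable_def)
  show "(\<lambda>x. indicator (cube m) x *\<^sub>R G x) \<in> borel_measurable (PiM {..<m} (\<lambda>_. lborel))"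
    "\<And>n. (\<lambda>x. indicator (cube m) x *\<^sub>R F n x) \<in> borel_measurable (PiM {..<m} (\<lambda>_. lborel))"
    by (intro cube_indicator_measurable assms)+
qed (use assms in \<open>auto intro!: AE_I2 simp: indicator_def\<close>)

lemma cube_face_in_cube:
  "x \<in> cube k \<Longrightarrow> j \<le> k \<Longrightarrow> t \<in> {0..1} \<Longrightarrow> cube_face k j t x \<in> cube (Suc k)"
  by (auto simp: cube_iff cube_face_def)

lemma cube_face_continuous:
  "continuous_on S (\<lambda>p. cube_face k j (snd p) (fst p))"
  unfolding cube_face_def restrict_def
proof (rule continuous_on_coordinatewise_then_product)
  fix i
  have *: "continuous_on S (\<lambda>p. fst p l)" for l
    by (rule continuous_on_product_then_coordinatewise) (intro continuous_intros)
  show "continuous_on S (\<lambda>p. if i \<in> {..<Suc k} then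
      if i < j then fst p i else if i = j then snd p else fst p (i - 1) else undefined)"
    by (cases "i < Suc k"; cases "i < j"; cases "i = j") (simp_all add: * continuous_on_snd)
qed

lemma cube_face_continuous':
  assumes "continuous_on (cube (Suc k)) F" "j \<le> k" "t \<in> {0..1}"
  shows "continuous_on (cube k) (\<lambda>x. F (cube_face k j t x))"
proof -
  have "continuous_on (cube k) ((\<lambda>p. cube_face k j (snd p) (fst p)) \<circ> (\<lambda>x. (x, t)))"
    by (intro continuous_on_compose cube_face_continuous continuous_intros)
  then show ?thesis
    by (intro continuous_on_compose2[OF assms(1)]) (use assms in \<open>auto simp: o_def intro!: cube_face_in_cube\<close>)
qed

text \<open>Integrating out the coordinate \<open>j\<close> first: the remaining coordinates parametrize the slice \<open>x\<^sub>j = t\<close>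
  by exactly the map that parametrizes a face for \<open>t = 0\<close> and \<open>t = 1\<close>.\<close>

lemma cint_Fubini:
  assumes F: "continuous_on (cube (Suc k)) F" and j: "j \<le> k"
  shows "cint (Suc k) F = cint k (\<lambda>x. integral {0..1} (\<lambda>t. F (cube_face k j t x)))"
proof -
  define I where "I = {..<Suc k} - {j}"
  define f where "f i = (if i < j then i else i - 1 :: nat)" for i
  define G where "G x = indicator (cube (Suc k)) x *\<^sub>R F x" for x
  have I: "finite I" "j \<notin> I" "insert j I = {..<Suc k}" using j by (auto simp: I_def)
  have f: "bij_betw f I {..<k}"
    by (rule bij_betwI[where g="\<lambda>i. if i < j then i else Suc i"])
       (use j in \<open>auto simp: I_def f_def split: if_splits\<close>)
  have G: "integrable (PiM (insert j I) (\<lambda>_. lborel)) G"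
    using cube_integrable[OF F] by (simp add: I G_def[abs_def] set_integrable_def)
  have meas: "(\<lambda>\<omega>. \<lambda>i\<in>I. \<omega> (f i)) \<in> measurable (PiM {..<k} (\<lambda>_. lborel :: real measure)) (PiM I (\<lambda>_. lborel))"
    using f by (intro measurable_restrict measurable_component_singleton) (auto simp: bij_betw_def)
  have pair: "(\<lambda>(x, y). G (x(j := y))) \<in> borel_measurable (PiM I (\<lambda>_. lborel) \<Otimes>\<^sub>M lborel)"
    using measurable_compose[OF measurable_add_dim borel_measurable_integrable[OF G]]
    by (simp add: split_beta')
  have upd: "(\<lambda>i\<in>I. w (f i))(j := t) = cube_face k j t w" for w :: "nat \<Rightarrow> real" and t
    using j by (auto simp: fun_eq_iff I_def f_def cube_face_def restrict_def)
  have inner: "(\<integral>y. G (cube_face k j y w) \<partial>lborel) =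
      indicator (cube k) w *\<^sub>R integral {0..1} (\<lambda>t. F (cube_face k j t w))"
    if "w \<in> space (PiM {..<k} (\<lambda>_. lborel :: real measure))" for w
  proof -
    have out: "w i = undefined" if "i \<ge> k" for i
      using \<open>w \<in> _\<close> that by (auto simp: space_PiM PiE_iff extensional_def)
    have 1: "cube_face k j y w \<in> cube (Suc k) \<longleftrightarrow> w \<in> cube k \<and> y \<in> {0..1}" for y
    proof
      assume A: "cube_face k j y w \<in> cube (Suc k)"
      have "y \<in> {0..1}" using cubeD[OF A, of j] j by (auto simp: cube_face_def)
      moreover have "w i \<in> {0..1}" if "i < k" for i
        using cubeD[OF A, of "if i < j then i else Suc i"] that j
        by (cases "i < j") (auto simp: cube_face_def)
      ultimately show "w \<in> cube k \<and> y \<in> {0..1}" using out by (auto simp: cube_iff)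
    qed (use j cube_face_in_cube in auto)
    show ?thesis
    proof (cases "w \<in> cube k")
      case True
      have "continuous_on {0..1} ((\<lambda>p. cube_face k j (snd p) (fst p)) \<circ> (\<lambda>t. (w, t)))"
        by (intro continuous_on_compose cube_face_continuous continuous_intros)
      then have "continuous_on {0..1} (\<lambda>t. F (cube_face k j t w))"
        by (intro continuous_on_compose2[OF F])
           (use True j in \<open>auto simp: o_def intro!: cube_face_in_cube\<close>)
      then have "(LINT y:{0..1}|lborel. F (cube_face k j y w)) = integral {0..1} (\<lambda>t. F (cube_face k j t w))"
        by (intro set_borel_integral_eq_integral borel_integrable_atLeastAtMost')
      then show ?thesis
        using True by (simp add: G_def indicator_def 1 set_lebesgue_integral_def)
    qed (simp add: G_def indicator_def 1)
  qed
  have "cint (Suc k) F = integral\<^sup>L (PiM (insert j I) (\<lambda>_. lborel)) G"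
    by (simp add: cint_def set_lebesgue_integral_def I G_def[abs_def])
  also have "\<dots> = (\<integral>x. (\<integral>y. G (x(j := y)) \<partial>lborel) \<partial>PiM I (\<lambda>_. lborel))"
    by (rule lborel_family.product_integral_insert[OF I(1,2) G])
  also have "\<dots> = (\<integral>x. (\<integral>y. G (x(j := y)) \<partial>lborel)
      \<partial>distr (PiM {..<k} (\<lambda>_. lborel)) (PiM I (\<lambda>_. lborel)) (\<lambda>\<omega>. \<lambda>i\<in>I. \<omega> (f i)))"
    by (simp add: distr_PiM_lborel_reindex[OF f I(1)])
  also have "\<dots> = (\<integral>w. (\<integral>y. G ((\<lambda>i\<in>I. w (f i))(j := y)) \<partial>lborel) \<partial>PiM {..<k} (\<lambda>_. lborel))"
    by (rule integral_distr[OF meas])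
       (use lborel.borel_measurable_lebesgue_integral[of "\<lambda>x y. G (x(j := y))", OF pair] in simp)
  also have "\<dots> = cint k (\<lambda>x. integral {0..1} (\<lambda>t. F (cube_face k j t x)))"
    unfolding upd cint_def set_lebesgue_integral_def
    by (intro Bochner_Integration.integral_cong inner refl)
  finally show ?thesis .
qed

section \<open>The Piola identity and Stokes' theorem for smooth functions\<close>

text \<open>Partial derivatives with a named derivative function; on the closed cube they are one-sided at the
  faces orthogonal to the direction of differentiation.\<close>

definition has_cube_partial ::
  "nat \<Rightarrow> nat \<Rightarrow> ((nat \<Rightarrow> real) \<Rightarrow> real) \<Rightarrow> ((nat \<Rightarrow> real) \<Rightarrow> real) \<Rightarrow> bool" where
  "has_cube_partial m j f g \<longleftrightarrow>
    (\<forall>x\<in>cube m. ((\<lambda>t. f (x(j := t))) has_real_derivative g x) (at (x j) within {0..1}))"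

lemma cube_partial_eq:
  fixes f :: "(nat \<Rightarrow> real) \<Rightarrow> 'b::euclidean_space"
  assumes "((\<lambda>t. f (x(j := t))) has_vector_derivative d) (at (x j) within {0..1})" "x j \<in> {0..1}"
  shows "cube_partial f j x = d"
  unfolding cube_partial_def using assms
  by (intro vector_derivative_within_closed_interval[of 0 1]) auto

lemma cube_partial_unique:
  "has_cube_partial m j f g \<Longrightarrow> j < m \<Longrightarrow> x \<in> cube m \<Longrightarrow> cube_partial f j x = g x"
  using cube_partial_eq[of f x j "g x"] cubeD[of x m j]
  by (auto simp: has_cube_partial_def has_real_derivative_iff_has_vector_derivative)

lemma has_cube_partial_cong:
  assumes "has_cube_partial m j f g" "j < m"
    and "\<And>x. x \<in> cube m \<Longrightarrow> f' x = f x" "\<And>x. x \<in> cube m \<Longrightarrow> g' x = g x"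
  shows "has_cube_partial m j f' g'"
  unfolding has_cube_partial_def
proof
  fix x assume x: "x \<in> cube m"
  have "((\<lambda>t. f (x(j := t))) has_real_derivative g' x) (at (x j) within {0..1})"
    using assms(1,4) x by (simp add: has_cube_partial_def)
  then show "((\<lambda>t. f' (x(j := t))) has_real_derivative g' x) (at (x j) within {0..1})"
    by (rule has_field_derivative_transform_within[where d=1])
       (use assms x cubeD[OF x assms(2)] in \<open>auto simp: cube_upd\<close>)
qed

lemma cube_C1_D:
  assumes "cube_C1 m (f :: _ \<Rightarrow> real)"
  shows "continuous_on (cube m) f"
    and "\<And>j. j < m \<Longrightarrow> has_cube_partial m j f (cube_partial f j)"
    and "\<And>j. j < m \<Longrightarrow> continuous_on (cube m) (cube_partial f j)"
  using assms
  by (auto simp: cube_C1_def has_cube_partial_def cube_partial_def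
      has_real_derivative_iff_has_vector_derivative vector_derivative_works[symmetric])

lemma cube_C1_I:
  assumes "continuous_on (cube m) f"
    and "\<And>j. j < m \<Longrightarrow> has_cube_partial m j f (g j)"
    and "\<And>j. j < m \<Longrightarrow> continuous_on (cube m) (g j)"
  shows "cube_C1 m f"
proof -
  have "continuous_on (cube m) (cube_partial f j)" if "j < m" for j
    using assms(3)[OF that] cube_partial_unique[OF assms(2)[OF that] that]
    by (simp cong: continuous_on_cong)
  moreover have "(\<lambda>t. f (x(j := t))) differentiable (at (x j) within {0..1})"
    if "j < m" "x \<in> cube m" for j x
    using assms(2)[OF that(1)] that(2) unfolding has_cube_partial_def
    by (meson real_differentiable_def)
  ultimately show ?thesis
    using assms(1) by (auto simp: cube_C1_def)
qed

text \<open>For the Piola identity only the mixed derivatives in two different directions matter. The set \<open>J\<close>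
  records the directions in which a function has been smoothed: a mixed derivative is required as
  soon as one of its two directions is in \<open>J\<close>.\<close>

definition mixed_smooth :: "nat \<Rightarrow> nat set \<Rightarrow> ((nat \<Rightarrow> real) \<Rightarrow> real) \<Rightarrow> bool" where
  "mixed_smooth m J f \<longleftrightarrow> cube_C1 m f \<and>
    (\<forall>a<m. \<forall>b<m. a \<noteq> b \<and> (a \<in> J \<or> b \<in> J) \<longrightarrow> (\<exists>q. continuous_on (cube m) q \<and>
       has_cube_partial m a (cube_partial f b) q \<and> has_cube_partial m b (cube_partial f a) q))"

lemma mixed_smooth_D:
  assumes "mixed_smooth m J f" "a < m" "b < m" "a \<noteq> b" "a \<in> J \<or> b \<in> J"
  obtains q where "continuous_on (cube m) q"
    "has_cube_partial m a (cube_partial f b) q" "has_cube_partial m b (cube_partial f a) q"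
  using assms unfolding mixed_smooth_def by blast

text \<open>The divergence theorem for one coordinate: Fubini, then the fundamental theorem of calculus.\<close>

lemma cint_partial:
  assumes j: "j \<le> k" and F: "has_cube_partial (Suc k) j F D"
    and cont: "continuous_on (cube (Suc k)) D"
  shows "cint (Suc k) D = cint k (\<lambda>x. F (cube_face k j 1 x) - F (cube_face k j 0 x))"
proof -
  have "integral {0..1} (\<lambda>t. D (cube_face k j t x)) = F (cube_face k j 1 x) - F (cube_face k j 0 x)"
    if x: "x \<in> cube k" for x
  proof -
    have face: "(cube_face k j s x)(j := t) = cube_face k j t x" for s t
      using j by (auto simp: cube_face_def fun_eq_iff)
    have "((\<lambda>t. F (cube_face k j t x)) has_vector_derivative D (cube_face k j s x)) (at s within {0..1})"
      if s: "s \<in> {0..1}" for s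
      using F cube_face_in_cube[OF x j s] j
      by (auto simp: has_cube_partial_def face has_real_derivative_iff_has_vector_derivative
          dest!: bspec[where x="cube_face k j s x"]) (simp add: cube_face_def)
    then show ?thesis
      by (intro integral_unique fundamental_theorem_of_calculus) auto
  qed
  then show ?thesis
    unfolding cint_Fubini[OF cont j] by (intro cint_cong)
qed

text \<open>Signed minors as parts of the Leibniz formula: the permutations of \<open>{0..k}\<close> are sorted by their
  value at \<open>0\<close>. In this form the Piola identity is a cancellation of permutations.\<close>

lemma minor_eq_permutation_sum:
  assumes "j < Suc k"
  shows "(-1) ^ j * sqdet k (\<lambda>r c. B r (skip j c)) =
    (\<Sum>p | p permutes {..<Suc k}. (if p 0 = j then of_int (sign p) * (\<Prod>i<k. B i (p (Suc i))) else 0))"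
proof -
  \<comment> \<open>The determinant with a unit vector as first row is the signed minor.\<close>
  let ?A = "\<lambda>i c. if i = 0 then (if c = j then 1 else 0) else B (i - 1) c"
  have "sqdet (Suc k) ?A = (-1) ^ j * sqdet k (\<lambda>r c. B r (skip j c))"
    using assms
    by (subst sqdet_expand_row[of 0])
       (auto simp: skip_def[of 0] if_distrib[of "\<lambda>x. x * _"] simp del: sum.lessThan_Suc cong: if_cong)
  moreover have "sqdet (Suc k) ?A =
    (\<Sum>p | p permutes {..<Suc k}. (if p 0 = j then of_int (sign p) * (\<Prod>i<k. B i (p (Suc i))) else 0))"
    unfolding sqdet_perm prod.lessThan_Suc_shift by (intro sum.cong) auto
  ultimately show ?thesis by simp
qed

text \<open>The signed maximal minors of the Jacobian of \<open>(f\<^sub>0, \<dots>, f\<^sub>k\<^sub>-\<^sub>1)\<close> form a divergence-free vector field.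
  By the product rule the divergence is a sum over a permutation \<open>p\<close> and an index \<open>l\<close> of terms with the
  factor \<open>\<partial>\<^bsub>p 0\<^esub> \<partial>\<^bsub>p (l+1)\<^esub> f\<^sub>l\<close>. Exchanging the values \<open>p 0\<close> and \<open>p (l+1)\<close> leaves the term unchanged up to
  the sign of the permutation, because mixed derivatives commute; so the terms cancel in pairs.\<close>

lemma piola_identity:
  assumes f: "\<And>i. i < k \<Longrightarrow> mixed_smooth (Suc k) {..<Suc k} (f i)"
  obtains N where
    "\<And>j. j < Suc k \<Longrightarrow> continuous_on (cube (Suc k)) (N j)"
    "\<And>j. j < Suc k \<Longrightarrow> has_cube_partial (Suc k) j
        (\<lambda>x. (-1) ^ j * sqdet k (\<lambda>r c. cube_partial (f r) (skip j c) x)) (N j)"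
    "\<And>x. (\<Sum>j<Suc k. N j x) = 0"
proof -
  let ?m = "Suc k"
  let ?P = "{p. p permutes {..<?m}}"
  have "\<exists>q. continuous_on (cube ?m) q \<and> (i < k \<and> a < b \<and> b < ?m \<longrightarrow>
       has_cube_partial ?m a (cube_partial (f i) b) q \<and> has_cube_partial ?m b (cube_partial (f i) a) q)"
    for i a b
  proof (cases "i < k \<and> a < b \<and> b < ?m")
    case True
    then have "a < ?m" "b < ?m" "a \<noteq> b" "a \<in> {..<?m} \<or> b \<in> {..<?m}" by auto
    with mixed_smooth_D[OF f, of i a b] True show ?thesis by metis
  qed (intro exI[of _ "\<lambda>_. 0"], auto)
  then obtain Q0 where Q0: "\<And>i a b. continuous_on (cube ?m) (Q0 i a b)"
    "\<And>i a b. i < k \<Longrightarrow> a < b \<Longrightarrow> b < ?m \<Longrightarrow> has_cube_partial ?m a (cube_partial (f i) b) (Q0 i a b)"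
    "\<And>i a b. i < k \<Longrightarrow> a < b \<Longrightarrow> b < ?m \<Longrightarrow> has_cube_partial ?m b (cube_partial (f i) a) (Q0 i a b)"
    by metis
  \<comment> \<open>Chosen for \<open>a < b\<close> only and then symmetrized, so that \<open>Q i a b = Q i b a\<close> holds for the chosen functions.\<close>
  define Q where "Q i a b = Q0 i (min a b) (max a b)" for i a b
  have Q_sym: "Q i a b = Q i b a" for i a b by (simp add: Q_def min.commute max.commute)
  have Q: "has_cube_partial ?m a (cube_partial (f i) b) (Q i a b)"
    if "i < k" "a < ?m" "b < ?m" "a \<noteq> b" for i a b
    using Q0(2)[of i a b] Q0(3)[of i b a] that by (cases "a < b") (auto simp: Q_def min_def max_def)
  have Q_cont: "continuous_on (cube ?m) (Q i a b)" for i a b by (simp add: Q_def Q0)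
  have part_cont: "continuous_on (cube ?m) (cube_partial (f i) b)" if "i < k" "b < ?m" for i b
    using f[OF that(1)] that(2) by (auto simp: mixed_smooth_def intro: cube_C1_D)
  define T where "T p l x = of_int (sign p) * (Q l (p 0) (p (Suc l)) x *
      (\<Prod>i\<in>{..<k} - {l}. cube_partial (f i) (p (Suc i)) x))" for p l x
  define N where "N j x = (\<Sum>p\<in>?P. if p 0 = j then \<Sum>l<k. T p l x else 0)" for j x
  have less: "p i < ?m" if "p \<in> ?P" "i < ?m" for p i
    using that permutes_in_image[of p "{..<?m}" i] by simp
  show thesis
  proof (rule that[of N])
    fix j assume j: "j < ?m"
    have "continuous_on (cube ?m) (T p l)" if "p \<in> ?P" for p l
      unfolding T_def using that
      by (auto intro!: continuous_intros Q_cont part_cont less[of p, unfolded mem_Collect_eq])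
    then show "continuous_on (cube ?m) (N j)"
      unfolding N_def
      by (intro continuous_on_sum, rename_tac p, case_tac "p 0 = j")
         (simp_all add: continuous_on_sum)
    show "has_cube_partial ?m j (\<lambda>x. (-1) ^ j * sqdet k (\<lambda>r c. cube_partial (f r) (skip j c) x)) (N j)"
      unfolding minor_eq_permutation_sum[OF j, where B="\<lambda>r c. cube_partial (f r) c x" for x] has_cube_partial_def N_def
    proof (intro ballI DERIV_sum)
      fix x p assume x: "x \<in> cube ?m" and p: "p \<in> ?P"
      let ?D = "at (x j) within {0..1}"
      have prod: "((\<lambda>t. \<Prod>i<k. cube_partial (f i) (p (Suc i)) (x(j := t))) has_real_derivative
          (\<Sum>l<k. Q l j (p (Suc l)) x * (\<Prod>i\<in>{..<k} - {l}. cube_partial (f i) (p (Suc i)) x))) ?D"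
        if "p 0 = j"
      proof -
        have "((\<lambda>t. cube_partial (f i) (p (Suc i)) (x(j := t))) has_derivative
           (\<lambda>h. h * Q i j (p (Suc i)) x)) ?D" if "i < k" for i
        proof -
          have "p (Suc i) \<noteq> j"
            using p \<open>p 0 = j\<close> by (metis mem_Collect_eq nat.distinct(1) permutes_inj inj_eq)
          then have "has_cube_partial ?m j (cube_partial (f i) (p (Suc i))) (Q i j (p (Suc i)))"
            using that j less[OF p, of "Suc i"] by (intro Q) auto
          then show ?thesis
            using x by (simp add: has_cube_partial_def has_field_derivative_def mult_commute_abs)
        qed
        then show ?thesis
          unfolding has_field_derivative_def
          by (intro has_derivative_eq_rhs[OF has_derivative_prod])
             (auto simp: sum_distrib_left mult_ac)
      qed
      show "((\<lambda>t. if p 0 = j then of_int (sign p) *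
               (\<Prod>i<k. cube_partial (f i) (p (Suc i)) (x(j := t))) else 0) has_real_derivative
             (if p 0 = j then \<Sum>l<k. T p l x else 0)) ?D"
      proof (cases "p 0 = j")
        case True
        then show ?thesis
          using DERIV_cmult[OF prod[OF True], of "of_int (sign p)"]
          by (simp add: T_def sum_distrib_left)
      qed simp
    qed
  next
    fix x
    have "(\<Sum>j<?m. N j x) = (\<Sum>p\<in>?P. \<Sum>j<?m. if p 0 = j then \<Sum>l<k. T p l x else 0)"
      unfolding N_def by (rule sum.swap)
    also have "\<dots> = (\<Sum>p\<in>?P. \<Sum>l<k. T p l x)"
    proof (rule sum.cong[OF refl])
      fix p assume "p \<in> ?P"
      then show "(\<Sum>j<?m. if p 0 = j then \<Sum>l<k. T p l x else 0) = (\<Sum>l<k. T p l x)"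
        using less[of p 0] by (simp add: sum.delta' del: sum.lessThan_Suc)
    qed
    also have "\<dots> = (\<Sum>l<k. \<Sum>p\<in>?P. T p l x)" by (rule sum.swap)
    also have "\<dots> = 0"
    proof (rule sum.neutral, safe)
      fix l assume l: "l < k"
      \<comment> \<open>The involution that pairs the terms of the \<open>l\<close>-th sum with opposite sign.\<close>
      define s where "s = Transposition.transpose 0 (Suc l)"
      have s: "s permutes {..<?m}" using l unfolding s_def by (intro permutes_swap_id) auto
      have "T (p \<circ> s) l x = - T p l x" if "p \<in> ?P" for p
      proof -
        have "sign (p \<circ> s) = - sign p"
          using that s permutes_imp_permutation[of "{..<?m}"]
          by (auto simp: sign_compose) (simp add: s_def sign_swap_id)
        moreover have "(p \<circ> s) 0 = p (Suc l)" "(p \<circ> s) (Suc l) = p 0" by (auto simp: s_def)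
        moreover have "(p \<circ> s) (Suc i) = p (Suc i)" if "i \<noteq> l" for i
          using that by (simp add: s_def transpose_def)
        ultimately show ?thesis
          by (auto simp: T_def Q_sym[of l "p (Suc l)"] intro!: prod.cong)
      qed
      then have "(\<Sum>p\<in>?P. T p l x) = - (\<Sum>p\<in>?P. T p l x)"
        by (subst sum_permutations_compose_right[OF s]) (simp add: sum_negf)
      then show "(\<Sum>p\<in>?P. T p l x) = 0" by simp
    qed
    finally show "(\<Sum>j<?m. N j x) = 0" .
  qed
qed

text \<open>Laplace expansion along the row of \<open>g\<close> writes the integrand as \<open>\<Sum>\<^sub>j \<partial>\<^sub>j g M\<^sub>j\<close> with signed minors \<open>M\<^sub>j\<close>.
  By the Piola identity this is the divergence of \<open>(g M\<^sub>j)\<^sub>j\<close>, whose integral lives on the faces.\<close>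

lemma stokes_smooth:
  assumes g: "cube_C1 (Suc k) g"
    and f: "\<And>i. i < k \<Longrightarrow> mixed_smooth (Suc k) {..<Suc k} (f i)"
  shows "cint (Suc k) (\<lambda>x. sqdet (Suc k) (\<lambda>i j. cube_partial (if i = 0 then g else f (i - 1)) j x)) =
    (\<Sum>j<Suc k. \<Sum>e\<in>{0, 1}. face_sign j e * cint k (\<lambda>x. g (cube_face k j e x) *
       sqdet k (\<lambda>r c. cube_partial (f r) (skip j c) (cube_face k j e x))))"
proof -
  let ?m = "Suc k"
  define M where "M j x = (-1) ^ j * sqdet k (\<lambda>r c. cube_partial (f r) (skip j c) x)" for j x
  obtain N where N_cont: "\<And>j. j < ?m \<Longrightarrow> continuous_on (cube ?m) (N j)"
    and N: "\<And>j. j < ?m \<Longrightarrow> has_cube_partial ?m j (M j) (N j)"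
    and N_sum: "\<And>x. (\<Sum>j<?m. N j x) = 0"
    unfolding M_def using piola_identity[of k f, OF f] by blast
  define D where "D j x = cube_partial g j x * M j x + N j x * g x" for j x
  have M_cont: "continuous_on (cube ?m) (M j)" if "j < ?m" for j
  proof -
    have "continuous_on (cube ?m) (cube_partial (f r) (skip j c))" if "r < k" "c < k" for r c
      using f[OF that(1)] that(2) \<open>j < ?m\<close>
      by (intro cube_C1_D) (auto simp: mixed_smooth_def skip_def)
    then show ?thesis unfolding M_def by (intro continuous_intros continuous_on_sqdet)
  qed
  have D_cont: "continuous_on (cube ?m) (D j)" if "j < ?m" for j
    unfolding D_def using that by (intro continuous_intros M_cont N_cont cube_C1_D[OF g])
  have D: "has_cube_partial ?m j (\<lambda>x. g x * M j x) (D j)" if "j < ?m" for j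
    using cube_C1_D(2)[OF g that] N[OF that] unfolding has_cube_partial_def D_def
    by (auto intro!: derivative_eq_intros)
  have part: "cint ?m (D j) = (\<Sum>e\<in>{0, 1}. face_sign j e * cint k (\<lambda>x. g (cube_face k j e x) *
       sqdet k (\<lambda>r c. cube_partial (f r) (skip j c) (cube_face k j e x))))" if j: "j < ?m" for j
  proof -
    have c: "continuous_on (cube k) (\<lambda>x. g (cube_face k j e x) * M j (cube_face k j e x))" if "e \<in> {0..1}" for e
      using j that by (intro continuous_intros cube_face_continuous' M_cont cube_C1_D[OF g]) auto
    have "cint ?m (D j) = cint k (\<lambda>x. g (cube_face k j 1 x) * M j (cube_face k j 1 x)
        - g (cube_face k j 0 x) * M j (cube_face k j 0 x))"
      using j by (intro cint_partial D D_cont) auto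
    also have "\<dots> = cint k (\<lambda>x. g (cube_face k j 1 x) * M j (cube_face k j 1 x))
        - cint k (\<lambda>x. g (cube_face k j 0 x) * M j (cube_face k j 0 x))"
      by (intro cint_diff c) auto
    finally have "cint ?m (D j) = cint k (\<lambda>x. g (cube_face k j 1 x) * M j (cube_face k j 1 x))
        - cint k (\<lambda>x. g (cube_face k j 0 x) * M j (cube_face k j 0 x))" .
    moreover have M_eq: "(\<lambda>e. cint k (\<lambda>x. g (cube_face k j e x) * M j (cube_face k j e x))) = (\<lambda>e.
        (-1) ^ j * cint k (\<lambda>x. g (cube_face k j e x) *
          sqdet k (\<lambda>r c. cube_partial (f r) (skip j c) (cube_face k j e x))))"
      unfolding M_def by (subst cint_mult[symmetric]) (simp add: mult_ac)
    ultimately show ?thesis by (simp add: face_sign_def fun_cong[OF M_eq])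
  qed
  have "sqdet ?m (\<lambda>i j. cube_partial (if i = 0 then g else f (i - 1)) j x) = (\<Sum>j<?m. D j x)" for x
  proof -
    have "(\<Sum>j<?m. D j x) = (\<Sum>j<?m. cube_partial g j x * M j x) + (\<Sum>j<?m. N j x) * g x"
      unfolding D_def sum.distrib sum_distrib_right ..
    also have "\<dots> = sqdet ?m (\<lambda>i j. cube_partial (if i = 0 then g else f (i - 1)) j x)"
      unfolding N_sum
      by (subst sqdet_expand_row[of 0]) (simp_all add: M_def skip_def[of 0] del: sum.lessThan_Suc)
    finally show ?thesis ..
  qed
  then have "cint ?m (\<lambda>x. sqdet ?m (\<lambda>i j. cube_partial (if i = 0 then g else f (i - 1)) j x)) =
      (\<Sum>j<?m. cint ?m (D j))"
    using cint_sum[of "{..<?m}" ?m D] D_cont by simp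
  also have "\<dots> = (\<Sum>j<?m. \<Sum>e\<in>{0, 1}. face_sign j e * cint k (\<lambda>x. g (cube_face k j e x) *
       sqdet k (\<lambda>r c. cube_partial (f r) (skip j c) (cube_face k j e x))))"
    by (intro sum.cong refl part) simp
  finally show ?thesis .
qed

section \<open>Steklov averages and Stokes' theorem for continuously differentiable functions\<close>

text \<open>The average of \<open>f\<close> over a segment of length \<open>e\<close> in direction \<open>j\<close>. The segment starts at \<open>(1 - e) x\<^sub>j\<close>
  instead of \<open>x\<^sub>j\<close>, which keeps it inside the unit interval.\<close>

definition steklov :: "nat \<Rightarrow> real \<Rightarrow> ((nat \<Rightarrow> real) \<Rightarrow> real) \<Rightarrow> (nat \<Rightarrow> real) \<Rightarrow> real" where
  "steklov j e f x = integral {0..1} (\<lambda>t. f (x(j := (1 - e) * x j + e * t)))"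

lemma convex_unit:
  fixes e s t :: real
  assumes "e \<in> {0..1}" "s \<in> {0..1}" "t \<in> {0..1}"
  shows "(1 - e) * s + e * t \<in> {0..1}"
proof -
  have "(1 - e) * s + e * t \<le> (1 - e) * 1 + e * 1"
    using assms by (intro add_mono mult_left_mono) auto
  then show ?thesis using assms by simp
qed

lemma continuous_on_fun_upd:
  assumes "continuous_on S f" "continuous_on S (g :: _ \<Rightarrow> real)"
  shows "continuous_on S (\<lambda>p. (f p)(j := g p))"
proof (rule continuous_on_coordinatewise_then_product)
  fix i
  show "continuous_on S (\<lambda>p. ((f p)(j := g p)) i)"
    using assms continuous_on_product_then_coordinatewise[OF assms(1), of i]
    by (cases "i = j") auto
qed

lemma continuous_on_coordinate:
  "continuous_on S f \<Longrightarrow> continuous_on S (\<lambda>p. (f p :: nat \<Rightarrow> real) j)"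
  by (rule continuous_on_product_then_coordinatewise)

lemma steklov_continuous:
  assumes f: "continuous_on (cube m) f" and j: "j < m" and e: "e \<in> {0..1}"
  shows "continuous_on (cube m) (steklov j e f)"
proof -
  have "continuous_on (cube m \<times> cbox 0 1) (\<lambda>(x, t). f (x(j := (1 - e) * x j + e * t)))"
    unfolding split_beta
    by (intro continuous_on_compose2[OF f] continuous_on_fun_upd continuous_intros
        continuous_on_coordinate)
       (use j e in \<open>auto intro!: cube_upd convex_unit dest: cubeD\<close>)
  from integral_continuous_on_param[OF this] show ?thesis
    by (simp add: steklov_def[abs_def])
qed

lemma steklov_line_continuous:
  assumes f: "continuous_on (cube m) f" and j: "j < m" and e: "e \<in> {0..1}" and x: "x \<in> cube m"
  shows "continuous_on {0..1} (\<lambda>t. f (x(j := (1 - e) * x j + e * t)))"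
  by (intro continuous_on_compose2[OF f] continuous_on_fun_upd continuous_intros)
     (use j e x in \<open>auto intro!: cube_upd convex_unit dest: cubeD\<close>)

lemma steklov_bound:
  assumes f: "continuous_on (cube m) f" and j: "j < m" and e: "e \<in> {0..1}" and x: "x \<in> cube m"
    and B: "\<And>x. x \<in> cube m \<Longrightarrow> \<bar>f x\<bar> \<le> B"
  shows "\<bar>steklov j e f x\<bar> \<le> B"
proof -
  have "norm (integral {0..1} (\<lambda>t. f (x(j := (1 - e) * x j + e * t)))) \<le> B * (1 - 0)"
    by (intro integral_bound steklov_line_continuous[OF f j e x])
       (use j e x cubeD[OF x j] in \<open>auto intro!: B cube_upd convex_unit\<close>)
  then show ?thesis by (simp add: steklov_def)
qed

lemma steklov_tendsto:
  assumes f: "continuous_on (cube m) f" and j: "j < m" and x: "x \<in> cube m"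
  shows "(\<lambda>n. steklov j (1 / (real n + 2)) f x) \<longlonglongrightarrow> f x"
proof -
  have "continuous_on ({0..1} \<times> cbox 0 1) (\<lambda>(e, t). f (x(j := (1 - e) * x j + e * t)))"
    unfolding split_beta
    by (intro continuous_on_compose2[OF f] continuous_on_fun_upd continuous_intros)
       (use j x cubeD[OF x j] in \<open>auto intro!: cube_upd convex_unit\<close>)
  from integral_continuous_on_param[OF this]
  have "continuous_on {0..1} (\<lambda>e. steklov j e f x)"
    by (simp add: steklov_def[abs_def])
  moreover have "(\<lambda>n. 1 / (real n + 2)) \<longlonglongrightarrow> 0" by real_asymp
  ultimately have "(\<lambda>n. steklov j (1 / (real n + 2)) f x) \<longlonglongrightarrow> steklov j 0 f x"
    by (rule continuous_on_tendsto_compose) auto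
  then show ?thesis by (simp add: steklov_def)
qed

lemma affine_chain:
  assumes "(F has_real_derivative D) (at (c * y + d) within {0..1})"
    and "\<And>y. y \<in> {0..1} \<Longrightarrow> c * y + d \<in> {0..1}"
  shows "((\<lambda>y. F (c * y + d)) has_real_derivative D * c) (at y within {0..1})"
proof -
  have "(F has_real_derivative D) (at (c * y + d) within (\<lambda>y. c * y + d) ` {0..1})"
    using assms by (auto intro: has_field_derivative_subset)
  moreover have "((\<lambda>y. c * y + d) has_real_derivative c) (at y within {0..1})"
    by (auto intro!: derivative_eq_intros)
  ultimately show ?thesis
    using DERIV_image_chain[of F D "\<lambda>y. c * y + d" y "{0..1}" c] by (simp add: o_def)
qed

text \<open>Averaging in direction \<open>j\<close> commutes with the other partial derivatives.\<close>

lemma steklov_partial_other: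
  assumes f: "continuous_on (cube m) f" and f': "continuous_on (cube m) f'"
    and D: "has_cube_partial m l f f'" and j: "j < m" and l: "l < m" "l \<noteq> j" and e: "e \<in> {0..1}"
  shows "has_cube_partial m l (steklov j e f) (steklov j e f')"
  unfolding has_cube_partial_def
proof
  fix x assume x: "x \<in> cube m"
  let ?p = "\<lambda>y t. x(l := y, j := (1 - e) * x j + e * t)"
  have in_cube: "?p y t \<in> cube m" if "y \<in> {0..1}" "t \<in> {0..1}" for y t
    using x j l e that cubeD[OF x j] by (intro cube_upd convex_unit)
  have "((\<lambda>y. integral (cbox 0 1) (\<lambda>t. f (?p y t))) has_field_derivative
      integral (cbox 0 1) (\<lambda>t. f' (?p (x l) t))) (at (x l) within {0..1})"
  proof (rule leibniz_rule_field_derivative)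
    fix y t :: real assume yt: "y \<in> {0..1}" "t \<in> cbox 0 1"
    have "((\<lambda>s. f ((?p y t)(l := s))) has_real_derivative f' (?p y t)) (at (?p y t l) within {0..1})"
      using D in_cube[of y t] yt by (auto simp: has_cube_partial_def)
    moreover have "(?p y t)(l := s) = ?p s t" for s using l by (auto simp: fun_eq_iff)
    moreover have "?p y t l = y" using l by simp
    ultimately show "((\<lambda>y. f (?p y t)) has_real_derivative f' (?p y t)) (at y within {0..1})"
      by simp
  next
    fix y :: real assume "y \<in> {0..1}"
    then show "(\<lambda>t. f (?p y t)) integrable_on cbox 0 1"
      by (intro integrable_continuous continuous_on_compose2[OF f] continuous_on_fun_upd continuous_intros)
         (use in_cube in auto)
  next
    show "continuous_on ({0..1} \<times> cbox 0 1) (\<lambda>(y, t). f' (?p y t))"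
      unfolding split_beta
      by (intro continuous_on_compose2[OF f'] continuous_on_fun_upd continuous_intros)
         (use in_cube in auto)
  qed (use cubeD[OF x l(1)] in auto)
  then show "((\<lambda>t. steklov j e f (x(l := t))) has_real_derivative steklov j e f' x) (at (x l) within {0..1})"
    using l by (simp add: steklov_def fun_upd_twist)
qed

text \<open>This form of the derivative shows that it converges to \<open>f'\<close> as \<open>e\<close> tends to \<open>0\<close>; the next lemma shows
  that it exists for continuous \<open>f\<close>.\<close>

lemma steklov_partial_self:
  assumes f: "continuous_on (cube m) f" and f': "continuous_on (cube m) f'"
    and D: "has_cube_partial m j f f'" and j: "j < m" and e: "e \<in> {0..1}"
  shows "has_cube_partial m j (steklov j e f) (\<lambda>x. (1 - e) * steklov j e f' x)"
  unfolding has_cube_partial_def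
proof
  fix x assume x: "x \<in> cube m"
  let ?p = "\<lambda>y t. x(j := (1 - e) * y + e * t)"
  have in_cube: "?p y t \<in> cube m" if "y \<in> {0..1}" "t \<in> {0..1}" for y t
    using x j e that by (intro cube_upd convex_unit)
  have "((\<lambda>y. integral (cbox 0 1) (\<lambda>t. f (?p y t))) has_field_derivative
      integral (cbox 0 1) (\<lambda>t. f' (?p (x j) t) * (1 - e))) (at (x j) within {0..1})"
  proof (rule leibniz_rule_field_derivative)
    fix y t :: real assume yt: "y \<in> {0..1}" "t \<in> cbox 0 1"
    have "((\<lambda>s. f ((?p y t)(j := s))) has_real_derivative f' (?p y t)) (at (?p y t j) within {0..1})"
      using D in_cube[of y t] yt unfolding has_cube_partial_def by auto
    then show "((\<lambda>y. f (?p y t)) has_real_derivative f' (?p y t) * (1 - e)) (at y within {0..1})"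
      using affine_chain[of "\<lambda>s. f (x(j := s))" "f' (?p y t)" "1 - e" y "e * t"] yt
        convex_unit[OF e] by auto
  next
    fix y :: real assume "y \<in> {0..1}"
    then show "(\<lambda>t. f (?p y t)) integrable_on cbox 0 1"
      by (intro integrable_continuous continuous_on_compose2[OF f] continuous_on_fun_upd continuous_intros)
         (use in_cube in auto)
  next
    show "continuous_on ({0..1} \<times> cbox 0 1) (\<lambda>(y, t). f' (?p y t) * (1 - e))"
      unfolding split_beta
      by (intro continuous_intros continuous_on_compose2[OF f'] continuous_on_fun_upd)
         (use in_cube in auto)
  qed (use cubeD[OF x j] in auto)
  then show "((\<lambda>t. steklov j e f (x(j := t))) has_real_derivative (1 - e) * steklov j e f' x) (at (x j) within {0..1})"
    by (simp add: steklov_def mult.commute)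
qed

text \<open>The gain of one derivative: the average is a difference quotient of a primitive of \<open>f\<close> along the
  direction \<open>j\<close>.\<close>

lemma steklov_partial_difference:
  assumes f: "continuous_on (cube m) f" and j: "j < m" and e: "0 < e" "e \<le> 1"
  shows "has_cube_partial m j (steklov j e f) (\<lambda>x. (1 - e) / e *
    (f (x(j := (1 - e) * x j + e)) - f (x(j := (1 - e) * x j))))"
  unfolding has_cube_partial_def
proof
  fix x assume x: "x \<in> cube m"
  define F where "F u = integral {0..u} (\<lambda>s. f (x(j := s)))" for u
  have cont: "continuous_on {0..1} (\<lambda>s. f (x(j := s)))"
    by (intro continuous_on_compose2[OF f] continuous_on_fun_upd continuous_intros)
       (use x j cube_upd in auto)
  have F: "(F has_real_derivative f (x(j := u))) (at u within {0..1})" if "u \<in> {0..1}" for u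
    unfolding F_def has_real_derivative_iff_has_vector_derivative
    by (rule integral_has_vector_derivative[OF cont that])
  have unit: "(1 - e) * y + e * t \<in> {0..1}" if "y \<in> {0..1}" "t \<in> {0..1}" for y t
    using that e by (intro convex_unit) auto
  have eq: "steklov j e f (x(j := y)) = (F ((1 - e) * y + e) - F ((1 - e) * y)) / e"
    if y: "y \<in> {0..1}" for y
  proof -
    have "((\<lambda>t. F (e * t + (1 - e) * y) / e) has_vector_derivative f (x(j := (1 - e) * y + e * t)))
        (at t within {0..1})" if t: "t \<in> {0..1}" for t
    proof -
      have "((\<lambda>t. F (e * t + (1 - e) * y)) has_real_derivative f (x(j := (1 - e) * y + e * t)) * e)
          (at t within {0..1})"
        using F[OF unit[OF y t]] unit[OF y] by (intro affine_chain) (simp_all add: add.commute)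
      from DERIV_cdivide[OF this, of e] show ?thesis
        using e by (simp add: has_real_derivative_iff_has_vector_derivative)
    qed
    then have "((\<lambda>t. f (x(j := (1 - e) * y + e * t))) has_integral
        F (e * 1 + (1 - e) * y) / e - F (e * 0 + (1 - e) * y) / e) {0..1}"
      by (intro fundamental_theorem_of_calculus) auto
    then show ?thesis
      by (simp add: steklov_def integral_unique diff_divide_distrib add.commute)
  qed
  have xj: "x j \<in> {0..1}" by (rule cubeD[OF x j])
  have "((\<lambda>y. F ((1 - e) * y + e)) has_real_derivative f (x(j := (1 - e) * x j + e)) * (1 - e)) (at (x j) within {0..1})"
    using F[OF unit[OF xj, of 1]] unit[of _ 1] by (intro affine_chain) auto
  moreover have "((\<lambda>y. F ((1 - e) * y + 0)) has_real_derivative f (x(j := (1 - e) * x j + 0)) * (1 - e)) (at (x j) within {0..1})"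
    using F[OF unit[OF xj, of 0]] unit[of _ 0] by (intro affine_chain) auto
  ultimately have "((\<lambda>y. (F ((1 - e) * y + e) - F ((1 - e) * y)) / e) has_real_derivative
      (f (x(j := (1 - e) * x j + e)) * (1 - e) - f (x(j := (1 - e) * x j)) * (1 - e)) / e) (at (x j) within {0..1})"
    by (intro DERIV_cdivide DERIV_diff) simp_all
  then have "((\<lambda>t. steklov j e f (x(j := t))) has_real_derivative
      (f (x(j := (1 - e) * x j + e)) * (1 - e) - f (x(j := (1 - e) * x j)) * (1 - e)) / e) (at (x j) within {0..1})"
    by (rule has_field_derivative_transform_within[where d=1]) (use xj eq in auto)
  moreover have "(A * c - B * c) / e = c / e * (A - B)" for A B c :: real
    by (simp add: algebra_simps diff_divide_distrib)
  ultimately show "((\<lambda>t. steklov j e f (x(j := t))) has_real_derivative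
      (1 - e) / e * (f (x(j := (1 - e) * x j + e)) - f (x(j := (1 - e) * x j)))) (at (x j) within {0..1})"
    by metis
qed

lemma steklov_C1:
  assumes f: "cube_C1 m f" and j: "j < m" and e: "e \<in> {0..1}"
  shows "cube_C1 m (steklov j e f)"
    and "\<And>l x. l < m \<Longrightarrow> x \<in> cube m \<Longrightarrow> cube_partial (steklov j e f) l x =
      (if l = j then 1 - e else 1) * steklov j e (cube_partial f l) x"
proof -
  have D: "has_cube_partial m l (steklov j e f)
      (\<lambda>x. (if l = j then 1 - e else 1) * steklov j e (cube_partial f l) x)" if "l < m" for l
    using steklov_partial_self[OF cube_C1_D(1)[OF f] cube_C1_D(3)[OF f j] cube_C1_D(2)[OF f j] j e]
      steklov_partial_other[OF cube_C1_D(1)[OF f] cube_C1_D(3)[OF f that] cube_C1_D(2)[OF f that] j that _ e]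
    by auto
  show "cube_C1 m (steklov j e f)"
    by (rule cube_C1_I[OF _ D])
       (auto intro!: continuous_intros steklov_continuous[OF _ j e] cube_C1_D[OF f])
  show "cube_partial (steklov j e f) l x =
      (if l = j then 1 - e else 1) * steklov j e (cube_partial f l) x" if "l < m" "x \<in> cube m" for l x
    by (rule cube_partial_unique[OF D that]) (rule that)
qed

text \<open>For directions \<open>j\<close> and \<open>l \<noteq> j\<close>, both mixed derivatives equal a difference of values of \<open>\<partial>\<^sub>l f\<close> by
  \<open>steklov_partial_difference\<close>; for two directions other than \<open>j\<close>, they are averages of the mixed
  derivative of \<open>f\<close>.\<close>

lemma steklov_mixed_smooth:
  assumes f: "mixed_smooth m J f" and j: "j < m" and e: "0 < e" "e \<le> 1"
  shows "mixed_smooth m (insert j J) (steklov j e f)"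
proof -
  have C1: "cube_C1 m f" using f by (simp add: mixed_smooth_def)
  have e': "e \<in> {0..1}" using e by simp
  let ?S = "steklov j e"
  have other: "\<exists>q. continuous_on (cube m) q \<and>
      has_cube_partial m j (cube_partial (?S f) l) q \<and> has_cube_partial m l (cube_partial (?S f) j) q"
    if l: "l < m" "l \<noteq> j" for l
  proof (intro exI conjI)
    let ?q = "\<lambda>x. (1 - e) / e * (cube_partial f l (x(j := (1 - e) * x j + e))
        - cube_partial f l (x(j := (1 - e) * x j)))"
    have unit: "(1 - e) * s + e \<in> {0..1}" "(1 - e) * s \<in> {0..1}" if "s \<in> {0..1}" for s
      using convex_unit[OF e' that, of 1] convex_unit[OF e' that, of 0] by auto
    have unit': "(1 - e) * x j + e \<in> {0..1}" "(1 - e) * x j \<in> {0..1}" if "x \<in> cube m" for x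
      using unit[OF cubeD[OF that j]] by auto
    have coord: "continuous_on (cube m) (\<lambda>x. x j)"
      by (rule continuous_on_coordinate) (rule continuous_on_id)
    show "continuous_on (cube m) ?q"
      by (intro continuous_intros continuous_on_compose2[OF cube_C1_D(3)[OF C1 l(1)]]
          continuous_on_fun_upd coord)
         (auto intro!: cube_upd j unit' simp del: atLeastAtMost_iff)
    show "has_cube_partial m j (cube_partial (?S f) l) ?q"
      by (rule has_cube_partial_cong[OF steklov_partial_difference[OF cube_C1_D(3)[OF C1 l(1)] j e] j])
         (use l steklov_C1(2)[OF C1 j e'] in auto)
    let ?d = "\<lambda>x. (1 - e) / e * (f (x(j := (1 - e) * x j + e)) - f (x(j := (1 - e) * x j)))"
    have "has_cube_partial m l ?d ?q"
      unfolding has_cube_partial_def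
    proof
      fix x assume x: "x \<in> cube m"
      have "((\<lambda>t. f ((x(j := s))(l := t))) has_real_derivative cube_partial f l (x(j := s))) (at (x l) within {0..1})"
        if "s \<in> {0..1}" for s
        using cube_C1_D(2)[OF C1 l(1)] cube_upd[OF x j that] l
        by (auto simp: has_cube_partial_def dest!: bspec[where x="x(j := s)"])
      from this[OF unit(1)[OF cubeD[OF x j]]] this[OF unit(2)[OF cubeD[OF x j]]]
      have "((\<lambda>t. (1 - e) / e * (f ((x(j := (1 - e) * x j + e))(l := t)) - f ((x(j := (1 - e) * x j))(l := t))))
          has_real_derivative ?q x) (at (x l) within {0..1})"
        by (intro DERIV_cmult DERIV_diff)
      then show "((\<lambda>t. ?d (x(l := t))) has_real_derivative ?q x) (at (x l) within {0..1})"
        using l by (simp add: fun_upd_twist)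
    qed
    then show "has_cube_partial m l (cube_partial (?S f) j) ?q"
      by (rule has_cube_partial_cong[OF _ l(1)])
         (use cube_partial_unique[OF steklov_partial_difference[OF cube_C1_D(1)[OF C1] j e] j] in auto)
  qed
  have "\<exists>q. continuous_on (cube m) q \<and>
      has_cube_partial m a (cube_partial (?S f) b) q \<and> has_cube_partial m b (cube_partial (?S f) a) q"
    if ab: "a < m" "b < m" "a \<noteq> b" "a \<in> insert j J \<or> b \<in> insert j J" for a b
  proof -
    consider "a = j" | "b = j" | "a \<noteq> j" "b \<noteq> j" by blast
    then show ?thesis
    proof cases
      case 1
      with other[of b] ab show ?thesis by blast
    next
      case 2
      with other[of a] ab show ?thesis by blast
    next
      case 3
      with ab f obtain q where q: "continuous_on (cube m) q"
        "has_cube_partial m a (cube_partial f b) q" "has_cube_partial m b (cube_partial f a) q"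
        unfolding mixed_smooth_def by blast
      have "has_cube_partial m a (cube_partial (?S f) b) (?S q)"
        by (rule has_cube_partial_cong[OF steklov_partial_other[OF cube_C1_D(3)[OF C1 ab(2)] q(1,2) j ab(1) 3(1) e'] ab(1)])
           (use 3 ab steklov_C1(2)[OF C1 j e'] in auto)
      moreover have "has_cube_partial m b (cube_partial (?S f) a) (?S q)"
        by (rule has_cube_partial_cong[OF steklov_partial_other[OF cube_C1_D(3)[OF C1 ab(1)] q(1,3) j ab(2) 3(2) e'] ab(2)])
           (use 3 ab steklov_C1(2)[OF C1 j e'] in auto)
      ultimately show ?thesis using steklov_continuous[OF q(1) j e'] by blast
    qed
  qed
  then show ?thesis
    unfolding mixed_smooth_def using steklov_C1(1)[OF C1 j e'] by blast
qed

lemma bounded_on_cube_family: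
  assumes "finite I" "\<And>i. i \<in> I \<Longrightarrow> continuous_on (cube m) (F i :: _ \<Rightarrow> real)"
  shows "\<exists>B\<ge>0. \<forall>i\<in>I. \<forall>x\<in>cube m. \<bar>F i x\<bar> \<le> B"
  using assms
proof (induction I rule: finite_induct)
  case (insert i I)
  then obtain B where B: "B \<ge> 0" "\<And>i x. i \<in> I \<Longrightarrow> x \<in> cube m \<Longrightarrow> \<bar>F i x\<bar> \<le> B" by auto
  have "continuous_on (cube m) (F i)" using insert.prems by simp
  then obtain C where C: "\<And>x. x \<in> cube m \<Longrightarrow> \<bar>F i x\<bar> \<le> C"
    using bounded_on_cube by blast
  show ?case
    by (rule exI[of _ "max B C"]) (use B C in \<open>auto simp: le_max_iff_disj\<close>)
qed auto

text \<open>Induction on the number \<open>n\<close> of directions that have not been smoothed. Smoothing the direction \<open>n\<close>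
  leads to the induction hypothesis, and both sides of the formula converge as the length of the
  averaging segment tends to \<open>0\<close>, because they contain only first derivatives.\<close>

lemma stokes_partly_smooth:
  assumes g: "cube_C1 (Suc k) g" and f: "\<And>i. i < k \<Longrightarrow> mixed_smooth (Suc k) {n..<Suc k} (f i)"
    and "n \<le> Suc k"
  shows "cint (Suc k) (\<lambda>x. sqdet (Suc k) (\<lambda>i j. cube_partial (if i = 0 then g else f (i - 1)) j x)) =
    (\<Sum>j<Suc k. \<Sum>e\<in>{0, 1}. face_sign j e * cint k (\<lambda>x. g (cube_face k j e x) *
       sqdet k (\<lambda>r c. cube_partial (f r) (skip j c) (cube_face k j e x))))"
  using f \<open>n \<le> Suc k\<close>
proof (induction n arbitrary: f)
  case 0
  then show ?case using stokes_smooth[OF g] by (simp add: atLeast0LessThan)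
next
  case (Suc n)
  let ?m = "Suc k"
  have n: "n < ?m" using Suc.prems by simp
  \<comment> \<open>Lengths \<open>1/2, 1/3, \<dots>\<close>, always in the open unit interval.\<close>
  define e :: "nat \<Rightarrow> real" where "e N = 1 / (real N + 2)" for N
  have e: "0 < e N" "e N \<le> 1" "e N \<in> {0..1}" for N by (auto simp: e_def)
  define S where "S N i = steklov n (e N) (f i)" for N i
  have C1: "cube_C1 ?m (f i)" if "i < k" for i using Suc.prems that by (simp add: mixed_smooth_def)
  have S_smooth: "mixed_smooth ?m {n..<?m} (S N i)" if "i < k" for N i
  proof -
    have "{n..<?m} = insert n {Suc n..<?m}" using n by auto
    then show ?thesis
      unfolding S_def using steklov_mixed_smooth[OF Suc.prems(1)[OF that] n e(1,2)] by simp
  qed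
  have S_C1: "cube_C1 ?m (S N i)" if "i < k" for N i
    using S_smooth[OF that] by (simp add: mixed_smooth_def)
  have S_lim: "(\<lambda>N. cube_partial (S N i) j x) \<longlonglongrightarrow> cube_partial (f i) j x"
    if "i < k" "j < ?m" "x \<in> cube ?m" for i j x
  proof -
    have "(\<lambda>N. (if j = n then 1 - e N else 1) * steklov n (e N) (cube_partial (f i) j) x) \<longlonglongrightarrow>
        1 * cube_partial (f i) j x"
    proof (rule tendsto_mult)
      show "(\<lambda>N. if j = n then 1 - e N else 1) \<longlonglongrightarrow> 1"
        unfolding e_def by (cases "j = n") (simp_all, real_asymp)
      show "(\<lambda>N. steklov n (e N) (cube_partial (f i) j) x) \<longlonglongrightarrow> cube_partial (f i) j x"
        unfolding e_def using that n by (intro steklov_tendsto[of ?m] cube_C1_D[OF C1])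
    qed
    then show ?thesis
      unfolding S_def using steklov_C1(2)[OF C1 n e(3)] that by simp
  qed
  have "\<exists>B\<ge>0. \<forall>p\<in>{..<k} \<times> {..<?m}. \<forall>x\<in>cube ?m. \<bar>cube_partial (f (fst p)) (snd p) x\<bar> \<le> B"
    by (intro bounded_on_cube_family) (auto intro!: cube_C1_D(3) C1)
  then obtain Bf where Bf: "Bf \<ge> 0"
    "\<And>i j x. i < k \<Longrightarrow> j < ?m \<Longrightarrow> x \<in> cube ?m \<Longrightarrow> \<bar>cube_partial (f i) j x\<bar> \<le> Bf" by force
  have "\<exists>B\<ge>0. \<forall>j\<in>{..<?m}. \<forall>x\<in>cube ?m. \<bar>cube_partial g j x\<bar> \<le> B"
    by (intro bounded_on_cube_family) (auto intro!: cube_C1_D(3) g)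
  then obtain Bg where Bg: "Bg \<ge> 0"
    "\<And>j x. j < ?m \<Longrightarrow> x \<in> cube ?m \<Longrightarrow> \<bar>cube_partial g j x\<bar> \<le> Bg" by force
  obtain G where G: "\<And>x. x \<in> cube ?m \<Longrightarrow> \<bar>g x\<bar> \<le> G" "G \<ge> 0"
    using bounded_on_cube[OF cube_C1_D(1)[OF g]] by blast
  define B where "B = max Bf Bg"
  have Sb: "\<bar>cube_partial (S N i) j x\<bar> \<le> Bf" if "i < k" "j < ?m" "x \<in> cube ?m" for N i j x
  proof -
    have "\<bar>steklov n (e N) (cube_partial (f i) j) x\<bar> \<le> Bf"
      by (rule steklov_bound[OF cube_C1_D(3)[OF C1] n e(3)]) (use that Bf in auto)
    moreover have "\<bar>if j = n then 1 - e N else 1\<bar> \<le> 1" using e[of N] by auto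
    ultimately have "\<bar>if j = n then 1 - e N else 1\<bar> * \<bar>steklov n (e N) (cube_partial (f i) j) x\<bar> \<le> 1 * Bf"
      by (intro mult_mono) auto
    then show ?thesis
      unfolding S_def using steklov_C1(2)[OF C1 n e(3)] that by (simp add: abs_mult)
  qed
  have "(\<lambda>N. cint ?m (\<lambda>x. sqdet ?m (\<lambda>i j. cube_partial (if i = 0 then g else S N (i - 1)) j x))) \<longlonglongrightarrow>
      cint ?m (\<lambda>x. sqdet ?m (\<lambda>i j. cube_partial (if i = 0 then g else f (i - 1)) j x))"
  proof (rule cint_tendsto)
    fix N x assume x: "x \<in> cube ?m"
    show "\<bar>sqdet ?m (\<lambda>i j. cube_partial (if i = 0 then g else S N (i - 1)) j x)\<bar> \<le> fact ?m * B ^ ?m"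
      by (intro abs_sqdet_le) (use x Sb Bg(2) in \<open>auto simp: B_def le_max_iff_disj\<close>)
  next
    fix x assume x: "x \<in> cube ?m"
    show "(\<lambda>N. sqdet ?m (\<lambda>i j. cube_partial (if i = 0 then g else S N (i - 1)) j x)) \<longlonglongrightarrow>
        sqdet ?m (\<lambda>i j. cube_partial (if i = 0 then g else f (i - 1)) j x)"
      by (intro tendsto_sqdet) (use x S_lim in auto)
  qed (auto intro!: continuous_on_sqdet cube_C1_D(3) g S_C1 C1)
  moreover have "(\<lambda>N. \<Sum>j<?m. \<Sum>e\<in>{0, 1}. face_sign j e * cint k (\<lambda>x. g (cube_face k j e x) *
       sqdet k (\<lambda>r c. cube_partial (S N r) (skip j c) (cube_face k j e x)))) \<longlonglongrightarrow>
      (\<Sum>j<?m. \<Sum>e\<in>{0, 1}. face_sign j e * cint k (\<lambda>x. g (cube_face k j e x) *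
       sqdet k (\<lambda>r c. cube_partial (f r) (skip j c) (cube_face k j e x))))"
  proof (intro tendsto_sum tendsto_mult tendsto_const cint_tendsto)
    fix j e' x N assume j: "j \<in> {..<?m}" and "e' \<in> {0, 1 :: real}" and "x \<in> cube k"
    then have face: "cube_face k j e' x \<in> cube ?m" by (intro cube_face_in_cube) auto
    have "\<bar>sqdet k (\<lambda>r c. cube_partial (S N r) (skip j c) (cube_face k j e' x))\<bar> \<le> fact k * Bf ^ k"
      by (intro abs_sqdet_le Sb) (use face j in \<open>auto simp: skip_def\<close>)
    then show "\<bar>g (cube_face k j e' x) * sqdet k (\<lambda>r c. cube_partial (S N r) (skip j c) (cube_face k j e' x))\<bar>
        \<le> G * (fact k * Bf ^ k)"
      unfolding abs_mult using face G by (intro mult_mono) auto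
  next
    fix j e' x assume j: "j \<in> {..<?m}" and "e' \<in> {0, 1 :: real}" and "x \<in> cube k"
    then have "cube_face k j e' x \<in> cube ?m" by (intro cube_face_in_cube) auto
    then show "(\<lambda>N. sqdet k (\<lambda>r c. cube_partial (S N r) (skip j c) (cube_face k j e' x))) \<longlonglongrightarrow>
        sqdet k (\<lambda>r c. cube_partial (f r) (skip j c) (cube_face k j e' x))"
      using j by (intro tendsto_sqdet S_lim) (auto simp: skip_def)
  next
    fix j e' N assume "j \<in> {..<?m}" "e' \<in> {0, 1 :: real}"
    then show "continuous_on (cube k) (\<lambda>x. g (cube_face k j e' x) *
        sqdet k (\<lambda>r c. cube_partial (S N r) (skip j c) (cube_face k j e' x)))"
      by (intro continuous_intros continuous_on_sqdet cube_face_continuous' cube_C1_D g S_C1)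
         (auto simp: skip_def)
  next
    fix j and e' :: real assume "j \<in> {..<?m}" "e' \<in> {0, 1 :: real}"
    then show "continuous_on (cube k) (\<lambda>x. g (cube_face k j e' x) *
        sqdet k (\<lambda>r c. cube_partial (f r) (skip j c) (cube_face k j e' x)))"
      by (intro continuous_intros continuous_on_sqdet cube_face_continuous' cube_C1_D g C1)
         (auto simp: skip_def)
  qed
  moreover have "cint ?m (\<lambda>x. sqdet ?m (\<lambda>i j. cube_partial (if i = 0 then g else S N (i - 1)) j x)) =
      (\<Sum>j<?m. \<Sum>e\<in>{0, 1}. face_sign j e * cint k (\<lambda>x. g (cube_face k j e x) *
       sqdet k (\<lambda>r c. cube_partial (S N r) (skip j c) (cube_face k j e x))))" for N
    by (rule Suc.IH) (use S_smooth n in auto)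
  ultimately show ?case by (simp add: LIMSEQ_unique del: sum.lessThan_Suc)
qed

lemma cube_stokes:
  assumes "cube_C1 (Suc k) g" "\<And>i. i < k \<Longrightarrow> cube_C1 (Suc k) (f i)"
  shows "cint (Suc k) (\<lambda>x. sqdet (Suc k) (\<lambda>i j. cube_partial (if i = 0 then g else f (i - 1)) j x)) =
    (\<Sum>j<Suc k. \<Sum>e\<in>{0, 1}. face_sign j e * cint k (\<lambda>x. g (cube_face k j e x) *
       sqdet k (\<lambda>r c. cube_partial (f r) (skip j c) (cube_face k j e x))))"
  using assms by (intro stokes_partly_smooth[where n="Suc k"]) (auto simp: mixed_smooth_def)

section \<open>Differential calculus and diffeomorphisms of the closed cube\<close>

lemma tendsto_fun_coordinatewise:
  fixes f :: "'a \<Rightarrow> nat \<Rightarrow> real"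
  assumes "\<And>i. ((\<lambda>t. f t i) \<longlongrightarrow> l i) F"
  shows "(f \<longlongrightarrow> l) F"
  using limitin_componentwise[of "\<lambda>_. euclidean" UNIV f l F] assms
  by (simp add: euclidean_product_topology)

lemma mvt_unit_interval:
  assumes D: "\<And>t. t \<in> {0..1} \<Longrightarrow> (f has_real_derivative f' t) (at t within {0..1})"
    and "a \<in> {0..1}" "b \<in> {0..1}"
  obtains c where "c \<in> closed_segment a b" "f b - f a = f' c * (b - a)"
proof -
  have *: "\<exists>c\<in>{a<..<b}. f b - f a = f' c * (b - a)" if "a < b" "a \<in> {0..1}" "b \<in> {0..1}" for a b
  proof (rule mvt_simple[OF \<open>a < b\<close>])
    fix t assume "a \<le> t" "t \<le> b"
    with D[of t] that have "(f has_real_derivative f' t) (at t within {a..b})"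
      by (intro has_field_derivative_subset[OF D]) auto
    then show "(f has_derivative (\<lambda>h. f' t * h)) (at t within {a..b})"
      by (simp add: has_field_derivative_def)
  qed
  consider "a < b" | "a = b" | "b < a" by linarith
  then show thesis
  proof cases
    case 1
    with *[of a b] assms(2,3) obtain c where "c \<in> {a<..<b}" "f b - f a = f' c * (b - a)" by blast
    with 1 show ?thesis by (intro that[of c]) (auto simp: closed_segment_eq_real_ivl)
  next
    case 2
    then show ?thesis by (intro that[of a]) auto
  next
    case 3
    with *[of b a] assms(2,3) obtain c where c: "c \<in> {b<..<a}" "f a - f b = f' c * (a - b)" by blast
    have "f b - f a = f' c * (b - a)" using c(2) by (simp add: algebra_simps)
    with 3 c(1) show ?thesis by (intro that[of c]) (auto simp: closed_segment_eq_real_ivl)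
  qed
qed

text \<open>Moving from \<open>x\<close> to \<open>y\<close> one coordinate at a time, with the mean value theorem on each leg.\<close>

lemma cube_mean_value:
  assumes f: "cube_C1 m (f :: _ \<Rightarrow> real)" and x: "x \<in> cube m" and y: "y \<in> cube m"
  shows "\<exists>z. (\<forall>l<m. z l \<in> cube m \<and> (\<forall>i. \<bar>z l i - x i\<bar> \<le> \<bar>y i - x i\<bar>)) \<and>
    f y - f x = (\<Sum>l<m. cube_partial f l (z l) * (y l - x l))"
proof -
  define w where "w l i = (if i < l then y i else x i)" for l i :: nat
  have w: "w l \<in> cube m" if "l \<le> m" for l
    using x y that by (auto simp: cube_iff w_def)
  have "\<exists>z. z \<in> cube m \<and> (\<forall>i. \<bar>z i - x i\<bar> \<le> \<bar>y i - x i\<bar>) \<and>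
      f (w (Suc l)) - f (w l) = cube_partial f l z * (y l - x l)" if l: "l < m" for l
  proof -
    have D: "((\<lambda>t. f ((w l)(l := t))) has_real_derivative cube_partial f l ((w l)(l := t)))
        (at t within {0..1})" if "t \<in> {0..1}" for t
      using cube_C1_D(2)[OF f l] cube_upd[OF w l that] l
      by (auto simp: has_cube_partial_def dest!: bspec[where x="(w l)(l := t)"])
    obtain c where c: "c \<in> closed_segment (x l) (y l)"
      "f ((w l)(l := y l)) - f ((w l)(l := x l)) = cube_partial f l ((w l)(l := c)) * (y l - x l)"
      using mvt_unit_interval[OF D cubeD[OF x l] cubeD[OF y l]] by blast
    have c01: "c \<in> {0..1}"
      using c(1) cubeD[OF x l] cubeD[OF y l] closed_segment_subset[of "x l" "{0..1}" "y l"] by auto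
    have "\<bar>c - x l\<bar> \<le> \<bar>y l - x l\<bar>"
      using c(1) by (auto simp: closed_segment_eq_real_ivl split: if_splits)
    moreover have "(w l)(l := y l) = w (Suc l)" "(w l)(l := x l) = w l"
      by (auto simp: w_def fun_eq_iff)
    ultimately show ?thesis
      using c(2) cube_upd[OF w l c01] l
      by (intro exI[of _ "(w l)(l := c)"]) (auto simp: w_def)
  qed
  then obtain z where z: "\<And>l. l < m \<Longrightarrow> z l \<in> cube m"
    "\<And>l i. l < m \<Longrightarrow> \<bar>z l i - x i\<bar> \<le> \<bar>y i - x i\<bar>"
    "\<And>l. l < m \<Longrightarrow> f (w (Suc l)) - f (w l) = cube_partial f l (z l) * (y l - x l)"
    by metis
  have "w m = y" "w 0 = x" using x y by (auto simp: w_def fun_eq_iff cube_iff)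
  then have "f y - f x = (\<Sum>l<m. f (w (Suc l)) - f (w l))"
    using sum_lessThan_telescope[of "\<lambda>l. f (w l)" m] by simp
  with z show ?thesis by (intro exI[of _ z]) auto
qed

text \<open>A Caratheodory form of differentiability: increments of \<open>f\<close> are linear in the increments of the
  coordinates, with slopes that converge to the partial derivatives. It replaces the Frechet
  derivative on the space of all functions on the naturals, which carries no norm.\<close>

lemma cube_slopes:
  assumes f: "cube_C1 m (f :: _ \<Rightarrow> real)" and x: "x \<in> cube m"
    and ev: "eventually (\<lambda>t. \<gamma> t \<in> cube m) F"
    and lim: "\<And>i. i < m \<Longrightarrow> ((\<lambda>t. \<gamma> t i) \<longlongrightarrow> x i) F"
  shows "\<exists>Q. (\<forall>t. \<gamma> t \<in> cube m \<longrightarrow> f (\<gamma> t) - f x = (\<Sum>l<m. Q t l * (\<gamma> t l - x l))) \<and>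
    (\<forall>l<m. ((\<lambda>t. Q t l) \<longlongrightarrow> cube_partial f l x) F)"
proof -
  have "\<forall>t. \<exists>z. \<gamma> t \<in> cube m \<longrightarrow> (\<forall>l<m. z l \<in> cube m \<and> (\<forall>i. \<bar>z l i - x i\<bar> \<le> \<bar>\<gamma> t i - x i\<bar>)) \<and>
    f (\<gamma> t) - f x = (\<Sum>l<m. cube_partial f l (z l) * (\<gamma> t l - x l))"
    using cube_mean_value[OF f x] by blast
  from choice[OF this] obtain z where "\<forall>t. \<gamma> t \<in> cube m \<longrightarrow>
    (\<forall>l<m. z t l \<in> cube m \<and> (\<forall>i. \<bar>z t l i - x i\<bar> \<le> \<bar>\<gamma> t i - x i\<bar>)) \<and>
    f (\<gamma> t) - f x = (\<Sum>l<m. cube_partial f l (z t l) * (\<gamma> t l - x l))" ..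
  then have z: "\<And>t l. \<gamma> t \<in> cube m \<Longrightarrow> l < m \<Longrightarrow> z t l \<in> cube m"
    "\<And>t l i. \<gamma> t \<in> cube m \<Longrightarrow> l < m \<Longrightarrow> \<bar>z t l i - x i\<bar> \<le> \<bar>\<gamma> t i - x i\<bar>"
    "\<And>t. \<gamma> t \<in> cube m \<Longrightarrow> f (\<gamma> t) - f x = (\<Sum>l<m. cube_partial f l (z t l) * (\<gamma> t l - x l))"
    by auto
  have "((\<lambda>t. cube_partial f l (z t l)) \<longlongrightarrow> cube_partial f l x) F" if l: "l < m" for l
  proof (rule continuous_on_tendsto_compose[OF cube_C1_D(3)[OF f l] _ x])
    show "eventually (\<lambda>t. z t l \<in> cube m) F"
      using ev by eventually_elim (rule z(1)[OF _ l])
    show "((\<lambda>t. z t l) \<longlongrightarrow> x) F"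
    proof (rule tendsto_fun_coordinatewise)
      fix i
      have "((\<lambda>t. \<gamma> t i) \<longlongrightarrow> x i) F"
      proof (cases "i < m")
        case False
        then have "eventually (\<lambda>t. x i = \<gamma> t i) F"
          using ev x by (auto simp: cube_iff elim!: eventually_mono)
        then show ?thesis by (rule Lim_transform_eventually[OF tendsto_const])
      qed (rule lim)
      then have "((\<lambda>t. \<gamma> t i - x i) \<longlongrightarrow> 0) F" by (simp add: LIM_zero)
      moreover have "eventually (\<lambda>t. norm (z t l i - x i) \<le> norm (\<gamma> t i - x i)) F"
        using ev by eventually_elim (simp add: z(2) l)
      ultimately have "((\<lambda>t. z t l i - x i) \<longlongrightarrow> 0) F"
        by (metis Lim_null_comparison tendsto_norm_zero)
      then show "((\<lambda>t. z t l i) \<longlongrightarrow> x i) F" by (simp add: LIM_zero_iff)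
    qed
  qed
  with z(3) show ?thesis by (intro exI[of _ "\<lambda>t l. cube_partial f l (z t l)"]) blast
qed

lemma cube_chain_rule:
  assumes f: "cube_C1 m (f :: _ \<Rightarrow> real)" and s: "s \<in> {0..1}"
    and \<gamma>: "\<And>t. t \<in> {0..1} \<Longrightarrow> \<gamma> t \<in> cube m"
    and d: "\<And>l. l < m \<Longrightarrow> ((\<lambda>t. \<gamma> t l) has_real_derivative d l) (at s within {0..1})"
  shows "((\<lambda>t. f (\<gamma> t)) has_real_derivative (\<Sum>l<m. cube_partial f l (\<gamma> s) * d l)) (at s within {0..1})"
proof -
  let ?F = "at s within {0..1}"
  have ev: "eventually (\<lambda>t. t \<in> {0..1}) ?F" by (simp add: eventually_at_filter)
  have "((\<lambda>t. \<gamma> t i) \<longlongrightarrow> \<gamma> s i) ?F" if "i < m" for i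
    using DERIV_continuous[OF d[OF that]] by (simp add: continuous_within)
  with cube_slopes[OF f \<gamma>[OF s], of \<gamma> ?F] ev \<gamma> obtain Q where
    Q: "\<And>t. t \<in> {0..1} \<Longrightarrow> f (\<gamma> t) - f (\<gamma> s) = (\<Sum>l<m. Q t l * (\<gamma> t l - \<gamma> s l))"
    "\<And>l. l < m \<Longrightarrow> ((\<lambda>t. Q t l) \<longlongrightarrow> cube_partial f l (\<gamma> s)) ?F"
    by (smt (verit) eventually_mono)
  have "((\<lambda>t. \<Sum>l<m. Q t l * ((\<gamma> t l - \<gamma> s l) / (t - s))) \<longlongrightarrow> (\<Sum>l<m. cube_partial f l (\<gamma> s) * d l)) ?F"
    using d Q(2) by (intro tendsto_sum tendsto_mult) (auto simp: has_field_derivative_iff)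
  moreover have "eventually (\<lambda>t. (\<Sum>l<m. Q t l * ((\<gamma> t l - \<gamma> s l) / (t - s))) = (f (\<gamma> t) - f (\<gamma> s)) / (t - s)) ?F"
    using ev by eventually_elim (simp add: Q(1) sum_divide_distrib)
  ultimately show ?thesis
    unfolding has_field_derivative_iff by (rule Lim_transform_eventually)
qed

lemma continuous_on_cube_valued:
  assumes "\<And>i. i < k \<Longrightarrow> continuous_on S (\<lambda>x. \<psi> x i)" "\<And>x. x \<in> S \<Longrightarrow> \<psi> x \<in> cube k"
  shows "continuous_on S \<psi>"
proof (rule continuous_on_coordinatewise_then_product)
  fix i
  show "continuous_on S (\<lambda>x. \<psi> x i)"
  proof (cases "i < k")
    case False
    then have "continuous_on S (\<lambda>x. \<psi> x i) \<longleftrightarrow> continuous_on S (\<lambda>_. undefined :: real)"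
      using assms(2) by (intro continuous_on_cong) (auto simp: cube_iff)
    then show ?thesis by simp
  qed (rule assms)
qed

lemma cube_C1_compose:
  assumes f: "cube_C1 k (f :: _ \<Rightarrow> real)"
    and \<phi>: "\<And>l. l < k \<Longrightarrow> cube_C1 m (\<lambda>x. \<phi> x l)" "\<And>x. x \<in> cube m \<Longrightarrow> \<phi> x \<in> cube k"
  shows "cube_C1 m (\<lambda>x. f (\<phi> x))"
    and "\<And>j x. j < m \<Longrightarrow> x \<in> cube m \<Longrightarrow> cube_partial (\<lambda>x. f (\<phi> x)) j x =
      (\<Sum>l<k. cube_partial f l (\<phi> x) * cube_partial (\<lambda>x. \<phi> x l) j x)"
proof -
  let ?D = "\<lambda>j x. \<Sum>l<k. cube_partial f l (\<phi> x) * cube_partial (\<lambda>x. \<phi> x l) j x"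
  have cont: "continuous_on (cube m) \<phi>"
    by (rule continuous_on_cube_valued[where k=k]) (auto intro: cube_C1_D(1)[OF \<phi>(1)] \<phi>(2))
  have D: "has_cube_partial m j (\<lambda>x. f (\<phi> x)) (?D j)" if j: "j < m" for j
    unfolding has_cube_partial_def
  proof
    fix x assume x: "x \<in> cube m"
    have d: "((\<lambda>t. \<phi> (x(j := t)) l) has_real_derivative cube_partial (\<lambda>x. \<phi> x l) j x) (at (x j) within {0..1})"
      if "l < k" for l
      using cube_C1_D(2)[OF \<phi>(1)[OF that] j] x unfolding has_cube_partial_def by blast
    have "\<phi> (x(j := t)) \<in> cube k" if "t \<in> {0..1}" for t
      by (intro \<phi>(2) cube_upd[OF x j] that)
    from cube_chain_rule[where \<gamma>="\<lambda>t. \<phi> (x(j := t))", OF f cubeD[OF x j] this d]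
    show "((\<lambda>t. f (\<phi> (x(j := t)))) has_real_derivative ?D j x) (at (x j) within {0..1})"
      by simp
  qed
  show "cube_C1 m (\<lambda>x. f (\<phi> x))"
    by (rule cube_C1_I[OF _ D])
       (auto intro!: continuous_intros continuous_on_compose2[OF cube_C1_D(1)[OF f] cont]
          continuous_on_compose2[OF cube_C1_D(3)[OF f] cont] cube_C1_D(3)[OF \<phi>(1)] \<phi>(2))
  show "cube_partial (\<lambda>x. f (\<phi> x)) j x = ?D j x" if "j < m" "x \<in> cube m" for j x
    by (rule cube_partial_unique[OF D that]) (rule that)
qed

text \<open>The Jacobian matrix, in the argument order of \<open>sqdet\<close>.\<close>

definition jac :: "((nat \<Rightarrow> real) \<Rightarrow> nat \<Rightarrow> real) \<Rightarrow> (nat \<Rightarrow> real) \<Rightarrow> nat \<Rightarrow> nat \<Rightarrow> real" where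
  "jac \<psi> x i j = cube_partial (\<lambda>y. \<psi> y i) j x"

lemma cube_diffeo_iff:
  "cube_diffeo k s \<psi> \<longleftrightarrow> s \<in> {1, -1} \<and> bij_betw \<psi> (cube k) (cube k) \<and>
     (\<forall>i<k. cube_C1 k (\<lambda>x. \<psi> x i)) \<and> (\<forall>x\<in>cube k. sgn (sqdet k (jac \<psi> x)) = s)"
  by (simp add: cube_diffeo_def sqdet_def jac_def)

lemma cube_diffeo_compose:
  assumes \<psi>: "cube_diffeo k s \<psi>" and \<phi>: "cube_diffeo k s' \<phi>"
  shows "cube_diffeo k (s * s') (\<psi> \<circ> \<phi>)"
proof -
  have maps: "\<phi> x \<in> cube k" if "x \<in> cube k" for x
    using \<phi> that by (auto simp: cube_diffeo_iff bij_betw_def)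
  have C1: "cube_C1 k (\<lambda>x. \<psi> x i)" "cube_C1 k (\<lambda>x. \<phi> x i)" if "i < k" for i
    using \<psi> \<phi> that by (auto simp: cube_diffeo_iff)
  have "sqdet k (jac (\<psi> \<circ> \<phi>) x) = sqdet k (jac \<psi> (\<phi> x)) * sqdet k (jac \<phi> x)" if x: "x \<in> cube k" for x
    unfolding sqdet_mult[symmetric]
    by (intro sqdet_cong) (use cube_C1_compose(2)[OF C1(1) C1(2) maps] x in \<open>simp add: jac_def\<close>)
  then show ?thesis
    using \<psi> \<phi> maps cube_C1_compose(1)[OF C1(1) C1(2) maps] bij_betw_trans[of \<phi> "cube k" "cube k" \<psi> "cube k"]
    unfolding cube_diffeo_iff by (auto simp: sgn_mult)
qed

text \<open>The inverse is continuous by compactness. Along a segment in direction \<open>j\<close> in the target, the slopes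
  of \<open>\<psi>\<close> between preimages form a matrix \<open>Q\<close> that maps the increment of the preimage to a multiple of
  the \<open>j\<close>-th unit vector. Cramer's rule solves for the difference quotients of the inverse, and these converge
  since \<open>Q\<close> tends to the invertible Jacobian of \<open>\<psi>\<close>. This argument is valid up to the boundary of the
  cube.\<close>

lemma cube_diffeo_inverse:
  assumes \<psi>: "cube_diffeo k s \<psi>"
  shows "cube_diffeo k s (inv_into (cube k) \<psi>)"
proof -
  define \<theta> where "\<theta> = inv_into (cube k) \<psi>"
  have bij: "bij_betw \<psi> (cube k) (cube k)" and s: "s \<in> {1, -1}"
    and sgn_J: "\<And>x. x \<in> cube k \<Longrightarrow> sgn (sqdet k (jac \<psi> x)) = s"
    and C1: "\<And>i. i < k \<Longrightarrow> cube_C1 k (\<lambda>x. \<psi> x i)"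
    using \<psi> by (auto simp: cube_diffeo_iff)
  have J: "sqdet k (jac \<psi> x) \<noteq> 0" if "x \<in> cube k" for x
    using sgn_J[OF that] s by auto
  have \<theta>_bij: "bij_betw \<theta> (cube k) (cube k)"
    unfolding \<theta>_def by (rule bij_betw_inv_into[OF bij])
  have maps: "\<psi> x \<in> cube k" "\<theta> x \<in> cube k" if "x \<in> cube k" for x
    using bij \<theta>_bij that by (auto simp: bij_betw_def)
  have inv: "\<psi> (\<theta> y) = y" "\<theta> (\<psi> y) = y" if "y \<in> cube k" for y
    unfolding \<theta>_def using bij that
    by (auto simp: bij_betw_def f_inv_into_f)
  have \<psi>_cont: "continuous_on (cube k) \<psi>"
    by (rule continuous_on_cube_valued[where k=k]) (auto intro: cube_C1_D(1)[OF C1] maps)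
  have \<theta>_cont: "continuous_on (cube k) \<theta>"
    using continuous_on_inv[OF \<psi>_cont compact_cube, of \<theta>] inv(2) bij by (auto simp: bij_betw_def)
  have jac_cont: "continuous_on (cube k) (\<lambda>x. jac \<psi> x i j)" if "i < k" "j < k" for i j
    unfolding jac_def by (intro cube_C1_D C1 that)
  define D where "D l j y = sqcof k (jac \<psi> (\<theta> y)) j l / sqdet k (jac \<psi> (\<theta> y))" for l j y
  have D_cont: "continuous_on (cube k) (D l j)" for l j
    unfolding D_def
    by (intro continuous_on_divide continuous_on_sqcof continuous_on_sqdet ballI J maps
        continuous_on_compose2[OF jac_cont \<theta>_cont]) (auto intro: maps)
  have D: "has_cube_partial k j (\<lambda>y. \<theta> y l) (D l j)" if j: "j < k" and l: "l < k" for l j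
    unfolding has_cube_partial_def
  proof
    fix y assume y: "y \<in> cube k"
    let ?F = "at (y j) within {0..1}"
    define \<gamma> where "\<gamma> t = \<theta> (y(j := t))" for t
    have \<gamma>_cube: "\<gamma> t \<in> cube k" if "t \<in> {0..1}" for t
      unfolding \<gamma>_def by (intro maps cube_upd y j that)
    have \<gamma>_y: "\<gamma> (y j) = \<theta> y" by (simp add: \<gamma>_def)
    have ev: "eventually (\<lambda>t. t \<in> {0..1}) ?F" by (simp add: eventually_at_filter)
    have ev': "eventually (\<lambda>t. \<gamma> t \<in> cube k) ?F"
      using ev by eventually_elim (rule \<gamma>_cube)
    have "continuous_on {0..1} \<gamma>"
      unfolding \<gamma>_def
      by (intro continuous_on_compose2[OF \<theta>_cont] continuous_on_fun_upd continuous_intros)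
         (use y j cube_upd in auto)
    then have "continuous_on {0..1} (\<lambda>t. \<gamma> t i)" for i
      by (rule continuous_on_product_then_coordinatewise)
    then have \<gamma>_lim: "((\<lambda>t. \<gamma> t i) \<longlongrightarrow> \<theta> y i) ?F" for i
      using cubeD[OF y j] unfolding continuous_on_def \<gamma>_y[symmetric] by blast
    have "\<forall>i\<in>{..<k}. \<exists>Q. (\<forall>t. \<gamma> t \<in> cube k \<longrightarrow> \<psi> (\<gamma> t) i - \<psi> (\<theta> y) i = (\<Sum>l<k. Q t l * (\<gamma> t l - \<theta> y l))) \<and>
        (\<forall>l<k. ((\<lambda>t. Q t l) \<longlongrightarrow> jac \<psi> (\<theta> y) i l) ?F)"
      unfolding jac_def by (intro ballI cube_slopes C1 maps y ev' \<gamma>_lim) auto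
    from bchoice[OF this] obtain Q where "\<forall>i\<in>{..<k}.
        (\<forall>t. \<gamma> t \<in> cube k \<longrightarrow> \<psi> (\<gamma> t) i - \<psi> (\<theta> y) i = (\<Sum>l<k. Q i t l * (\<gamma> t l - \<theta> y l))) \<and>
        (\<forall>l<k. ((\<lambda>t. Q i t l) \<longlongrightarrow> jac \<psi> (\<theta> y) i l) ?F)" ..
    then have Q: "\<And>i t. i < k \<Longrightarrow> \<gamma> t \<in> cube k \<Longrightarrow>
        \<psi> (\<gamma> t) i - \<psi> (\<theta> y) i = (\<Sum>l<k. Q i t l * (\<gamma> t l - \<theta> y l))"
      "\<And>i l. i < k \<Longrightarrow> l < k \<Longrightarrow> ((\<lambda>t. Q i t l) \<longlongrightarrow> jac \<psi> (\<theta> y) i l) ?F"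
      by auto
    let ?A = "\<lambda>t i l. Q i t l"
    have cramer_t: "sqdet k (?A t) * (\<gamma> t l - \<theta> y l) = (t - y j) * sqcof k (?A t) j l"
      if t: "t \<in> {0..1}" for t
    proof (rule cramer_cofactor)
      fix i assume i: "i < k"
      have "(\<Sum>m<k. Q i t m * (\<gamma> t m - \<theta> y m)) = (y(j := t)) i - y i"
        using Q(1)[OF i \<gamma>_cube[OF t]] inv(1)[OF y] inv(1)[OF cube_upd[OF y j t]] by (simp add: \<gamma>_def)
      then show "(\<Sum>m<k. Q i t m * (\<gamma> t m - \<theta> y m)) = (if i = j then t - y j else 0)" by simp
    qed (use j l in auto)
    have det_lim: "((\<lambda>t. sqdet k (?A t)) \<longlongrightarrow> sqdet k (jac \<psi> (\<theta> y))) ?F"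
      by (intro tendsto_sqdet Q(2))
    have "eventually (\<lambda>t. sqdet k (?A t) \<noteq> 0) ?F"
      using tendsto_imp_eventually_ne[OF det_lim J[OF maps(2)[OF y]]] .
    moreover have "eventually (\<lambda>t. t \<noteq> y j) ?F" by (simp add: eventually_at_filter)
    ultimately have "eventually (\<lambda>t. sqcof k (?A t) j l / sqdet k (?A t) = (\<gamma> t l - \<gamma> (y j) l) / (t - y j)) ?F"
      using ev
    proof eventually_elim
      case (elim t)
      then show ?case using cramer_t[of t] by (simp add: \<gamma>_y field_simps)
    qed
    moreover have "((\<lambda>t. sqcof k (?A t) j l / sqdet k (?A t)) \<longlongrightarrow> D l j y) ?F"
      unfolding D_def by (intro tendsto_divide tendsto_sqcof det_lim Q(2) J maps y)
    ultimately have "((\<lambda>t. \<gamma> t l) has_real_derivative D l j y) ?F"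
      unfolding has_field_derivative_iff by (rule Lim_transform_eventually[rotated])
    then show "((\<lambda>t. \<theta> (y(j := t)) l) has_real_derivative D l j y) ?F" by (simp add: \<gamma>_def)
  qed
  have \<theta>_C1: "cube_C1 k (\<lambda>y. \<theta> y l)" if l: "l < k" for l
    by (rule cube_C1_I[OF _ D[OF _ l]])
       (auto intro: D_cont continuous_on_product_then_coordinatewise[OF \<theta>_cont])
  have "sgn (sqdet k (jac \<theta> y)) = s" if y: "y \<in> cube k" for y
  proof -
    have "(\<Sum>l<k. jac \<psi> (\<theta> y) i l * jac \<theta> y l j) = (if i = j then 1 else 0)" if "i < k" "j < k" for i j
    proof -
      have "has_cube_partial k j (\<lambda>y. y i) (\<lambda>_. if i = j then 1 else 0)"
        by (auto simp: has_cube_partial_def intro!: derivative_eq_intros)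
      then have "has_cube_partial k j (\<lambda>y. \<psi> (\<theta> y) i) (\<lambda>_. if i = j then 1 else 0)"
        by (rule has_cube_partial_cong[OF _ that(2)]) (auto simp: inv)
      from cube_partial_unique[OF this that(2) y] show ?thesis
        using cube_C1_compose(2)[OF C1[OF that(1)] \<theta>_C1 maps(2) that(2) y] by (simp add: jac_def)
    qed
    then have "sqdet k (\<lambda>i j. \<Sum>l<k. jac \<psi> (\<theta> y) i l * jac \<theta> y l j) = sqdet k (\<lambda>i j. if i = j then 1 else 0)"
      by (intro sqdet_cong) simp
    then have "sqdet k (jac \<psi> (\<theta> y)) * sqdet k (jac \<theta> y) = 1"
      by (simp add: sqdet_mult sqdet_id)
    then have "s * sgn (sqdet k (jac \<theta> y)) = 1"
      using sgn_J[OF maps(2)[OF y]] by (metis sgn_mult sgn_1)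
    then show ?thesis using s by auto
  qed
  then show ?thesis
    using s \<theta>_bij \<theta>_C1 unfolding cube_diffeo_iff \<theta>_def[symmetric] by blast
qed

section \<open>Change of variables on the cube\<close>

lemma cint_restrict:
  assumes G: "continuous_on (cube k) G" and "k \<le> m"
  shows "cint m (\<lambda>x. G (restrict x {..<k})) = cint k G"
    and "continuous_on (cube m) (\<lambda>x. G (restrict x {..<k}))"
proof -
  have cont: "continuous_on (cube m) (\<lambda>x. G (restrict x {..<k}))" if "k \<le> m" for m
  proof (rule continuous_on_compose2[OF G])
    show in_cube: "(\<lambda>x. restrict x {..<k}) ` cube m \<subseteq> cube k"
      using that by (auto simp: cube_iff)
    show "continuous_on (cube m) (\<lambda>x. restrict x {..<k})"
      by (rule continuous_on_cube_valued[where k=k])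
         (use in_cube in \<open>auto intro!: continuous_on_coordinate continuous_on_id simp: restrict_def\<close>)
  qed
  show "continuous_on (cube m) (\<lambda>x. G (restrict x {..<k}))" by (rule cont) fact
  show "cint m (\<lambda>x. G (restrict x {..<k})) = cint k G"
    using \<open>k \<le> m\<close>
  proof (induction m rule: dec_induct)
    case base
    have "restrict x {..<k} = x" if "x \<in> cube k" for x
      using that by (auto simp: cube_iff restrict_def fun_eq_iff)
    then show ?case by (intro cint_cong) simp
  next
    case (step m)
    have "restrict (cube_face m m t x) {..<k} = restrict x {..<k}" for t x
      using step.hyps by (auto simp: restrict_def cube_face_def fun_eq_iff)
    then have "cint (Suc m) (\<lambda>x. G (restrict x {..<k})) = cint m (\<lambda>x. G (restrict x {..<k}))"
      using step.hyps by (subst cint_Fubini[OF cont, of m m]) auto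
    then show ?case using step.IH by (rule trans)
  qed
qed

text \<open>The first \<open>k\<close> coordinates of a vector, in the order given by \<open>e\<close>. This is the bridge between cubes of
  variable dimension and a Euclidean space whose dimension is part of its type.\<close>

definition coords :: "(nat \<Rightarrow> 'n) \<Rightarrow> nat \<Rightarrow> real ^ 'n \<Rightarrow> nat \<Rightarrow> real" where
  "coords e k y = (\<lambda>i\<in>{..<k}. y $ e i)"

lemma coords_in_cube: "y \<in> cbox 0 1 \<Longrightarrow> coords e k y \<in> cube k"
  by (auto simp: coords_def cube_iff mem_box_cart)

lemma continuous_on_coords: "continuous_on S (coords e k)"
proof (rule continuous_on_coordinatewise_then_product)
  fix i
  show "continuous_on S (\<lambda>y. coords e k y i)"
    by (cases "i < k") (auto simp: coords_def intro!: continuous_intros)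
qed

lemma cint_eq_integral:
  fixes e :: "nat \<Rightarrow> 'n::finite"
  assumes e: "bij_betw e {..<n} UNIV" and G: "continuous_on (cube n) G"
  shows "cint n G = integral (cbox 0 1) (\<lambda>y :: real ^ 'n. G (coords e n y))"
proof -
  let ?B = "Basis :: (real ^ 'n) set"
  let ?S = "\<lambda>w. \<Sum>b\<in>?B. w b *\<^sub>R b"
  define f where "f i = (axis (e i) 1 :: real ^ 'n)" for i
  have e_inj: "e i = e j \<longleftrightarrow> i = j" if "i < n" "j < n" for i j
    using e that by (auto simp: bij_betw_def inj_on_def)
  have f: "bij_betw f {..<n} ?B"
  proof (rule bij_betw_imageI)
    show "inj_on f {..<n}" by (auto simp: inj_on_def f_def axis_eq_axis e_inj)
    have "f ` {..<n} = (\<lambda>v. axis v 1) ` (e ` {..<n})" by (auto simp: f_def)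
    then show "f ` {..<n} = ?B" using e by (auto simp: bij_betw_def Basis_vec_def)
  qed
  have nth: "?S w $ v = w (axis v 1)" for w v
  proof -
    have "?S w $ v = (\<Sum>b\<in>?B. w b *\<^sub>R b) \<bullet> axis v 1"
      by (simp add: cart_eq_inner_axis)
    also have "\<dots> = w (axis v 1)"
      by (subst inner_sum_left_Basis) (auto simp: axis_in_Basis_iff)
    finally show ?thesis .
  qed
  have coords: "coords e n (?S w) = (\<lambda>i\<in>{..<n}. w (f i))" for w
    by (simp only: coords_def nth f_def)
  have in_box: "?S w \<in> cbox 0 1 \<longleftrightarrow> (\<lambda>i\<in>{..<n}. w (f i)) \<in> cube n" for w
  proof -
    have "?S w \<in> cbox 0 1 \<longleftrightarrow> (\<forall>v\<in>e ` {..<n}. 0 \<le> w (axis v 1) \<and> w (axis v 1) \<le> 1)"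
      using e unfolding mem_box_cart nth by (simp add: bij_betw_def)
    also have "\<dots> \<longleftrightarrow> (\<lambda>i\<in>{..<n}. w (f i)) \<in> cube n"
      by (auto simp: cube_iff f_def)
    finally show ?thesis .
  qed
  have cont: "continuous_on (cbox 0 1) (\<lambda>y :: real ^ 'n. G (coords e n y))"
    by (rule continuous_on_compose2[OF G continuous_on_coords]) (auto intro: coords_in_cube)
  have cont_meas: "(\<lambda>y. indicator (cbox 0 1) y *\<^sub>R G (coords e n y)) \<in> borel_measurable borel"
    by (intro borel_measurable_continuous_on_indicator cont) auto
  have meas: "(\<lambda>\<omega>. \<lambda>i\<in>{..<n}. \<omega> (f i)) \<in> measurable (PiM ?B (\<lambda>_. lborel :: real measure)) (PiM {..<n} (\<lambda>_. lborel))"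
    using f by (intro measurable_restrict measurable_component_singleton) (auto simp: bij_betw_def)
  have "cint n G = (\<integral>x. indicator (cube n) x *\<^sub>R G x \<partial>distr (PiM ?B (\<lambda>_. lborel)) (PiM {..<n} (\<lambda>_. lborel)) (\<lambda>\<omega>. \<lambda>i\<in>{..<n}. \<omega> (f i)))"
    by (simp add: distr_PiM_lborel_reindex[OF f] cint_def set_lebesgue_integral_def)
  also have "\<dots> = (\<integral>w. indicator (cube n) (\<lambda>i\<in>{..<n}. w (f i)) *\<^sub>R G (\<lambda>i\<in>{..<n}. w (f i)) \<partial>PiM ?B (\<lambda>_. lborel))"
    by (rule integral_distr[OF meas cube_indicator_measurable[OF G]])
  also have "\<dots> = (\<integral>w. indicator (cbox 0 1) (?S w) *\<^sub>R G (coords e n (?S w)) \<partial>PiM ?B (\<lambda>_. lborel))"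
    by (intro Bochner_Integration.integral_cong) (auto simp: indicator_def in_box coords)
  also have "\<dots> = (\<integral>y. indicator (cbox 0 1) y *\<^sub>R G (coords e n y) \<partial>distr (PiM ?B (\<lambda>_. lborel)) borel ?S)"
    by (rule integral_distr[symmetric, OF _ cont_meas]) measurable
  also have "\<dots> = (LINT y:cbox 0 1|lborel. G (coords e n y))"
    by (simp add: lborel_eq[symmetric] set_lebesgue_integral_def)
  also have "\<dots> = integral (cbox 0 1) (\<lambda>y. G (coords e n y))"
    by (intro set_borel_integral_eq_integral) (unfold set_integrable_def, intro borel_integrable_compact compact_cbox cont)
  finally show ?thesis .
qed

text \<open>The Leibniz formula is transported along the numbering \<open>e\<close> of the index type; renaming the points does
  not change the sign of a permutation.\<close>

lemma det_eq_sqdet: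
  fixes M :: "real ^ 'n ^ 'n"
  assumes e: "bij_betw e {..<n} (UNIV :: 'n::finite set)"
  shows "Determinants.det M = sqdet n (\<lambda>i j. M $ e i $ e j)"
proof -
  have inj: "inj_on e {..<n}" using e by (simp add: bij_betw_def)
  define g where "g = inv_into {..<n} e"
  have g: "bij_betw g UNIV {..<n}" unfolding g_def by (rule bij_betw_inv_into[OF e])
  let ?\<Phi> = "map_permutation {..<n} e"
  have bij: "bij_betw ?\<Phi> {p. p permutes {..<n}} {p. p permutes (UNIV :: 'n set)}"
  proof (rule bij_betw_byWitness[where f'="map_permutation UNIV g"])
    show "\<forall>p\<in>{p. p permutes {..<n}}. map_permutation UNIV g (?\<Phi> p) = p"
      using map_permutation_compose_inv[of e "{..<n}" UNIV _ g] e
      by (auto simp: g_def bij_betw_def)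
    show "\<forall>p\<in>{p. p permutes UNIV}. ?\<Phi> (map_permutation UNIV g p) = p"
      using map_permutation_compose_inv[of g UNIV "{..<n}" _ e] g e
      by (auto simp: g_def bij_betw_def f_inv_into_f)
    show "?\<Phi> ` {p. p permutes {..<n}} \<subseteq> {p. p permutes UNIV}"
      using map_permutation_permutes e by blast
    show "map_permutation UNIV g ` {p. p permutes UNIV} \<subseteq> {p. p permutes {..<n}}"
      using map_permutation_permutes g by blast
  qed
  have "Determinants.det M = (\<Sum>p | p permutes {..<n}. of_int (sign (?\<Phi> p)) * (\<Prod>v\<in>UNIV. M $ v $ ?\<Phi> p v))"
    unfolding Determinants.det_def by (rule sum.reindex_bij_betw[OF bij, symmetric])
  also have "\<dots> = (\<Sum>p | p permutes {..<n}. of_int (sign p) * (\<Prod>i<n. M $ e i $ e (p i)))"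
  proof (intro sum.cong refl arg_cong2[of _ _ _ _ "(*)"])
    fix p assume p: "p \<in> {p. p permutes {..<n}}"
    show "real_of_int (sign (?\<Phi> p)) = real_of_int (sign p)"
      using sign_map_permutation[OF inj] p by simp
    show "(\<Prod>v\<in>UNIV. M $ v $ ?\<Phi> p v) = (\<Prod>i<n. M $ e i $ e (p i))"
      by (subst prod.reindex_bij_betw[OF e, symmetric])
         (auto intro!: prod.cong simp: map_permutation_apply[OF inj])
  qed
  finally show ?thesis by (simp add: sqdet_perm)
qed

text \<open>The determinant of a block matrix with blocks \<open>A\<close> and \<open>1\<close>.\<close>

lemma sqdet_block:
  assumes "k \<le> n"
  shows "sqdet n (\<lambda>i j. if i < k then (if j < k then A i j else 0) else if i = j then 1 else 0) = sqdet k A"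
  using assms
proof (induction n rule: dec_induct)
  case base
  show ?case by (rule sqdet_cong) simp
next
  case (step n)
  let ?B = "\<lambda>i j. if i < k then (if j < k then A i j else 0) else if i = j then 1 else 0 :: real"
  have "sqdet n (\<lambda>r c. ?B (skip n r) (skip n c)) = sqdet n ?B"
    by (rule sqdet_cong) (simp add: skip_def)
  then have "sqdet (Suc n) ?B = sqdet n ?B"
    using step.hyps by (subst sqdet_expand_row[of n]) (simp_all add: mult.commute flip: power_add)
  then show ?case using step.IH by simp
qed

lemma coords_has_derivative:
  assumes f: "cube_C1 k (f :: _ \<Rightarrow> real)" and y: "(y :: real ^ 'n::finite) \<in> cbox 0 1"
  shows "((\<lambda>y. f (coords e k y)) has_derivative
    (\<lambda>h. \<Sum>l<k. cube_partial f l (coords e k y) * h $ e l)) (at y within cbox 0 1)"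
  unfolding has_derivative_within_alt2
proof (intro conjI allI impI)
  let ?F = "at y within cbox 0 1"
  let ?x = "coords e k y"
  show "bounded_linear (\<lambda>h :: real ^ 'n. \<Sum>l<k. cube_partial f l ?x * h $ e l)"
    by (intro bounded_linear_sum bounded_linear_const_mult bounded_linear_vec_nth)
  fix r :: real assume r: "r > 0"
  have ev: "eventually (\<lambda>z. z \<in> cbox 0 1) ?F" by (simp add: eventually_at_filter)
  have ev': "eventually (\<lambda>z. coords e k z \<in> cube k) ?F"
    using ev by eventually_elim (rule coords_in_cube)
  have "((\<lambda>z. coords e k z i) \<longlongrightarrow> ?x i) ?F" if "i < k" for i
    using that by (auto simp: coords_def intro!: tendsto_intros)
  with cube_slopes[OF f coords_in_cube[OF y] ev'] obtain Q where
    Q: "\<And>z. coords e k z \<in> cube k \<Longrightarrow> f (coords e k z) - f ?x = (\<Sum>l<k. Q z l * (coords e k z l - ?x l))"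
      "\<And>l. l < k \<Longrightarrow> ((\<lambda>z. Q z l) \<longlongrightarrow> cube_partial f l ?x) ?F"
    by blast
  have "((\<lambda>z. \<Sum>l<k. \<bar>Q z l - cube_partial f l ?x\<bar>) \<longlongrightarrow> (\<Sum>l<k. \<bar>cube_partial f l ?x - cube_partial f l ?x\<bar>)) ?F"
    by (intro tendsto_intros Q(2)) auto
  then have "eventually (\<lambda>z. (\<Sum>l<k. \<bar>Q z l - cube_partial f l ?x\<bar>) < r) ?F"
    using r by (intro order_tendstoD(2)[of _ 0]) auto
  then show "eventually (\<lambda>z. norm (f (coords e k z) - f ?x - (\<Sum>l<k. cube_partial f l ?x * (z - y) $ e l))
      \<le> r * norm (z - y)) ?F"
    using ev'
  proof eventually_elim
    case (elim z)
    have "f (coords e k z) - f ?x - (\<Sum>l<k. cube_partial f l ?x * (z - y) $ e l) =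
        (\<Sum>l<k. (Q z l - cube_partial f l ?x) * (z - y) $ e l)"
      unfolding Q(1)[OF elim(2)] sum_subtractf[symmetric]
      by (intro sum.cong) (auto simp: coords_def algebra_simps)
    also have "norm \<dots> \<le> (\<Sum>l<k. \<bar>Q z l - cube_partial f l ?x\<bar> * norm (z - y))"
      by (rule order_trans[OF norm_sum])
         (auto intro!: sum_mono mult_left_mono component_le_norm_cart simp: abs_mult simp del: vector_minus_component)
    also have "\<dots> \<le> r * norm (z - y)"
      unfolding sum_distrib_right[symmetric] using elim(1) by (intro mult_right_mono) auto
    finally show ?case .
  qed
qed

text \<open>The change of variables theorem for \<open>\<real>\<^sup>n\<close>, applied to the product of \<open>\<psi>\<close> with the identity on the
  remaining \<open>n - k\<close> coordinates; this map permutes the unit cube of \<open>\<real>\<^sup>n\<close> and has the Jacobian determinant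
  of \<open>\<psi>\<close>. Since that determinant has constant sign \<open>s\<close>, its absolute value is \<open>s\<close> times the determinant.\<close>

lemma cint_change_of_variables:
  assumes \<psi>: "cube_diffeo k s \<psi>" and \<phi>: "continuous_on (cube k) \<phi>"
    and card: "k \<le> CARD('n::{finite,wellorder})"
  shows "cint k (\<lambda>x. \<phi> (\<psi> x) * sqdet k (jac \<psi> x)) = s * cint k \<phi>"
proof -
  define n where "n = CARD('n)"
  obtain e :: "nat \<Rightarrow> 'n" where e: "bij_betw e {..<n} UNIV"
    using ex_bij_betw_nat_finite[of "UNIV :: 'n set"] by (auto simp: n_def atLeast0LessThan)
  have kn: "k \<le> n" using card by (simp add: n_def)
  have e_inj: "e i = e j \<longleftrightarrow> i = j" if "i < n" "j < n" for i j
    using inj_on_eq_iff[OF bij_betw_imp_inj_on[OF e]] that by simp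
  define idx where "idx = inv_into {..<n} e"
  have idx: "idx (e i) = i" if "i < n" for i
    using e that by (simp add: idx_def bij_betw_def)
  have e_idx: "e (idx v) = v" "idx v < n" for v
    using e by (auto simp: idx_def bij_betw_def f_inv_into_f) (metis UNIV_I inv_into_into lessThan_iff)
  have s: "s \<in> {1, -1}" and bij: "bij_betw \<psi> (cube k) (cube k)"
    and C1: "\<And>i. i < k \<Longrightarrow> cube_C1 k (\<lambda>x. \<psi> x i)"
    and J: "\<And>x. x \<in> cube k \<Longrightarrow> sgn (sqdet k (jac \<psi> x)) = s"
    using \<psi> by (auto simp: cube_diffeo_iff)
  have maps: "\<psi> x \<in> cube k" if "x \<in> cube k" for x using bij that by (auto simp: bij_betw_def)
  let ?R = "coords e k"
  define \<Psi> :: "real ^ 'n::_ \<Rightarrow> real ^ 'n::_" where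
    "\<Psi> y = (\<chi> v. if idx v < k then \<psi> (?R y) (idx v) else y $ v)" for y
  define \<Psi>' :: "real ^ 'n::_ \<Rightarrow> real ^ 'n::_ \<Rightarrow> real ^ 'n::_" where
    "\<Psi>' y h = (\<chi> v. if idx v < k then \<Sum>l<k. jac \<psi> (?R y) (idx v) l * h $ e l else h $ v)" for y h
  have integral_eq: "cint k G = integral (cbox 0 1) (\<lambda>y :: real ^ 'n::_. G (?R y))"
    if "continuous_on (cube k) G" for G
  proof -
    have "restrict (coords e n y) {..<k} = ?R y" for y
      using kn by (auto simp: coords_def restrict_def fun_eq_iff)
    then show ?thesis
      using cint_restrict[OF that kn] cint_eq_integral[OF e cint_restrict(2)[OF that kn]] by simp
  qed
  have R_\<Psi>: "?R (\<Psi> y) = \<psi> (?R y)" if "y \<in> cbox 0 1" for y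
  proof
    fix i
    have "\<psi> (?R y) i = undefined" if "i \<ge> k"
      using maps[OF coords_in_cube[OF \<open>y \<in> cbox 0 1\<close>]] that by (simp add: cube_iff)
    then show "?R (\<Psi> y) i = \<psi> (?R y) i"
      using idx[of i] kn by (auto simp: coords_def \<Psi>_def not_less)
  qed
  have \<Psi>_box: "\<Psi> y \<in> cbox 0 1" if y: "y \<in> cbox 0 1" for y
    using maps[OF coords_in_cube[OF y, of e k]] y unfolding mem_box_cart \<Psi>_def
    by (auto simp: cube_iff)
  have R_eq: "y = z" if "?R y = ?R z" "\<And>v. \<not> idx v < k \<Longrightarrow> y $ v = z $ v" for y z
  proof (rule Finite_Cartesian_Product.vec_eq_iff[THEN iffD2], rule allI)
    fix v
    show "y $ v = z $ v"
    proof (cases "idx v < k")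
      case True
      then show ?thesis using fun_cong[OF that(1), of "idx v"] e_idx(1)[of v] by (simp add: coords_def)
    qed (rule that)
  qed
  have inj: "inj_on \<Psi> (cbox 0 1)"
  proof (rule inj_onI)
    fix y z assume yz: "y \<in> cbox 0 1" "z \<in> cbox 0 1" "\<Psi> y = \<Psi> z"
    have "\<psi> (?R y) = \<psi> (?R z)" using R_\<Psi>[OF yz(1)] R_\<Psi>[OF yz(2)] yz(3) by simp
    then have "?R y = ?R z"
      using inj_onD[OF bij_betw_imp_inj_on[OF bij]] coords_in_cube yz(1,2) by blast
    moreover have "y $ v = z $ v" if "\<not> idx v < k" for v
      using arg_cong[OF yz(3), of "\<lambda>y. y $ v"] that by (simp add: \<Psi>_def)
    ultimately show "y = z" by (rule R_eq)
  qed
  have image: "\<Psi> ` cbox 0 1 = cbox 0 1"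
  proof
    show "cbox 0 1 \<subseteq> \<Psi> ` cbox 0 1"
    proof
      fix z :: "real ^ 'n::_" assume z: "z \<in> cbox 0 1"
      obtain x where x: "x \<in> cube k" "\<psi> x = ?R z"
        using bij_betw_imp_surj_on[OF bij] coords_in_cube[OF z, of e k] by (metis imageE)
      define y where "y = (\<chi> v. if idx v < k then x (idx v) else z $ v)"
      have y: "y \<in> cbox 0 1" using x(1) z by (auto simp: y_def mem_box_cart cube_iff)
      have Ry: "?R y = x"
        using x(1) kn idx by (auto simp: coords_def y_def cube_iff fun_eq_iff)
      have "\<Psi> y = z"
      proof (rule R_eq)
        show "?R (\<Psi> y) = ?R z" using R_\<Psi>[OF y] Ry x(2) by simp
      qed (simp add: \<Psi>_def y_def)
      with y show "z \<in> \<Psi> ` cbox 0 1" by blast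
    qed
  qed (simp add: image_subset_iff \<Psi>_box)
  have der: "(\<Psi> has_derivative \<Psi>' y) (at y within cbox 0 1)" if y: "y \<in> cbox 0 1" for y
  proof (subst has_derivative_componentwise_within, rule ballI)
    fix b :: "real ^ 'n::_" assume "b \<in> Basis"
    then obtain v where b: "b = axis v 1" by (auto simp: Basis_vec_def)
    show "((\<lambda>y. \<Psi> y \<bullet> b) has_derivative (\<lambda>h. \<Psi>' y h \<bullet> b)) (at y within cbox 0 1)"
    proof (cases "idx v < k")
      case True
      then show ?thesis
        using coords_has_derivative[OF C1[OF True] y, of e]
        by (simp add: b inner_axis \<Psi>_def \<Psi>'_def jac_def)
    next
      case False
      then show ?thesis
        by (simp add: b inner_axis \<Psi>_def \<Psi>'_def bounded_linear_imp_has_derivative bounded_linear_vec_nth)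
    qed
  qed
  have det: "Determinants.det (matrix (\<Psi>' y)) = sqdet k (jac \<psi> (?R y))" for y
  proof -
    have "matrix (\<Psi>' y) $ e i $ e j = (if i < k then (if j < k then jac \<psi> (?R y) i j else 0) else if i = j then 1 else 0)"
      if "i < n" "j < n" for i j
    proof -
      have "e l = e j \<longleftrightarrow> l = j" if "l < k" for l
        using e_inj[of l j] \<open>j < n\<close> that kn by simp
      moreover have "e i = e j \<longleftrightarrow> i = j"
        by (rule e_inj[OF that])
      ultimately show ?thesis
        using that idx by (auto simp: matrix_def \<Psi>'_def axis_def if_distrib[of "\<lambda>x. _ * x"] cong: if_cong)
    qed
    then have "Determinants.det (matrix (\<Psi>' y)) = sqdet n (\<lambda>i j. if i < k then (if j < k then jac \<psi> (?R y) i j else 0) else if i = j then 1 else 0)"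
      unfolding det_eq_sqdet[OF e] by (intro sqdet_cong)
    then show ?thesis using sqdet_block[OF kn] by simp
  qed
  have cont: "continuous_on (cbox 0 1) (\<lambda>y :: real ^ 'n::_. \<phi> (?R y))"
    by (rule continuous_on_compose2[OF \<phi> continuous_on_coords]) (auto intro: coords_in_cube)
  let ?f = "\<lambda>y :: real ^ 'n::_. (\<chi> i. \<phi> (?R y)) :: real ^ 1"
  have "continuous_on (cbox 0 1) ?f"
    by (intro continuous_on_vec_lambda cont)
  then have "?f absolutely_integrable_on \<Psi> ` cbox 0 1"
    unfolding image by (rule absolutely_integrable_continuous)
  then have "integral (cbox 0 1) (\<lambda>y. \<bar>Determinants.det (matrix (\<Psi>' y))\<bar> *\<^sub>R ?f (\<Psi> y)) = integral (\<Psi> ` cbox 0 1) ?f"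
    using has_absolute_integral_change_of_variables[OF lmeasurable_cbox[THEN fmeasurableD] der inj,
        of ?f "integral (\<Psi> ` cbox 0 1) ?f"] by simp
  then have "integral (cbox 0 1) (\<lambda>y. \<bar>sqdet k (jac \<psi> (?R y))\<bar> * \<phi> (?R (\<Psi> y))) = integral (cbox 0 1) (\<lambda>y. \<phi> (?R y))"
    unfolding image integral_on_1_eq det by (simp add: Finite_Cartesian_Product.vec_eq_iff)
  also have "integral (cbox 0 1) (\<lambda>y. \<bar>sqdet k (jac \<psi> (?R y))\<bar> * \<phi> (?R (\<Psi> y))) =
      integral (cbox 0 1) (\<lambda>y. s * (\<phi> (\<psi> (?R y)) * sqdet k (jac \<psi> (?R y))))"
  proof (rule integral_cong)
    fix y :: "real ^ 'n::_" assume y: "y \<in> cbox 0 1"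
    show "\<bar>sqdet k (jac \<psi> (?R y))\<bar> * \<phi> (?R (\<Psi> y)) = s * (\<phi> (\<psi> (?R y)) * sqdet k (jac \<psi> (?R y)))"
      using J[OF coords_in_cube[OF y, of e k]] R_\<Psi>[OF y] by (simp add: abs_sgn)
  qed
  also have "\<dots> = s * cint k (\<lambda>x. \<phi> (\<psi> x) * sqdet k (jac \<psi> x))"
  proof -
    have "continuous_on (cube k) \<psi>"
      by (rule continuous_on_cube_valued[where k=k]) (auto intro: cube_C1_D(1)[OF C1] maps)
    then have "continuous_on (cube k) (\<lambda>x. \<phi> (\<psi> x) * sqdet k (jac \<psi> x))"
      by (intro continuous_on_mult continuous_on_compose2[OF \<phi>] continuous_on_sqdet)
         (auto simp: jac_def intro!: maps cube_C1_D(3)[OF C1])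
    then show ?thesis by (simp add: integral_eq)
  qed
  finally have "s * cint k (\<lambda>x. \<phi> (\<psi> x) * sqdet k (jac \<psi> x)) = cint k \<phi>"
    using integral_eq[OF \<phi>] by simp
  then show ?thesis using s by auto
qed

section \<open>Pullback of differential forms\<close>

lemma finite_multi_indices: "finite (multi_indices k :: 'n::{finite,wellorder} list set)"
  by (rule finite_subset[OF _ finite_lists_length_eq[of "UNIV :: 'n set" k]])
     (auto simp: multi_indices_def)

lemma multi_indices_empty:
  assumes "CARD('n::{finite,wellorder}) < k"
  shows "multi_indices k = ({} :: 'n list set)"
proof -
  have "length I \<le> CARD('n)" if "sorted_wrt (<) I" for I :: "'n list"
    using that distinct_card[of I] card_mono[of UNIV "set I"] by (simp add: strict_sorted_iff)
  then show ?thesis using assms by (force simp: multi_indices_def)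
qed

definition remove_nth :: "nat \<Rightarrow> 'a list \<Rightarrow> 'a list" where
  "remove_nth r J = take r J @ drop (Suc r) J"

lemma remove_nth_nth:
  "r < length J \<Longrightarrow> i < length J - 1 \<Longrightarrow> remove_nth r J ! i = J ! skip r i"
  by (auto simp: remove_nth_def nth_append skip_def min_def)

lemma remove_nth_multi_index:
  assumes "J \<in> multi_indices (Suc k)" "r \<le> k"
  shows "remove_nth r J \<in> multi_indices k" "set (remove_nth r J) = set J - {J ! r}"
proof -
  have J: "J = take r J @ J ! r # drop (Suc r) J"
    using assms by (intro id_take_nth_drop) (simp add: multi_indices_def)
  have sorted: "sorted_wrt (<) J" and len: "length J = Suc k"
    using assms by (auto simp: multi_indices_def)
  have "sorted_wrt (<) (take r J @ J ! r # drop (Suc r) J)" using sorted J by simp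
  then have s: "sorted_wrt (<) (take r J @ drop (Suc r) J)" "J ! r \<notin> set (take r J @ drop (Suc r) J)"
    by (auto simp: sorted_wrt_append)
  then show "remove_nth r J \<in> multi_indices k"
    using len assms(2) by (simp add: remove_nth_def multi_indices_def)
  have "set J = insert (J ! r) (set (take r J @ drop (Suc r) J))"
    by (subst J) simp
  with s(2) show "set (remove_nth r J) = set J - {J ! r}"
    by (simp add: remove_nth_def)
qed

lemma multi_indices_eqI:
  "I \<in> multi_indices k \<Longrightarrow> J \<in> multi_indices l \<Longrightarrow> set I = set J \<Longrightarrow> I = J"
  by (auto simp: multi_indices_def intro: strict_sorted_equal)

text \<open>Deleting an entry of an increasing list remembers as much as the list and the position: the list is
  recovered by inserting the deleted value in order.\<close>

lemma remove_nth_bij: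
  "bij_betw (\<lambda>(J, r). (remove_nth r J, J ! r)) (multi_indices (Suc k) \<times> {..k})
    {(I, v :: 'n::{finite,wellorder}). I \<in> multi_indices k \<and> v \<notin> set I}"
proof (rule bij_betw_imageI)
  show "inj_on (\<lambda>(J, r). (remove_nth r J, J ! r)) (multi_indices (Suc k) \<times> {..k} :: ('n list \<times> nat) set)"
  proof (rule inj_onI, clarsimp)
    fix J J' :: "'n list" and r r'
    assume J: "J \<in> multi_indices (Suc k)" "J' \<in> multi_indices (Suc k)" and r: "r \<le> k" "r' \<le> k"
      and eq: "remove_nth r J = remove_nth r' J'" "J ! r = J' ! r'"
    have in_set: "J ! r \<in> set J" "J' ! r' \<in> set J'"
      using J r by (auto simp: multi_indices_def)
    have "set J = insert (J ! r) (set (remove_nth r J))"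
      using remove_nth_multi_index(2)[OF J(1) r(1)] in_set by blast
    also have "\<dots> = insert (J' ! r') (set (remove_nth r' J'))" using eq by simp
    also have "\<dots> = set J'"
      using remove_nth_multi_index(2)[OF J(2) r(2)] in_set by blast
    finally have "J = J'" by (rule multi_indices_eqI[OF J])
    moreover have "distinct J" using J by (simp add: multi_indices_def strict_sorted_iff)
    ultimately show "J = J' \<and> r = r'"
      using eq(2) r J by (auto simp: multi_indices_def nth_eq_iff_index_eq)
  qed
  show "(\<lambda>(J, r). (remove_nth r J, J ! r)) ` (multi_indices (Suc k) \<times> {..k}) =
      {(I, v :: 'n). I \<in> multi_indices k \<and> v \<notin> set I}"
  proof (intro Set.equalityI subsetI)
    fix p :: "'n list \<times> 'n" assume "p \<in> {(I, v). I \<in> multi_indices k \<and> v \<notin> set I}"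
    then obtain I v where p: "p = (I, v)" and I: "I \<in> multi_indices k" "v \<notin> set I" by auto
    define J where "J = sorted_list_of_set (insert v (set I))"
    have set_J: "set J = insert v (set I)"
      unfolding J_def by (rule set_sorted_list_of_set) simp
    have "card (set I) = k"
      using I by (auto simp: multi_indices_def strict_sorted_iff distinct_card)
    moreover have sorted_J: "sorted_wrt (<) J"
      unfolding J_def by (rule strict_sorted_list_of_set)
    ultimately have J: "J \<in> multi_indices (Suc k)"
      using I(2) distinct_card[of J] by (simp add: set_J multi_indices_def strict_sorted_iff)
    obtain r where r: "r < length J" "J ! r = v"
      using set_J by (metis in_set_conv_nth insertI1)
    then have rk: "r \<le> k" using J by (simp add: multi_indices_def)
    have "set (remove_nth r J) = set I"
      using remove_nth_multi_index(2)[OF J rk] set_J r(2) I(2) by auto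
    then have "remove_nth r J = I"
      using remove_nth_multi_index(1)[OF J rk] I(1) multi_indices_eqI by blast
    then show "p \<in> (\<lambda>(J, r). (remove_nth r J, J ! r)) ` (multi_indices (Suc k) \<times> {..k})"
      using J rk r(2) p by (intro image_eqI[of _ _ "(J, r)"]) auto
  next
    fix p :: "'n list \<times> 'n"
    assume "p \<in> (\<lambda>(J, r). (remove_nth r J, J ! r)) ` (multi_indices (Suc k) \<times> {..k})"
    then obtain J r where "p = (remove_nth r J, J ! r)" "J \<in> multi_indices (Suc k)" "r \<le> k" by auto
    then show "p \<in> {(I, v). I \<in> multi_indices k \<and> v \<notin> set I}"
      using remove_nth_multi_index[of J k r] by simp
  qed
qed

text \<open>With \<open>\<alpha>\<^sub>I = \<Sum>\<^sub>v D\<^sub>I\<^sub>v dx\<^sup>v\<close>, this says that the coefficients of \<open>\<Sum>\<^sub>I \<alpha>\<^sub>I \<and> dx\<^sup>I\<close> in the basis of increasing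
  multi-indices are the sums over \<open>r\<close>, evaluated on the vectors given by \<open>B\<close>. On the right, terms with \<open>v\<close>
  in \<open>I\<close> have two equal rows. In the others, \<open>v\<close> and \<open>I\<close> merge to an increasing list \<open>J\<close>
  with \<open>v\<close> at a position \<open>r\<close>, and moving that row to the front costs the sign \<open>(-1)\<^sup>r\<close>.\<close>

lemma wedge_row_expansion:
  fixes B :: "nat \<Rightarrow> 'n::{finite,wellorder} \<Rightarrow> real" and D :: "'n list \<Rightarrow> 'n \<Rightarrow> real"
  shows "(\<Sum>J\<in>multi_indices (Suc k). (\<Sum>r\<le>k. (-1) ^ r * D (remove_nth r J) (J ! r)) *
      sqdet (Suc k) (\<lambda>i j. B j (J ! i))) =
    (\<Sum>I\<in>multi_indices k. sqdet (Suc k)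
      (\<lambda>i j. if i = 0 then \<Sum>v\<in>UNIV. D I v * B j v else B j (I ! (i - 1))))"
proof -
  define W where "W I v = sqdet (Suc k) (\<lambda>i j. if i = 0 then B j v else B j (I ! (i - 1)))" for I v
  have W_0: "W I v = 0" if I: "I \<in> multi_indices k" and v: "v \<in> set I" for I v
  proof -
    obtain i where "i < k" "I ! i = v"
      using I v by (auto simp: in_set_conv_nth multi_indices_def)
    then show ?thesis
      unfolding W_def by (intro sqdet_repeated_row[of 0 _ "Suc i"]) auto
  qed
  have W_J: "sqdet (Suc k) (\<lambda>i j. B j (J ! i)) = (-1) ^ r * W (remove_nth r J) (J ! r)"
    if J: "J \<in> multi_indices (Suc k)" and r: "r \<le> k" for J r
    unfolding W_def sqdet_row_to_front[OF r, of "\<lambda>i j. B j (J ! i)"]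
    by (intro arg_cong2[of _ _ _ _ "(*)"] refl sqdet_cong)
       (use J r in \<open>auto simp: remove_nth_nth multi_indices_def\<close>)
  have "(\<Sum>J\<in>multi_indices (Suc k). (\<Sum>r\<le>k. (-1) ^ r * D (remove_nth r J) (J ! r)) *
      sqdet (Suc k) (\<lambda>i j. B j (J ! i))) =
    (\<Sum>J\<in>multi_indices (Suc k). \<Sum>r\<le>k. D (remove_nth r J) (J ! r) * W (remove_nth r J) (J ! r))"
    unfolding sum_distrib_right
  proof (intro sum.cong refl)
    fix J :: "'n list" and r assume "J \<in> multi_indices (Suc k)" "r \<in> {..k}"
    then have "sqdet (Suc k) (\<lambda>i j. B j (J ! i)) = (-1) ^ r * W (remove_nth r J) (J ! r)"
      by (intro W_J) auto
    moreover have "(-1) ^ r * d * ((-1) ^ r * w) = d * (w :: real)" for d w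
      by (simp add: minus_one_power_iff)
    ultimately show "(-1) ^ r * D (remove_nth r J) (J ! r) * sqdet (Suc k) (\<lambda>i j. B j (J ! i)) =
        D (remove_nth r J) (J ! r) * W (remove_nth r J) (J ! r)" by simp
  qed
  also have "\<dots> = (\<Sum>(J, r)\<in>multi_indices (Suc k) \<times> {..k}.
      (\<lambda>(I, v). D I v * W I v) ((\<lambda>(J, r). (remove_nth r J, J ! r)) (J, r)))"
    by (simp add: sum.cartesian_product)
  also have "\<dots> = (\<Sum>(I, v)\<in>{(I, v). I \<in> multi_indices k \<and> v \<notin> set I}. D I v * W I v)"
    using sum.reindex_bij_betw[OF remove_nth_bij, of "\<lambda>(I, v). D I v * W I v" k]
    by (simp add: case_prod_beta')
  also have "\<dots> = (\<Sum>(I, v)\<in>multi_indices k \<times> UNIV. D I v * W I v)"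
    by (rule sum.mono_neutral_left) (auto simp: W_0 finite_multi_indices)
  also have "\<dots> = (\<Sum>I\<in>multi_indices k. \<Sum>v\<in>UNIV. D I v * W I v)"
    by (simp add: sum.cartesian_product)
  finally show ?thesis
    by (simp add: W_def sqdet_first_row_sum)
qed

lemma cube_C1_nth:
  fixes f :: "(nat \<Rightarrow> real) \<Rightarrow> real ^ 'n::finite"
  assumes f: "cube_C1 m f"
  shows "cube_C1 m (\<lambda>x. f x $ v)"
    and "\<And>j x. j < m \<Longrightarrow> x \<in> cube m \<Longrightarrow> cube_partial (\<lambda>x. f x $ v) j x = cube_partial f j x $ v"
    and "\<And>j x. j < m \<Longrightarrow> x \<in> cube m \<Longrightarrow>
      ((\<lambda>t. f (x(j := t))) has_vector_derivative cube_partial f j x) (at (x j) within {0..1})"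
proof -
  show line: "((\<lambda>t. f (x(j := t))) has_vector_derivative cube_partial f j x) (at (x j) within {0..1})"
    if "j < m" "x \<in> cube m" for j x
    using f that by (simp add: cube_C1_def cube_partial_def vector_derivative_works[symmetric])
  have D: "has_cube_partial m j (\<lambda>x. f x $ v) (\<lambda>x. cube_partial f j x $ v)" if "j < m" for j
    unfolding has_cube_partial_def has_real_derivative_iff_has_vector_derivative
    using line[OF that] bounded_linear.has_vector_derivative[OF bounded_linear_vec_nth] by blast
  show "cube_C1 m (\<lambda>x. f x $ v)"
    by (rule cube_C1_I[OF _ D]) (use f in \<open>auto simp: cube_C1_def intro!: continuous_intros\<close>)
  show "cube_partial (\<lambda>x. f x $ v) j x = cube_partial f j x $ v" if "j < m" "x \<in> cube m" for j x
    by (rule cube_partial_unique[OF D that]) (rule that)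
qed

lemma cube_partial_vec:
  fixes h :: "(nat \<Rightarrow> real) \<Rightarrow> real ^ 'n::finite"
  assumes d: "\<And>v. has_cube_partial m j (\<lambda>x. h x $ v) (d v)" and j: "j < m" and x: "x \<in> cube m"
  shows "cube_partial h j x $ v = d v x"
proof -
  have "((\<lambda>t. h (x(j := t))) has_vector_derivative (\<chi> v. d v x)) (at (x j) within {0..1})"
    unfolding has_vector_derivative_def
  proof (subst has_derivative_componentwise_within, rule ballI)
    fix b :: "real ^ 'n" assume "b \<in> Basis"
    then obtain v where b: "b = axis v 1" by (auto simp: Basis_vec_def)
    show "((\<lambda>t. h (x(j := t)) \<bullet> b) has_derivative (\<lambda>t. (t *\<^sub>R (\<chi> v. d v x)) \<bullet> b)) (at (x j) within {0..1})"
      using d[of v] x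
      by (simp add: b inner_axis has_cube_partial_def has_field_derivative_def mult_commute_abs)
  qed
  then show ?thesis
    using cube_partial_eq[of h x j] cubeD[OF x j] by simp
qed

text \<open>The chain rule with a derivative relative to \<open>S\<close>: the cell maps into \<open>S\<close>, so differentiability of \<open>u\<close>
  within \<open>S\<close> is what is composed, also at boundary points.\<close>

lemma C1_on_compose_cube:
  fixes f :: "(nat \<Rightarrow> real) \<Rightarrow> real ^ 'n::finite" and u :: "real ^ 'n \<Rightarrow> real"
  assumes u: "C1_on S u" and f: "cube_C1 m f" and maps: "f ` cube m \<subseteq> S"
  shows "cube_C1 m (\<lambda>x. u (f x))"
    and "\<And>j x. j < m \<Longrightarrow> x \<in> cube m \<Longrightarrow> cube_partial (\<lambda>x. u (f x)) j x =
      (\<Sum>v\<in>UNIV. frechet_derivative u (at (f x) within S) (axis v 1) * cube_partial f j x $ v)"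
proof -
  let ?L = "\<lambda>x. frechet_derivative u (at (f x) within S)"
  let ?D = "\<lambda>j x. \<Sum>v\<in>UNIV. ?L x (axis v 1) * cube_partial f j x $ v"
  have f_cont: "continuous_on (cube m) f" using f by (simp add: cube_C1_def)
  have D: "has_cube_partial m j (\<lambda>x. u (f x)) (?D j)" if j: "j < m" for j
    unfolding has_cube_partial_def
  proof
    fix x assume x: "x \<in> cube m"
    let ?d = "cube_partial f j x"
    have "u differentiable (at (f x) within S)"
      using u maps x by (auto simp: C1_on_def differentiable_on_def)
    then have L: "(u has_derivative ?L x) (at (f x) within S)"
      by (simp add: frechet_derivative_works)
    have "(\<lambda>t. f (x(j := t))) ` {0..1} \<subseteq> S"
      using maps cube_upd[OF x j] by auto
    with L have L': "(u has_derivative ?L x) (at (f (x(j := x j))) within (\<lambda>t. f (x(j := t))) ` {0..1})"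
      by (simp add: has_derivative_subset)
    have lin: "linear (?L x)" using L has_derivative_linear by blast
    have "?d = (\<Sum>v\<in>UNIV. ?d $ v *\<^sub>R axis v 1)"
      using basis_expansion[of ?d] by (simp add: scalar_mult_eq_scaleR)
    then have "?L x ?d = ?L x (\<Sum>v\<in>UNIV. ?d $ v *\<^sub>R axis v 1)" by simp
    also have "\<dots> = ?D j x"
      by (simp add: linear_sum[OF lin] linear_scale[OF lin] mult.commute)
    finally have scale: "?L x (h *\<^sub>R ?d) = ?D j x * h" for h
      by (simp add: linear_scale[OF lin])
    have "((\<lambda>t. u (f (x(j := t)))) has_derivative (\<lambda>h. ?L x (h *\<^sub>R ?d))) (at (x j) within {0..1})"
      by (rule has_derivative_in_compose[OF cube_C1_nth(3)[OF f j x, unfolded has_vector_derivative_def] L'])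
    then show "((\<lambda>t. u (f (x(j := t)))) has_real_derivative ?D j x) (at (x j) within {0..1})"
      unfolding scale has_field_derivative_def .
  qed
  have u_cont: "continuous_on S u"
    using u by (simp add: C1_on_def differentiable_imp_continuous_on)
  have L_cont: "continuous_on (cube m) (\<lambda>x. ?L x w)" for w
    using u maps by (intro continuous_on_compose2[OF _ f_cont, of S "\<lambda>y. frechet_derivative u (at y within S) w"])
      (auto simp: C1_on_def)
  show "cube_C1 m (\<lambda>x. u (f x))"
    by (rule cube_C1_I[OF _ D])
       (use f in \<open>auto simp: cube_C1_def intro!: continuous_intros L_cont continuous_on_compose2[OF u_cont f_cont] maps\<close>)
  show "cube_partial (\<lambda>x. u (f x)) j x = ?D j x" if "j < m" "x \<in> cube m" for j x
    by (rule cube_partial_unique[OF D that]) (rule that)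
qed

text \<open>The coefficient of the pullback of \<open>a\<close> along \<open>f\<close> with respect to \<open>dx\<^sub>0 \<and> \<dots> \<and> dx\<^sub>k\<^sub>-\<^sub>1\<close>.\<close>

definition pullback ::
  "nat \<Rightarrow> ((nat \<Rightarrow> real) \<Rightarrow> real ^ 'n::{finite,wellorder}) \<Rightarrow> 'n form \<Rightarrow> (nat \<Rightarrow> real) \<Rightarrow> real" where
  "pullback k f a x = (\<Sum>I\<in>multi_indices k. a I (f x) * sqdet k (\<lambda>i j. cube_partial f j x $ (I ! i)))"

lemma cell_integral_eq: "cell_integral \<tau> a = corient \<tau> * cint (cdim \<tau>) (pullback (cdim \<tau>) (cmap \<tau>) a)"
  by (simp add: cell_integral_def cint_def pullback_def[abs_def] jacobian_minor_def sqdet_def)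

lemma pullback_continuous:
  assumes a: "a \<in> forms \<Omega> k" and f: "cube_C1 k f" "f ` cube k \<subseteq> \<Omega>"
  shows "continuous_on (cube k) (pullback k f a)"
  unfolding pullback_def[abs_def]
proof (intro continuous_on_sum continuous_on_mult continuous_on_sqdet)
  fix I assume "I \<in> (multi_indices k :: 'a list set)"
  then have "C1_on \<Omega> (a I)" using a by (simp add: forms_def)
  from cube_C1_D(1)[OF C1_on_compose_cube(1)[OF this f]]
  show "continuous_on (cube k) (\<lambda>x. a I (f x))" .
qed (use f in \<open>auto simp: cube_C1_def intro!: continuous_intros\<close>)

text \<open>Pulling back commutes with the exterior derivative, in the form
  \<open>f\<^sup>* (d a) = \<Sum>\<^sub>I d (a\<^sub>I \<circ> f) \<and> df\<^sup>I\<close>, which makes sense for maps of class \<open>C\<^sup>1\<close>.\<close>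

lemma pullback_ext_deriv:
  assumes a: "a \<in> forms \<Omega> k" and f: "cube_C1 (Suc k) f" "f ` cube (Suc k) \<subseteq> \<Omega>"
    and x: "x \<in> cube (Suc k)"
  shows "pullback (Suc k) f (ext_deriv \<Omega> k a) x = (\<Sum>I\<in>multi_indices k. sqdet (Suc k)
      (\<lambda>i j. cube_partial (if i = 0 then (\<lambda>x. a I (f x)) else (\<lambda>x. f x $ (I ! (i - 1)))) j x))"
proof -
  define D where "D I v = frechet_derivative (a I) (at (f x) within \<Omega>) (axis v 1)" for I v
  have "f x \<in> \<Omega>" using f(2) x by blast
  then have "pullback (Suc k) f (ext_deriv \<Omega> k a) x =
      (\<Sum>J\<in>multi_indices (Suc k). (\<Sum>r\<le>k. (-1) ^ r * D (remove_nth r J) (J ! r)) *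
        sqdet (Suc k) (\<lambda>i j. cube_partial f j x $ (J ! i)))"
    by (simp add: pullback_def ext_deriv_def D_def remove_nth_def cong: sum.cong)
  also have "\<dots> = (\<Sum>I\<in>multi_indices k. sqdet (Suc k)
      (\<lambda>i j. if i = 0 then \<Sum>v\<in>UNIV. D I v * cube_partial f j x $ v else cube_partial f j x $ (I ! (i - 1))))"
    by (rule wedge_row_expansion)
  also have "\<dots> = (\<Sum>I\<in>multi_indices k. sqdet (Suc k)
      (\<lambda>i j. cube_partial (if i = 0 then (\<lambda>x. a I (f x)) else (\<lambda>x. f x $ (I ! (i - 1)))) j x))"
  proof (intro sum.cong refl sqdet_cong)
    fix I :: "'a list" and i j assume "I \<in> multi_indices k" and j: "j < Suc k"
    then have "C1_on \<Omega> (a I)" using a by (simp add: forms_def)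
    from C1_on_compose_cube(2)[OF this f j x] cube_C1_nth(2)[OF f(1) j x]
    show "(if i = 0 then \<Sum>v\<in>UNIV. D I v * cube_partial f j x $ v else cube_partial f j x $ (I ! (i - 1))) =
        cube_partial (if i = 0 then (\<lambda>x. a I (f x)) else (\<lambda>x. f x $ (I ! (i - 1)))) j x"
      by (simp add: D_def)
  qed
  finally show ?thesis .
qed

lemma cube_partial_face:
  assumes "j \<le> k" "c < k"
  shows "cube_partial (f \<circ> cube_face k j e) c x = cube_partial f (skip j c) (cube_face k j e x)"
proof -
  have "cube_face k j e (x(c := t)) = (cube_face k j e x)(skip j c := t)" for t
    using assms by (auto simp: cube_face_def skip_def fun_eq_iff)
  moreover have "cube_face k j e x (skip j c) = x c"
    using assms by (auto simp: cube_face_def skip_def)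
  ultimately show ?thesis by (simp add: cube_partial_def)
qed

lemma stokes_pullback:
  assumes a: "a \<in> forms \<Omega> k" and f: "cube_C1 (Suc k) f" "f ` cube (Suc k) \<subseteq> \<Omega>"
  shows "cint (Suc k) (pullback (Suc k) f (ext_deriv \<Omega> k a)) =
    (\<Sum>j<Suc k. \<Sum>e\<in>{0, 1}. face_sign j e * cint k (pullback k (f \<circ> cube_face k j e) a))"
proof -
  let ?g = "\<lambda>I x. a I (f x)"
  let ?h = "\<lambda>I i x. f x $ (I ! i)"
  have g: "cube_C1 (Suc k) (?g I)" if "I \<in> multi_indices k" for I
    using a that C1_on_compose_cube(1)[OF _ f] by (auto simp: forms_def)
  have h: "cube_C1 (Suc k) (?h I i)" for I i by (rule cube_C1_nth(1)[OF f(1)])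
  let ?face = "\<lambda>I j e x. ?g I (cube_face k j e x) *
      sqdet k (\<lambda>r c. cube_partial (?h I r) (skip j c) (cube_face k j e x))"
  have face_cont: "continuous_on (cube k) (?face I j e)"
    if "I \<in> multi_indices k" "j < Suc k" "e \<in> {0, 1}" for I j and e :: real
    using that by (intro continuous_on_mult continuous_on_sqdet cube_face_continuous' cube_C1_D g h)
      (auto simp: skip_def)
  have pull: "cint k (pullback k (f \<circ> cube_face k j e) a) = (\<Sum>I\<in>multi_indices k. cint k (?face I j e))"
    if j: "j < Suc k" and e: "e \<in> {0, 1}" for j and e :: real
  proof -
    have "pullback k (f \<circ> cube_face k j e) a x = (\<Sum>I\<in>multi_indices k. ?face I j e x)"
      if x: "x \<in> cube k" for x
      unfolding pullback_def
    proof (intro sum.cong refl arg_cong2[of _ _ _ _ "(*)"] sqdet_cong)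
      fix I :: "'a list" and r c assume rc: "r < k" "c < k"
      have "cube_face k j e x \<in> cube (Suc k)"
        using x j e by (intro cube_face_in_cube) auto
      moreover have "skip j c < Suc k" using rc by (simp add: skip_def)
      ultimately show "cube_partial (f \<circ> cube_face k j e) c x $ (I ! r) =
          cube_partial (?h I r) (skip j c) (cube_face k j e x)"
        using j rc by (simp add: cube_partial_face cube_C1_nth(2)[OF f(1)])
    qed simp
    then show ?thesis
      by (simp add: cint_cong[of k "pullback k (f \<circ> cube_face k j e) a"] cint_sum face_cont j e del: insert_iff)
  qed
  have "cint (Suc k) (pullback (Suc k) f (ext_deriv \<Omega> k a)) =
      cint (Suc k) (\<lambda>x. \<Sum>I\<in>multi_indices k. sqdet (Suc k)
        (\<lambda>i j. cube_partial (if i = 0 then ?g I else ?h I (i - 1)) j x))"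
    by (rule cint_cong) (rule pullback_ext_deriv[OF a f])
  also have "\<dots> = (\<Sum>I\<in>multi_indices k. cint (Suc k) (\<lambda>x. sqdet (Suc k)
        (\<lambda>i j. cube_partial (if i = 0 then ?g I else ?h I (i - 1)) j x)))"
    by (rule cint_sum) (auto intro!: continuous_on_sqdet cube_C1_D(3) g h)
  also have "\<dots> = (\<Sum>I\<in>multi_indices k. \<Sum>j<Suc k. \<Sum>e\<in>{0, 1}. face_sign j e * cint k (?face I j e))"
    by (intro sum.cong refl cube_stokes g h)
  also have "\<dots> = (\<Sum>j<Suc k. \<Sum>e\<in>{0, 1}. \<Sum>I\<in>multi_indices k. face_sign j e * cint k (?face I j e))"
    by (subst sum.swap, intro sum.cong refl, rule sum.swap)
  also have "\<dots> = (\<Sum>j<Suc k. \<Sum>e\<in>{0, 1}. face_sign j e * cint k (pullback k (f \<circ> cube_face k j e) a))"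
    by (intro sum.cong refl) (simp only: pull lessThan_iff sum_distrib_left)
  finally show ?thesis .
qed

lemma pullback_reparam:
  fixes f g :: "(nat \<Rightarrow> real) \<Rightarrow> real ^ 'n::{finite,wellorder}"
  assumes re: "reparam k s f g" and a: "a \<in> forms \<Omega> k"
    and f: "cube_C1 k f" "f ` cube k \<subseteq> \<Omega>" and card: "k \<le> CARD('n)"
  shows "cint k (pullback k g a) = s * cint k (pullback k f a)"
proof -
  obtain \<psi> where \<psi>: "cube_diffeo k s \<psi>" and g: "\<And>x. x \<in> cube k \<Longrightarrow> g x = f (\<psi> x)"
    using re by (auto simp: reparam_def)
  have maps: "\<psi> x \<in> cube k" if "x \<in> cube k" for x
    using \<psi> that by (auto simp: cube_diffeo_iff bij_betw_def)
  have C1: "cube_C1 k (\<lambda>x. \<psi> x i)" if "i < k" for i using \<psi> that by (auto simp: cube_diffeo_iff)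
  have "pullback k g a x = pullback k f a (\<psi> x) * sqdet k (jac \<psi> x)" if x: "x \<in> cube k" for x
  proof -
    have "cube_partial g j x $ v = (\<Sum>l<k. cube_partial f l (\<psi> x) $ v * jac \<psi> x l j)" if j: "j < k" for j v
    proof (rule cube_partial_vec[OF _ j x])
      fix v
      have comp: "cube_C1 k (\<lambda>x. f (\<psi> x) $ v)"
        by (rule cube_C1_compose(1)[OF cube_C1_nth(1)[OF f(1)] C1 maps])
      show "has_cube_partial k j (\<lambda>x. g x $ v) (\<lambda>x. \<Sum>l<k. cube_partial f l (\<psi> x) $ v * jac \<psi> x l j)"
      proof (rule has_cube_partial_cong[OF cube_C1_D(2)[OF comp j] j])
        fix x assume x: "x \<in> cube k"
        show "(\<Sum>l<k. cube_partial f l (\<psi> x) $ v * jac \<psi> x l j) = cube_partial (\<lambda>x. f (\<psi> x) $ v) j x"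
          using cube_C1_compose(2)[OF cube_C1_nth(1)[OF f(1)] C1 maps j x, of v]
          by (simp add: cube_C1_nth(2)[OF f(1)] maps x jac_def)
      qed (simp add: g)
    qed
    then have "sqdet k (\<lambda>i j. cube_partial g j x $ (I ! i)) =
        sqdet k (\<lambda>i j. cube_partial f j (\<psi> x) $ (I ! i)) * sqdet k (jac \<psi> x)" for I
      unfolding sqdet_mult[symmetric] by (intro sqdet_cong) simp
    then show ?thesis
      by (simp add: pullback_def g x sum_distrib_right mult.assoc)
  qed
  then have "cint k (pullback k g a) = cint k (\<lambda>x. pullback k f a (\<psi> x) * sqdet k (jac \<psi> x))"
    by (rule cint_cong)
  also have "\<dots> = s * cint k (pullback k f a)"
    by (rule cint_change_of_variables[OF \<psi> pullback_continuous[OF a f] card])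
  finally show ?thesis .
qed

section \<open>Stokes' theorem for chains and the commuting projection\<close>

text \<open>Two parametrizations that reparametrize to the same map are reparametrizations of each other. This
  is where inverses of diffeomorphisms enter.\<close>

lemma reparam_common:
  assumes "reparam k s f h" "reparam k s' g h"
  shows "reparam k (s' * s) f g"
proof -
  obtain \<psi> \<phi> where \<psi>: "cube_diffeo k s \<psi>" "\<And>x. x \<in> cube k \<Longrightarrow> h x = f (\<psi> x)"
    and \<phi>: "cube_diffeo k s' \<phi>" "\<And>x. x \<in> cube k \<Longrightarrow> h x = g (\<phi> x)"
    using assms unfolding reparam_def by blast
  let ?\<theta> = "inv_into (cube k) \<phi>"
  have \<theta>: "?\<theta> x \<in> cube k" "\<phi> (?\<theta> x) = x" if "x \<in> cube k" for x
    using \<phi>(1) that by (auto simp: cube_diffeo_iff bij_betw_def inv_into_into f_inv_into_f)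
  have "cube_diffeo k (s * s') (\<psi> \<circ> ?\<theta>)"
    by (intro cube_diffeo_compose \<psi> cube_diffeo_inverse \<phi>)
  moreover have "g x = f ((\<psi> \<circ> ?\<theta>) x)" if "x \<in> cube k" for x
    using \<psi>(2)[OF \<theta>(1)[OF that]] \<phi>(2)[OF \<theta>(1)[OF that]] \<theta>(2)[OF that] by simp
  ultimately show ?thesis unfolding reparam_def by (metis mult.commute)
qed

lemma reparam_sign: "reparam k s f g \<Longrightarrow> s = 1 \<or> s = -1"
  by (auto simp: reparam_def cube_diffeo_iff)

text \<open>Exactly one cell of the complex represents the face \<open>x\<^sub>j = e\<close> of \<open>\<tau>\<close>: the complex has one by the face
  axiom, and by \<open>reparam_common\<close> two of them would be the same geometric cell. The two orientation signs
  of that cell cancel against each other, and the sign of the reparametrization against the one from the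
  change of variables. When \<open>k\<close> exceeds the dimension of the space, all \<open>k\<close>-forms vanish.\<close>

lemma face_incidence_sum:
  fixes \<Omega> :: "(real ^ 'n::{finite,wellorder}) set"
  assumes D: "cell_complex \<Omega> D" and \<tau>: "\<tau> \<in> D" "cdim \<tau> = Suc k"
    and j: "j < Suc k" and e: "e \<in> {0, 1}" and a: "a \<in> forms \<Omega> k"
  shows "(\<Sum>\<sigma>\<in>{\<sigma>\<in>D. cdim \<sigma> = k}. face_incidence \<tau> j e \<sigma> * cell_integral \<sigma> a) =
    corient \<tau> * (face_sign j e * cint k (pullback k (face_map \<tau> j e) a))"
proof (cases "k \<le> CARD('n)")
  case False
  then have "pullback k f a = (\<lambda>_. 0)" for f :: "(nat \<Rightarrow> real) \<Rightarrow> real ^ 'n::_"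
    by (simp add: pullback_def[abs_def] multi_indices_empty)
  then show ?thesis by (simp add: cell_integral_eq cint_def)
next
  case True
  have fin: "finite D" and cells: "\<And>\<sigma>. \<sigma> \<in> D \<Longrightarrow> cell_in \<Omega> \<sigma>"
    and unique: "\<And>\<sigma> \<rho> s. \<sigma> \<in> D \<Longrightarrow> \<rho> \<in> D \<Longrightarrow> cdim \<sigma> = cdim \<rho> \<Longrightarrow>
      reparam (cdim \<rho>) s (cmap \<rho>) (cmap \<sigma>) \<Longrightarrow> \<sigma> = \<rho>"
    using D unfolding cell_complex_def by blast+
  have "\<exists>\<sigma>\<in>D. Suc (cdim \<sigma>) = cdim \<tau> \<and> (\<exists>s. reparam (cdim \<sigma>) s (cmap \<sigma>) (face_map \<tau> j e))"
    using D \<tau> j e unfolding cell_complex_def by auto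
  then obtain \<rho> s where \<rho>: "\<rho> \<in> D" "cdim \<rho> = k" "reparam k s (cmap \<rho>) (face_map \<tau> j e)"
    using \<tau>(2) by auto
  have zero: "face_incidence \<tau> j e \<sigma> = 0" if "\<sigma> \<in> D" "cdim \<sigma> = k" "\<sigma> \<noteq> \<rho>" for \<sigma>
  proof -
    have "\<not> reparam k s' (cmap \<sigma>) (face_map \<tau> j e)" for s'
      using unique[OF \<rho>(1) that(1)] reparam_common[of k s' "cmap \<sigma>" _ s "cmap \<rho>"] \<rho> that by metis
    then show ?thesis using that by (simp add: face_incidence_def)
  qed
  have "(\<Sum>\<sigma>\<in>{\<sigma>\<in>D. cdim \<sigma> = k}. face_incidence \<tau> j e \<sigma> * cell_integral \<sigma> a) =
      (\<Sum>\<sigma>\<in>{\<rho>}. face_incidence \<tau> j e \<sigma> * cell_integral \<sigma> a)"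
    by (rule sum.mono_neutral_right) (use fin \<rho> zero in auto)
  also have "\<dots> = face_incidence \<tau> j e \<rho> * cell_integral \<rho> a" by simp
  also have "\<dots> = corient \<tau> * (face_sign j e * cint k (pullback k (face_map \<tau> j e) a))"
  proof -
    have \<rho>_in: "cube_C1 k (cmap \<rho>)" "cmap \<rho> ` cube k \<subseteq> \<Omega>" "corient \<rho> * corient \<rho> = 1"
      using cells[OF \<rho>(1)] \<rho>(2) by (auto simp: cell_in_def carrier_of_def)
    have re: "cint k (pullback k (face_map \<tau> j e) a) = s' * cint k (pullback k (cmap \<rho>) a)"
      if "reparam k s' (cmap \<rho>) (face_map \<tau> j e)" for s'
      by (rule pullback_reparam[OF that a \<rho>_in(1,2) True])
    \<comment> \<open>A degenerate cell may be related to the face with both signs; \<open>s\<close> and the sign used by \<open>face_incidence\<close>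
      may then differ, but the integral formula holds for each of them.\<close>
    define s' :: real where "s' = (if reparam k 1 (cmap \<rho>) (face_map \<tau> j e) then 1 else -1)"
    have s': "reparam k s' (cmap \<rho>) (face_map \<tau> j e)"
      using \<rho>(3) reparam_sign[OF \<rho>(3)] by (auto simp: s'_def)
    have "face_incidence \<tau> j e \<rho> = corient \<tau> * face_sign j e * corient \<rho> * s'"
      using s' by (auto simp: face_incidence_def \<rho>(2) s'_def split: if_splits)
    then show ?thesis
      using \<rho>_in(3) by (simp add: re[OF s'] cell_integral_eq \<rho>(2) mult_ac)
  qed
  finally show ?thesis .
qed

lemma cell_stokes:
  assumes D: "cell_complex \<Omega> D" and \<tau>: "\<tau> \<in> D" "cdim \<tau> = Suc k" and a: "a \<in> forms \<Omega> k"
  shows "(\<Sum>\<sigma>\<in>D. incidence \<tau> \<sigma> * cell_integral \<sigma> a) = cell_integral \<tau> (ext_deriv \<Omega> k a)"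
proof -
  let ?D = "{\<sigma>\<in>D. cdim \<sigma> = k}"
  have fin: "finite D" and cell: "cell_in \<Omega> \<tau>"
    using D \<tau> by (auto simp: cell_complex_def)
  have "(\<Sum>\<sigma>\<in>D. incidence \<tau> \<sigma> * cell_integral \<sigma> a) = (\<Sum>\<sigma>\<in>?D. incidence \<tau> \<sigma> * cell_integral \<sigma> a)"
    by (rule sum.mono_neutral_right) (use fin \<tau> in \<open>auto simp: incidence_def\<close>)
  also have "\<dots> = (\<Sum>\<sigma>\<in>?D. \<Sum>j<Suc k. \<Sum>e\<in>{0, 1}. face_incidence \<tau> j e \<sigma> * cell_integral \<sigma> a)"
    by (intro sum.cong refl) (use \<tau> in \<open>simp only: incidence_def sum_distrib_right mem_Collect_eq if_True simp_thms\<close>)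
  also have "\<dots> = (\<Sum>j<Suc k. \<Sum>e\<in>{0, 1}. \<Sum>\<sigma>\<in>?D. face_incidence \<tau> j e \<sigma> * cell_integral \<sigma> a)"
    by (subst sum.swap, intro sum.cong refl, rule sum.swap)
  also have "\<dots> = (\<Sum>j<Suc k. \<Sum>e\<in>{0, 1}. corient \<tau> * (face_sign j e * cint k (pullback k (face_map \<tau> j e) a)))"
    by (intro sum.cong refl face_incidence_sum[OF D \<tau> _ _ a]) auto
  also have "\<dots> = corient \<tau> * (\<Sum>j<Suc k. \<Sum>e\<in>{0, 1}. face_sign j e * cint k (pullback k (cmap \<tau> \<circ> cube_face k j e) a))"
    using \<tau>(2) by (simp only: sum_distrib_left face_map_def diff_Suc_1)
  also have "\<dots> = corient \<tau> * cint (Suc k) (pullback (Suc k) (cmap \<tau>) (ext_deriv \<Omega> k a))"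
    using cell \<tau>(2) by (subst stokes_pullback[OF a]) (auto simp: cell_in_def carrier_of_def)
  also have "\<dots> = cell_integral \<tau> (ext_deriv \<Omega> k a)"
    using \<tau>(2) by (simp add: cell_integral_eq)
  finally show ?thesis .
qed

lemma boundary_in_chains:
  assumes "c \<in> chains D (Suc k)"
  shows "boundary D c \<in> chains D k"
  using assms by (auto simp: chains_def boundary_def incidence_def intro!: sum.neutral)

lemma chain_stokes:
  assumes D: "cell_complex \<Omega> D" and c: "c \<in> chains D (Suc k)" and a: "a \<in> forms \<Omega> k"
  shows "chain_integral D (boundary D c) a = chain_integral D c (ext_deriv \<Omega> k a)"
proof -
  have "chain_integral D (boundary D c) a = (\<Sum>\<sigma>\<in>D. \<Sum>\<tau>\<in>D. c \<tau> * (incidence \<tau> \<sigma> * cell_integral \<sigma> a))"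
    unfolding chain_integral_def boundary_def
    by (intro sum.cong refl) (simp add: sum_distrib_right mult.assoc)
  also have "\<dots> = (\<Sum>\<tau>\<in>D. c \<tau> * (\<Sum>\<sigma>\<in>D. incidence \<tau> \<sigma> * cell_integral \<sigma> a))"
    by (subst sum.swap) (simp add: sum_distrib_left)
  also have "\<dots> = chain_integral D c (ext_deriv \<Omega> k a)"
    unfolding chain_integral_def
  proof (rule sum.cong[OF refl])
    fix \<tau> assume \<tau>: "\<tau> \<in> D"
    show "c \<tau> * (\<Sum>\<sigma>\<in>D. incidence \<tau> \<sigma> * cell_integral \<sigma> a) = c \<tau> * cell_integral \<tau> (ext_deriv \<Omega> k a)"
    proof (cases "cdim \<tau> = Suc k")
      case True
      then show ?thesis using cell_stokes[OF D \<tau> _ a] by simp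
    next
      case False
      then have "c \<tau> = 0" using c by (simp add: chains_def)
      then show ?thesis by simp
    qed
  qed
  finally show ?thesis .
qed

lemma reduction_cochain: "reduction D k a \<in> cochains D k"
proof -
  have "(\<lambda>\<tau>. r * c \<tau> + s * c' \<tau>) \<in> chains D k" if "c \<in> chains D k" "c' \<in> chains D k" for c c' r s
    using that by (auto simp: chains_def)
  then show ?thesis
    by (auto simp: cochains_def reduction_def chain_integral_def sum.distrib sum_distrib_left
        distrib_right mult.assoc)
qed

lemma coboundary_reduction:
  assumes "cell_complex \<Omega> D" "a \<in> forms \<Omega> k"
  shows "coboundary D k (reduction D k a) = reduction D (Suc k) (ext_deriv \<Omega> k a)"
  using chain_stokes[OF assms(1) _ assms(2)] boundary_in_chains
  by (auto simp: coboundary_def reduction_def fun_eq_iff)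

theorem lemma1:
  fixes \<Omega> :: "(real ^ 'n::{finite,wellorder}) set"
    and D :: "'n cell set"
    and \<Lambda>\<^sub>h :: "nat \<Rightarrow> 'n form set"
    and \<I> :: "nat \<Rightarrow> 'n cochain \<Rightarrow> 'n form"
    and k :: nat and a :: "'n form"
  assumes "compact_manifold \<Omega>"
    and "cell_complex \<Omega> D"
    and "reconstruction \<Omega> D \<Lambda>\<^sub>h \<I>"
    and "a \<in> forms \<Omega> k"
  shows "ext_deriv \<Omega> k (projection D \<I> k a) = projection D \<I> (Suc k) (ext_deriv \<Omega> k a)"
proof -
  have "ext_deriv \<Omega> k (\<I> k (reduction D k a)) = \<I> (Suc k) (coboundary D k (reduction D k a))"
    using assms(3) reduction_cochain[of D k a] by (simp add: reconstruction_def)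
  then show ?thesis
    by (simp add: projection_def coboundary_reduction[OF assms(2,4)])
qed

end
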